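(* Let $\mathbb{A}$ be a symmetric strict monoidal category, let $\mathsf{T}(\mathbb{A})$ be the spatial strict monoidal category presented by the generators and equations given in the context, and let $\mathbf{H}\,\mathcal{C}(\mathbb{A})$ be the category of horizontal cells of the free cornering of $\mathbb{A}$. Then there is an isomorphism of categories $\mathbf{H}\,\mathcal{C}(\mathbb{A})\cong\mathsf{T}(\mathbb{A})$.
   Context: Single-object double categories. A single-object double category $\mathbb{D}$ consists of a monoid $(\mathbb{D}_H,\otimes,I)$ of horizontal edges, a monoid $(\mathbb{D}_V,\otimes,I)$ of vertical edges, and cells $\alpha$, each with a top and a bottom boundary in $\mathbb{D}_H$ and a left and a right boundary in $\mathbb{D}_V$. If the right boundary of $\alpha$ equals the left boundary of $\beta$ there is a horizontal composite $\alpha\vert\beta$ (top/bottom boundaries are multiplied in the order $\alpha,\beta$; left boundary that of $\alpha$, right boundary that of $\beta$). If the bottom boundary of $\alpha$ equals the top boundary of $\beta$ there is a vertical composite $\frac{\alpha}{\beta}$ (left/right boundaries multiplied in the order $\alpha,\beta$; top that of $\alpha$, bottom that of $\beta$). Both compositions are associative and unital, with identity cells $1_A$ for $A\in\mathbb{D}_H$ (top $=$ bottom $=A$, left $=$ right $=I$; identities for vertical composition) and $1_X$ for $X\in\mathbb{D}_V$ (left $=$ right $=X$, top $=$ bottom $=I$; identities for horizontal composition), with $1_A\vert 1_B=1_{A\otimes B}$, $\frac{1_X}{1_Y}=1_{X\otimes Y}$, the two identity cells on $I$ coincide, and the interchange law $\frac{\alpha}{\beta}\big\vert\frac{\gamma}{\delta}=\frac{\alpha\vert\gamma}{\beta\vert\delta}$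 holds. Horizontal cells. $\mathbf{H}\mathbb{D}$ is the strict monoidal category with object set $\mathbb{D}_V$, whose morphisms $X\to Y$ are cells with left boundary $X$, right boundary $Y$ and top and bottom boundary $I$; composition is horizontal composition, and the tensor product is vertical composition, $h\otimes k=\frac{h}{k}$. Free cornering. For a symmetric strict monoidal category $\mathbb{A}$ (with object set $\mathbb{A}_0$ and braiding $\sigma_{A,B}:A\otimes B\to B\otimes A$), $\mathcal{C}(\mathbb{A})$ is the free single-object double category determined by: horizontal edge monoid $(\mathbb{A}_0,\otimes,I)$; vertical edge monoid the free monoid $\mathbb{A}^{\circ\bullet}=(\mathbb{A}_0\times\{\circ,\bullet\})^*$, with generators written $A^\circ$, $A^\bullet$, product written $\otimes$ and unit $I$; generating cells, for each $A\in\mathbb{A}_0$, the corners (boundaries not mentioned are $I$) - $s^\circ_A$: top $A$, right $A^\circ$; $\quad r^\circ_A$: left $A^\circ$, bottom $A$; - $s^\bullet_A$: top $A$, left $A^\bullet$; $\quad r^\bullet_A$: right $A^\bullet$, bottom $A$; and, for each morphism $f:A\to B$ of $\mathbb{A}$, a cell $\ulcorner f\urcorner$ with top $A$, bottom $B$; subject to the yanking equations $s^\circ_A\vert r^\circ_A=1_A$, $\frac{r^\circ_A}{s^\circ_A}=1_{A^\circ}$, $r^\bullet_A\vert s^\bullet_A=1_A$, $\frac{r^\bullet_A}{s^\bullet_A}=1_{A^\bullet}$, and the equations $\frac{\ulcorner f\urcorner}{\ulcorner g\urcorner}=\ulcorner f;g\urcorner$ (for composable $f,g$; $f;g$ is "first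 $f$ then $g$"), $\ulcorner 1_A\urcorner=1_A$, $\ulcorner f\urcorner\vert\ulcorner g\urcorner=\ulcorner f\otimes g\urcorner$. The category $\mathsf{T}(\mathbb{A})$. A strict monoidal category is spatial if $h\otimes 1_X=1_X\otimes h$ for every object $X$ and $h:I\to I$. $\mathsf{T}(\mathbb{A})$ is the free spatial strict monoidal category with generating objects $A^\circ,A^\bullet$ for $A\in\mathbb{A}_0$, and generating morphisms, for all $A,B\in\mathbb{A}_0$ and $f:A\to B$ in $\mathbb{A}$: $f^\circ:A^\circ\to B^\circ$; $f^\bullet:B^\bullet\to A^\bullet$; $\triangleleft_{A,B}:(A\otimes B)^\circ\to A^\circ\otimes B^\circ$; $\triangleright_{A,B}:A^\circ\otimes B^\circ\to(A\otimes B)^\circ$; $\blacktriangleleft_{A,B}:(A\otimes B)^\bullet\to A^\bullet\otimes B^\bullet$; $\blacktriangleright_{A,B}:A^\bullet\otimes B^\bullet\to(A\otimes B)^\bullet$; $\iota^\circ:I\to I^\circ$; $\kappa^\circ:I^\circ\to I$; $\iota^\bullet:I\to I^\bullet$; $\kappa^\bullet:I^\bullet\to I$; $\sigma^\circ_{A,B}:A^\circ\otimes B^\circ\to B^\circ\otimes A^\circ$; $\sigma^\bullet_{A,B}:A^\bullet\otimes B^\bullet\to B^\bullet\otimes A^\bullet$; $\eta_A:I\to A^\bullet\otimes A^\circ$; $\varepsilon_A:A^\circ\otimes A^\bullet\to I$. The equations are as follows (composition written $;$ in diagrammatic order, $1$ denoting identities of the evident type, for all objects and morphisms of $\mathbb{A}$).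 In (1)–(6) the equations are stated for $\circ$; the same equations are also imposed with $\triangleleft,\triangleright,\iota^\circ,\kappa^\circ,\sigma^\circ$ replaced by $\blacktriangleleft,\blacktriangleright,\iota^\bullet,\kappa^\bullet,\sigma^\bullet$, $A^\circ$ by $A^\bullet$, and $f^\circ:A^\circ\to B^\circ$ by $f^\bullet:B^\bullet\to A^\bullet$. (1) $\triangleleft_{A,B};\triangleright_{A,B}=1$; $\triangleright_{A,B};\triangleleft_{A,B}=1$; $(\triangleright_{A,B}\otimes 1);\triangleright_{A\otimes B,C}=(1\otimes\triangleright_{B,C});\triangleright_{A,B\otimes C}$; $\triangleleft_{A\otimes B,C};(\triangleleft_{A,B}\otimes 1)=\triangleleft_{A,B\otimes C};(1\otimes\triangleleft_{B,C})$. (2) $\iota^\circ;\kappa^\circ=1$; $\kappa^\circ;\iota^\circ=1$. (3) $(\iota^\circ\otimes 1);\triangleright_{I,A}=1$; $(1\otimes\iota^\circ);\triangleright_{A,I}=1$; $\triangleleft_{I,A};(\kappa^\circ\otimes 1)=1$; $\triangleleft_{A,I};(1\otimes\kappa^\circ)=1$; $\iota^\circ;\triangleleft_{I,I}=\iota^\circ\otimes\iota^\circ$; $\triangleright_{I,I};\kappa^\circ=\kappa^\circ\otimes\kappa^\circ$. (4) $(f^\circ\otimes 1);\sigma^\circ=\sigma^\circ;(1\otimes f^\circ)$; $(1\otimes f^\circ);\sigma^\circ=\sigma^\circ;(f^\circ\otimes 1)$. (5) $(\triangleright_{A,B}\otimes 1);\sigma^\circ_{A\otimes B,C}=(1\otimes\sigma^\circ_{B,C});(\sigma^\circ_{A,C}\otimes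 1);(1\otimes\triangleright_{A,B})$; $(1\otimes\triangleright_{B,C});\sigma^\circ_{A,B\otimes C}=(\sigma^\circ_{A,B}\otimes 1);(1\otimes\sigma^\circ_{A,C});(\triangleright_{B,C}\otimes 1)$; $\sigma^\circ_{A\otimes B,C};(1\otimes\triangleleft_{A,B})=(\triangleleft_{A,B}\otimes 1);(1\otimes\sigma^\circ_{B,C});(\sigma^\circ_{A,C}\otimes 1)$; $\sigma^\circ_{A,B\otimes C};(\triangleleft_{B,C}\otimes 1)=(1\otimes\triangleleft_{B,C});(\sigma^\circ_{A,B}\otimes 1);(1\otimes\sigma^\circ_{A,C})$. (6) $(\iota^\circ\otimes 1);\sigma^\circ_{I,A}=1\otimes\iota^\circ$; $(1\otimes\iota^\circ);\sigma^\circ_{A,I}=\iota^\circ\otimes 1$; $\sigma^\circ_{I,A};(1\otimes\kappa^\circ)=\kappa^\circ\otimes 1$; $\sigma^\circ_{A,I};(\kappa^\circ\otimes 1)=1\otimes\kappa^\circ$. (7) $(1_{A^\circ}\otimes\eta_A);(\varepsilon_A\otimes 1_{A^\circ})=1_{A^\circ}$; $(\eta_A\otimes 1_{A^\bullet});(1_{A^\bullet}\otimes\varepsilon_A)=1_{A^\bullet}$; for $f:A\to B$: $\eta_A;(1\otimes f^\circ)=\eta_B;(f^\bullet\otimes 1)$ and $(f^\circ\otimes 1);\varepsilon_B=(1\otimes f^\bullet);\varepsilon_A$. (8) With $N_{A,B}=\eta_B;(1\otimes\eta_A\otimes 1):I\to B^\bullet\otimes A^\bullet\otimes A^\circ\otimes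 B^\circ$ and $E_{A,B}=(1\otimes\varepsilon_B\otimes 1);\varepsilon_A:A^\circ\otimes B^\circ\otimes B^\bullet\otimes A^\bullet\to I$: $N_{A,B};(1\otimes\sigma^\circ_{A,B})=N_{B,A};(\sigma^\bullet_{A,B}\otimes 1)$ and $(\sigma^\circ_{A,B}\otimes 1);E_{B,A}=(1\otimes\sigma^\bullet_{A,B});E_{A,B}$. (9) $\eta_{A\otimes B};(\blacktriangleleft_{A,B}\otimes 1)=N_{B,A};(1\otimes\sigma^\circ_{B,A});(1\otimes\triangleright_{A,B})$; $\eta_{A\otimes B};(1\otimes\triangleleft_{A,B})=N_{A,B};(\sigma^\bullet_{B,A}\otimes 1);(\blacktriangleright_{A,B}\otimes 1)$; $(\triangleright_{A,B}\otimes 1);\varepsilon_{A\otimes B}=(1\otimes\blacktriangleleft_{A,B});(1\otimes\sigma^\bullet_{A,B});E_{A,B}$; $(1\otimes\blacktriangleright_{A,B});\varepsilon_{A\otimes B}=(\triangleleft_{A,B}\otimes 1);(\sigma^\circ_{A,B}\otimes 1);E_{B,A}$. (10) $f^\circ;g^\circ=(f;g)^\circ$; $\triangleleft;(f^\circ\otimes g^\circ);\triangleright=(f\otimes g)^\circ$; $(1_A)^\circ=1_{A^\circ}$; $\triangleright_{A,B};(\sigma_{A,B})^\circ;\triangleleft_{B,A}=\sigma^\circ_{A,B}$; $g^\bullet;f^\bullet=(f;g)^\bullet$; $\blacktriangleleft;(f^\bullet\otimes g^\bullet);\blacktriangleright=(f\otimes g)^\bullet$; $(1_A)^\bullet=1_{A^\bullet}$;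 $\blacktriangleright_{A,B};(\sigma_{B,A})^\bullet;\blacktriangleleft_{B,A}=\sigma^\bullet_{A,B}$. *)

theory Defs
  imports "HOL-Algebra.Group"
begin

section \<open>Categories\<close>

text \<open>Composition is written in diagrammatic order: \<open>f \<Zsemi> g\<close> is first \<open>f\<close>, then \<open>g\<close>.
  Arrows carry their source and target, so hom-sets are disjoint.\<close>

record ('o, 'm) category =
  obj :: "'o set"
  arr :: "'m set"
  src :: "'m \<Rightarrow> 'o"
  tgt :: "'m \<Rightarrow> 'o"
  idt :: "'o \<Rightarrow> 'm"
  seq :: "'m \<Rightarrow> 'm \<Rightarrow> 'm"  (infixl "\<Zsemi>\<index>" 60)

locale category =
  fixes C :: "('o, 'm, 'z) category_scheme" (structure)
  assumes src_obj: "f \<in> arr C \<Longrightarrow> src C f \<in> obj C"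
    and tgt_obj: "f \<in> arr C \<Longrightarrow> tgt C f \<in> obj C"
    and idt_arr: "A \<in> obj C \<Longrightarrow> idt C A \<in> arr C"
    and idt_src: "A \<in> obj C \<Longrightarrow> src C (idt C A) = A"
    and idt_tgt: "A \<in> obj C \<Longrightarrow> tgt C (idt C A) = A"
    and seq_arr: "\<lbrakk>f \<in> arr C; g \<in> arr C; tgt C f = src C g\<rbrakk> \<Longrightarrow> f \<Zsemi> g \<in> arr C"
    and seq_src: "\<lbrakk>f \<in> arr C; g \<in> arr C; tgt C f = src C g\<rbrakk> \<Longrightarrow> src C (f \<Zsemi> g) = src C f"
    and seq_tgt: "\<lbrakk>f \<in> arr C; g \<in> arr C; tgt C f = src C g\<rbrakk> \<Longrightarrow> tgt C (f \<Zsemi> g) = tgt C g"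
    and idt_seq: "f \<in> arr C \<Longrightarrow> idt C (src C f) \<Zsemi> f = f"
    and seq_idt: "f \<in> arr C \<Longrightarrow> f \<Zsemi> idt C (tgt C f) = f"
    and seq_assoc: "\<lbrakk>f \<in> arr C; g \<in> arr C; h \<in> arr C; tgt C f = src C g; tgt C g = src C h\<rbrakk>
      \<Longrightarrow> (f \<Zsemi> g) \<Zsemi> h = f \<Zsemi> (g \<Zsemi> h)"

locale cat_functor = dom: category C + cod: category D
  for C :: "('a, 'f, 'x) category_scheme" and D :: "('b, 'g, 'y) category_scheme" +
  fixes F0 :: "'a \<Rightarrow> 'b" and F1 :: "'f \<Rightarrow> 'g"
  assumes on_obj: "A \<in> obj C \<Longrightarrow> F0 A \<in> obj D"
    and on_arr: "f \<in> arr C \<Longrightarrow> F1 f \<in> arr D"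
    and on_src: "f \<in> arr C \<Longrightarrow> src D (F1 f) = F0 (src C f)"
    and on_tgt: "f \<in> arr C \<Longrightarrow> tgt D (F1 f) = F0 (tgt C f)"
    and on_idt: "A \<in> obj C \<Longrightarrow> F1 (idt C A) = idt D (F0 A)"
    and on_seq: "\<lbrakk>f \<in> arr C; g \<in> arr C; tgt C f = src C g\<rbrakk>
      \<Longrightarrow> F1 (f \<Zsemi>\<^bsub>C\<^esub> g) = F1 f \<Zsemi>\<^bsub>D\<^esub> F1 g"

text \<open>Isomorphism (not equivalence) of categories: functors that are mutually inverse
  on objects and on arrows.\<close>

definition isomorphic_categories ::
  "('a, 'f, 'x) category_scheme \<Rightarrow> ('b, 'g, 'y) category_scheme \<Rightarrow> bool" (infix "\<cong>\<^sub>C" 50) where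
  "C \<cong>\<^sub>C D \<longleftrightarrow> (\<exists>F0 F1 G0 G1. cat_functor C D F0 F1 \<and> cat_functor D C G0 G1
     \<and> (\<forall>A\<in>obj C. G0 (F0 A) = A) \<and> (\<forall>f\<in>arr C. G1 (F1 f) = f)
     \<and> (\<forall>B\<in>obj D. F0 (G0 B) = B) \<and> (\<forall>g\<in>arr D. F1 (G1 g) = g))"


section \<open>Strict monoidal categories\<close>

record ('o, 'm) monoidal_category = "('o, 'm) category" +
  otimes :: "'o \<Rightarrow> 'o \<Rightarrow> 'o"  (infixl "\<odot>\<index>" 70)
  ounit :: 'o
  atimes :: "'m \<Rightarrow> 'm \<Rightarrow> 'm"  (infixl "\<oslash>\<index>" 70)

definition obj_monoid :: "('o, 'm, 'z) monoidal_category_scheme \<Rightarrow> 'o monoid" where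
  "obj_monoid C = \<lparr>carrier = obj C, mult = otimes C, one = ounit C\<rparr>"

locale strict_monoidal_category = category C
  for C :: "('o, 'm, 'z) monoidal_category_scheme" (structure) +
  assumes obj_monoid: "monoid (obj_monoid C)"
    and atimes_arr: "\<lbrakk>f \<in> arr C; g \<in> arr C\<rbrakk> \<Longrightarrow> f \<oslash> g \<in> arr C"
    and atimes_src: "\<lbrakk>f \<in> arr C; g \<in> arr C\<rbrakk> \<Longrightarrow> src C (f \<oslash> g) = src C f \<odot> src C g"
    and atimes_tgt: "\<lbrakk>f \<in> arr C; g \<in> arr C\<rbrakk> \<Longrightarrow> tgt C (f \<oslash> g) = tgt C f \<odot> tgt C g"
    and atimes_idt: "\<lbrakk>A \<in> obj C; B \<in> obj C\<rbrakk> \<Longrightarrow> idt C A \<oslash> idt C B = idt C (A \<odot> B)"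
    and interchange: "\<lbrakk>f \<in> arr C; g \<in> arr C; h \<in> arr C; k \<in> arr C;
        tgt C f = src C g; tgt C h = src C k\<rbrakk>
      \<Longrightarrow> (f \<Zsemi> g) \<oslash> (h \<Zsemi> k) = (f \<oslash> h) \<Zsemi> (g \<oslash> k)"
    and atimes_assoc: "\<lbrakk>f \<in> arr C; g \<in> arr C; h \<in> arr C\<rbrakk> \<Longrightarrow> (f \<oslash> g) \<oslash> h = f \<oslash> (g \<oslash> h)"
    and unit_atimes: "f \<in> arr C \<Longrightarrow> idt C (ounit C) \<oslash> f = f"
    and atimes_unit: "f \<in> arr C \<Longrightarrow> f \<oslash> idt C (ounit C) = f"

locale spatial_strict_monoidal_category = strict_monoidal_category C
  for C :: "('o, 'm, 'z) monoidal_category_scheme" (structure) +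
  assumes spatial: "\<lbrakk>h \<in> arr C; src C h = ounit C; tgt C h = ounit C; X \<in> obj C\<rbrakk>
      \<Longrightarrow> h \<oslash> idt C X = idt C X \<oslash> h"

record ('o, 'm) symmetric_category = "('o, 'm) monoidal_category" +
  braid :: "'o \<Rightarrow> 'o \<Rightarrow> 'm"  ("\<sigma>\<index>")

locale symmetric_strict_monoidal_category = strict_monoidal_category C
  for C :: "('o, 'm, 'z) symmetric_category_scheme" (structure) +
  assumes braid_arr: "\<lbrakk>A \<in> obj C; B \<in> obj C\<rbrakk> \<Longrightarrow> \<sigma> A B \<in> arr C"
    and braid_src: "\<lbrakk>A \<in> obj C; B \<in> obj C\<rbrakk> \<Longrightarrow> src C (\<sigma> A B) = A \<odot> B"
    and braid_tgt: "\<lbrakk>A \<in> obj C; B \<in> obj C\<rbrakk> \<Longrightarrow> tgt C (\<sigma> A B) = B \<odot> A"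
    and braid_natural: "\<lbrakk>f \<in> arr C; g \<in> arr C\<rbrakk>
      \<Longrightarrow> (f \<oslash> g) \<Zsemi> \<sigma> (tgt C f) (tgt C g) = \<sigma> (src C f) (src C g) \<Zsemi> (g \<oslash> f)"
    and braid_hexagon1: "\<lbrakk>A \<in> obj C; B \<in> obj C; D \<in> obj C\<rbrakk>
      \<Longrightarrow> \<sigma> A (B \<odot> D) = (\<sigma> A B \<oslash> idt C D) \<Zsemi> (idt C B \<oslash> \<sigma> A D)"
    and braid_hexagon2: "\<lbrakk>A \<in> obj C; B \<in> obj C; D \<in> obj C\<rbrakk>
      \<Longrightarrow> \<sigma> (A \<odot> B) D = (idt C A \<oslash> \<sigma> B D) \<Zsemi> (\<sigma> A D \<oslash> idt C B)"
    and braid_symmetric: "\<lbrakk>A \<in> obj C; B \<in> obj C\<rbrakk> \<Longrightarrow> \<sigma> A B \<Zsemi> \<sigma> B A = idt C (A \<odot> B)"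


section \<open>Single-object double categories\<close>

record ('h, 'v, 'c) double_category =
  hedge :: "'h monoid"
  vedge :: "'v monoid"
  cells :: "'c set"
  ctop :: "'c \<Rightarrow> 'h"
  cbot :: "'c \<Rightarrow> 'h"
  cleft :: "'c \<Rightarrow> 'v"
  cright :: "'c \<Rightarrow> 'v"
  hid :: "'h \<Rightarrow> 'c"
  vid :: "'v \<Rightarrow> 'c"
  hcomp :: "'c \<Rightarrow> 'c \<Rightarrow> 'c"
  vcomp :: "'c \<Rightarrow> 'c \<Rightarrow> 'c"

text \<open>\<open>hid D A\<close> is the cell $1_A$ on a horizontal edge (an identity for vertical composition);
  \<open>vid D X\<close> is the cell $1_X$ on a vertical edge (an identity for horizontal composition).\<close>

locale single_object_double_category =
  fixes D :: "('h, 'v, 'c, 'z) double_category_scheme"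
  assumes hedge_monoid: "monoid (hedge D)" and vedge_monoid: "monoid (vedge D)"
    and boundaries: "a \<in> cells D \<Longrightarrow> ctop D a \<in> carrier (hedge D) \<and> cbot D a \<in> carrier (hedge D)
      \<and> cleft D a \<in> carrier (vedge D) \<and> cright D a \<in> carrier (vedge D)"
    and hid_cell: "A \<in> carrier (hedge D) \<Longrightarrow> hid D A \<in> cells D \<and> ctop D (hid D A) = A
      \<and> cbot D (hid D A) = A \<and> cleft D (hid D A) = \<one>\<^bsub>vedge D\<^esub> \<and> cright D (hid D A) = \<one>\<^bsub>vedge D\<^esub>"
    and vid_cell: "X \<in> carrier (vedge D) \<Longrightarrow> vid D X \<in> cells D \<and> ctop D (vid D X) = \<one>\<^bsub>hedge D\<^esub>
      \<and> cbot D (vid D X) = \<one>\<^bsub>hedge D\<^esub> \<and> cleft D (vid D X) = X \<and> cright D (vid D X) = X"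
    and hcomp_cell: "\<lbrakk>a \<in> cells D; b \<in> cells D; cright D a = cleft D b\<rbrakk> \<Longrightarrow> hcomp D a b \<in> cells D
      \<and> ctop D (hcomp D a b) = ctop D a \<otimes>\<^bsub>hedge D\<^esub> ctop D b
      \<and> cbot D (hcomp D a b) = cbot D a \<otimes>\<^bsub>hedge D\<^esub> cbot D b
      \<and> cleft D (hcomp D a b) = cleft D a \<and> cright D (hcomp D a b) = cright D b"
    and vcomp_cell: "\<lbrakk>a \<in> cells D; b \<in> cells D; cbot D a = ctop D b\<rbrakk> \<Longrightarrow> vcomp D a b \<in> cells D
      \<and> ctop D (vcomp D a b) = ctop D a \<and> cbot D (vcomp D a b) = cbot D b
      \<and> cleft D (vcomp D a b) = cleft D a \<otimes>\<^bsub>vedge D\<^esub> cleft D b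
      \<and> cright D (vcomp D a b) = cright D a \<otimes>\<^bsub>vedge D\<^esub> cright D b"
    and hcomp_assoc: "\<lbrakk>a \<in> cells D; b \<in> cells D; c \<in> cells D; cright D a = cleft D b;
        cright D b = cleft D c\<rbrakk> \<Longrightarrow> hcomp D (hcomp D a b) c = hcomp D a (hcomp D b c)"
    and vcomp_assoc: "\<lbrakk>a \<in> cells D; b \<in> cells D; c \<in> cells D; cbot D a = ctop D b;
        cbot D b = ctop D c\<rbrakk> \<Longrightarrow> vcomp D (vcomp D a b) c = vcomp D a (vcomp D b c)"
    and hcomp_unit: "a \<in> cells D \<Longrightarrow> hcomp D (vid D (cleft D a)) a = a
      \<and> hcomp D a (vid D (cright D a)) = a"
    and vcomp_unit: "a \<in> cells D \<Longrightarrow> vcomp D (hid D (ctop D a)) a = a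
      \<and> vcomp D a (hid D (cbot D a)) = a"
    and hid_mult: "\<lbrakk>A \<in> carrier (hedge D); B \<in> carrier (hedge D)\<rbrakk>
      \<Longrightarrow> hcomp D (hid D A) (hid D B) = hid D (A \<otimes>\<^bsub>hedge D\<^esub> B)"
    and vid_mult: "\<lbrakk>X \<in> carrier (vedge D); Y \<in> carrier (vedge D)\<rbrakk>
      \<Longrightarrow> vcomp D (vid D X) (vid D Y) = vid D (X \<otimes>\<^bsub>vedge D\<^esub> Y)"
    and hid_vid: "hid D \<one>\<^bsub>hedge D\<^esub> = vid D \<one>\<^bsub>vedge D\<^esub>"
    and double_interchange: "\<lbrakk>a \<in> cells D; b \<in> cells D; c \<in> cells D; d \<in> cells D;
        cbot D a = ctop D b; cbot D c = ctop D d; cright D a = cleft D c; cright D b = cleft D d\<rbrakk>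
      \<Longrightarrow> hcomp D (vcomp D a b) (vcomp D c d) = vcomp D (hcomp D a c) (hcomp D b d)"

definition horizontal_cells ::
  "('h, 'v, 'c, 'z) double_category_scheme \<Rightarrow> ('v, 'c) monoidal_category" ("\<^bold>H") where
  "\<^bold>H D = \<lparr>obj = carrier (vedge D),
     arr = {a \<in> cells D. ctop D a = \<one>\<^bsub>hedge D\<^esub> \<and> cbot D a = \<one>\<^bsub>hedge D\<^esub>},
     src = cleft D, tgt = cright D, idt = vid D, seq = hcomp D,
     otimes = mult (vedge D), ounit = \<one>\<^bsub>vedge D\<^esub>, atimes = vcomp D\<rparr>"

lemma (in single_object_double_category) horizontal_cells_strict_monoidal:
  "strict_monoidal_category (\<^bold>H D)"
proof -
  interpret h: monoid "hedge D" by (rule hedge_monoid)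
  interpret v: monoid "vedge D" by (rule vedge_monoid)
  have u: "vcomp D (vid D \<one>\<^bsub>vedge D\<^esub>) a = a"
    if "a \<in> cells D" "ctop D a = \<one>\<^bsub>hedge D\<^esub>" for a
    using vcomp_unit[OF that(1)] that(2) hid_vid by simp
  have u': "vcomp D a (vid D \<one>\<^bsub>vedge D\<^esub>) = a"
    if "a \<in> cells D" "cbot D a = \<one>\<^bsub>hedge D\<^esub>" for a
    using vcomp_unit[OF that(1)] that(2) hid_vid by simp
  show ?thesis
    by unfold_locales
      (simp_all add: horizontal_cells_def obj_monoid_def boundaries vid_cell hcomp_cell vcomp_cell
        hcomp_assoc vcomp_assoc hcomp_unit vid_mult double_interchange v.m_assoc u u')
qed


section \<open>Edges of polarised objects\<close>

text \<open>\<open>White\<close> is the polarity $\circ$ and \<open>Black\<close> the polarity $\bullet$.\<close>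

datatype polarity = White | Black

type_synonym 'o pword = "('o \<times> polarity) list"

abbreviation white :: "'o \<Rightarrow> 'o pword" ("_\<^sup>\<circ>" [1000] 1000) where "A\<^sup>\<circ> \<equiv> [(A, White)]"
abbreviation black :: "'o \<Rightarrow> 'o pword" ("_\<^sup>\<bullet>" [1000] 1000) where "A\<^sup>\<bullet> \<equiv> [(A, Black)]"

definition pwords :: "('o, 'm, 'z) symmetric_category_scheme \<Rightarrow> 'o pword set" where
  "pwords \<A> = lists (obj \<A> \<times> UNIV)"

definition pword_monoid :: "('o, 'm, 'z) symmetric_category_scheme \<Rightarrow> 'o pword monoid" where
  "pword_monoid \<A> = \<lparr>carrier = pwords \<A>, mult = (@), one = []\<rparr>"


section \<open>Quotients of terms by a congruence\<close>

text \<open>\<open>qval\<close>, \<open>qop\<close> transport to classes a function, respectively a binary term constructor, that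
  respects the relation.\<close>

definition qval :: "('t \<Rightarrow> 'b) \<Rightarrow> 't set \<Rightarrow> 'b" where
  "qval p X = the_elem (p ` X)"

definition qop :: "('t \<times> 't) set \<Rightarrow> ('t \<Rightarrow> 't \<Rightarrow> 't) \<Rightarrow> 't set \<Rightarrow> 't set \<Rightarrow> 't set" where
  "qop R c X Y = (\<Union>x\<in>X. \<Union>y\<in>Y. R `` {c x y})"


section \<open>The free cornering\<close>

text \<open>Cell terms; \<open>a \<parallel> b\<close> is horizontal and \<open>a \<div> b\<close> vertical composition (\<open>a\<close> above \<open>b\<close>).
  \<open>SW\<close>, \<open>RW\<close>, \<open>SB\<close>, \<open>RB\<close> are the corners
  $s^\circ$, $r^\circ$, $s^\bullet$, $r^\bullet$ and \<open>Box f\<close> is the cell of an arrow \<open>f\<close>.\<close>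

datatype ('o, 'm) cterm =
    HId 'o
  | VId "'o pword"
  | SW 'o | RW 'o | SB 'o | RB 'o
  | Box 'm
  | HComp "('o, 'm) cterm" "('o, 'm) cterm"  (infixl "\<parallel>" 65)
  | VComp "('o, 'm) cterm" "('o, 'm) cterm"  (infixl "\<div>" 70)

primrec ttop :: "('o, 'm, 'z) symmetric_category_scheme \<Rightarrow> ('o, 'm) cterm \<Rightarrow> 'o" where
  "ttop \<A> (HId A) = A"
| "ttop \<A> (VId X) = ounit \<A>"
| "ttop \<A> (SW A) = A"
| "ttop \<A> (RW A) = ounit \<A>"
| "ttop \<A> (SB A) = A"
| "ttop \<A> (RB A) = ounit \<A>"
| "ttop \<A> (Box f) = src \<A> f"
| "ttop \<A> (a \<parallel> b) = ttop \<A> a \<odot>\<^bsub>\<A>\<^esub> ttop \<A> b"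
| "ttop \<A> (a \<div> b) = ttop \<A> a"

primrec tbot :: "('o, 'm, 'z) symmetric_category_scheme \<Rightarrow> ('o, 'm) cterm \<Rightarrow> 'o" where
  "tbot \<A> (HId A) = A"
| "tbot \<A> (VId X) = ounit \<A>"
| "tbot \<A> (SW A) = ounit \<A>"
| "tbot \<A> (RW A) = A"
| "tbot \<A> (SB A) = ounit \<A>"
| "tbot \<A> (RB A) = A"
| "tbot \<A> (Box f) = tgt \<A> f"
| "tbot \<A> (a \<parallel> b) = tbot \<A> a \<odot>\<^bsub>\<A>\<^esub> tbot \<A> b"
| "tbot \<A> (a \<div> b) = tbot \<A> b"

primrec tleft :: "('o, 'm) cterm \<Rightarrow> 'o pword" where
  "tleft (HId A) = []"
| "tleft (VId X) = X"
| "tleft (SW A) = []"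
| "tleft (RW A) = A\<^sup>\<circ>"
| "tleft (SB A) = A\<^sup>\<bullet>"
| "tleft (RB A) = []"
| "tleft (Box f) = []"
| "tleft (a \<parallel> b) = tleft a"
| "tleft (a \<div> b) = tleft a @ tleft b"

primrec tright :: "('o, 'm) cterm \<Rightarrow> 'o pword" where
  "tright (HId A) = []"
| "tright (VId X) = X"
| "tright (SW A) = A\<^sup>\<circ>"
| "tright (RW A) = []"
| "tright (SB A) = []"
| "tright (RB A) = A\<^sup>\<bullet>"
| "tright (Box f) = []"
| "tright (a \<parallel> b) = tright b"
| "tright (a \<div> b) = tright a @ tright b"

primrec wf_cell :: "('o, 'm, 'z) symmetric_category_scheme \<Rightarrow> ('o, 'm) cterm \<Rightarrow> bool" where
  "wf_cell \<A> (HId A) \<longleftrightarrow> A \<in> obj \<A>"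
| "wf_cell \<A> (VId X) \<longleftrightarrow> X \<in> pwords \<A>"
| "wf_cell \<A> (SW A) \<longleftrightarrow> A \<in> obj \<A>"
| "wf_cell \<A> (RW A) \<longleftrightarrow> A \<in> obj \<A>"
| "wf_cell \<A> (SB A) \<longleftrightarrow> A \<in> obj \<A>"
| "wf_cell \<A> (RB A) \<longleftrightarrow> A \<in> obj \<A>"
| "wf_cell \<A> (Box f) \<longleftrightarrow> f \<in> arr \<A>"
| "wf_cell \<A> (a \<parallel> b) \<longleftrightarrow> wf_cell \<A> a \<and> wf_cell \<A> b \<and> tright a = tleft b"
| "wf_cell \<A> (a \<div> b) \<longleftrightarrow> wf_cell \<A> a \<and> wf_cell \<A> b \<and> tbot \<A> a = ttop \<A> b"

text \<open>The congruence on well-formed cell terms generated by the laws of single-object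
  double categories, the yanking equations, and the equations between boxes.\<close>

context
  fixes \<A> :: "('o, 'm, 'z) symmetric_category_scheme" (structure)
begin

inductive cell_eq :: "('o, 'm) cterm \<Rightarrow> ('o, 'm) cterm \<Rightarrow> bool" (infix "\<approx>" 50) where
  c_refl: "wf_cell \<A> a \<Longrightarrow> a \<approx> a"
| c_sym: "a \<approx> b \<Longrightarrow> b \<approx> a"
| c_trans: "\<lbrakk>a \<approx> b; b \<approx> c\<rbrakk> \<Longrightarrow> a \<approx> c"
| c_hcong: "\<lbrakk>a \<approx> a'; b \<approx> b'; tright a = tleft b\<rbrakk> \<Longrightarrow> a \<parallel> b \<approx> a' \<parallel> b'"
| c_vcong: "\<lbrakk>a \<approx> a'; b \<approx> b'; tbot \<A> a = ttop \<A> b\<rbrakk> \<Longrightarrow> a \<div> b \<approx> a' \<div> b'"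

| c_hassoc: "\<lbrakk>wf_cell \<A> a; wf_cell \<A> b; wf_cell \<A> c; tright a = tleft b; tright b = tleft c\<rbrakk>
    \<Longrightarrow> (a \<parallel> b) \<parallel> c \<approx> a \<parallel> (b \<parallel> c)"
| c_vassoc: "\<lbrakk>wf_cell \<A> a; wf_cell \<A> b; wf_cell \<A> c; tbot \<A> a = ttop \<A> b; tbot \<A> b = ttop \<A> c\<rbrakk>
    \<Longrightarrow> (a \<div> b) \<div> c \<approx> a \<div> (b \<div> c)"
| c_hunit_left: "wf_cell \<A> a \<Longrightarrow> VId (tleft a) \<parallel> a \<approx> a"
| c_hunit_right: "wf_cell \<A> a \<Longrightarrow> a \<parallel> VId (tright a) \<approx> a"
| c_vunit_top: "wf_cell \<A> a \<Longrightarrow> HId (ttop \<A> a) \<div> a \<approx> a"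
| c_vunit_bot: "wf_cell \<A> a \<Longrightarrow> a \<div> HId (tbot \<A> a) \<approx> a"
| c_hid: "\<lbrakk>A \<in> obj \<A>; B \<in> obj \<A>\<rbrakk> \<Longrightarrow> HId A \<parallel> HId B \<approx> HId (A \<odot> B)"
| c_vid: "\<lbrakk>X \<in> pwords \<A>; Y \<in> pwords \<A>\<rbrakk> \<Longrightarrow> VId X \<div> VId Y \<approx> VId (X @ Y)"
| c_unit: "HId (ounit \<A>) \<approx> VId []"
| c_interchange: "\<lbrakk>wf_cell \<A> a; wf_cell \<A> b; wf_cell \<A> c; wf_cell \<A> d;
      tbot \<A> a = ttop \<A> b; tbot \<A> c = ttop \<A> d; tright a = tleft c; tright b = tleft d\<rbrakk>
    \<Longrightarrow> (a \<div> b) \<parallel> (c \<div> d) \<approx> (a \<parallel> c) \<div> (b \<parallel> d)"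

| c_yank_white_h: "A \<in> obj \<A> \<Longrightarrow> SW A \<parallel> RW A \<approx> HId A"
| c_yank_white_v: "A \<in> obj \<A> \<Longrightarrow> RW A \<div> SW A \<approx> VId (A\<^sup>\<circ>)"
| c_yank_black_h: "A \<in> obj \<A> \<Longrightarrow> RB A \<parallel> SB A \<approx> HId A"
| c_yank_black_v: "A \<in> obj \<A> \<Longrightarrow> RB A \<div> SB A \<approx> VId (A\<^sup>\<bullet>)"

| c_box_seq: "\<lbrakk>f \<in> arr \<A>; g \<in> arr \<A>; tgt \<A> f = src \<A> g\<rbrakk> \<Longrightarrow> Box f \<div> Box g \<approx> Box (f \<Zsemi> g)"
| c_box_idt: "A \<in> obj \<A> \<Longrightarrow> Box (idt \<A> A) \<approx> HId A"
| c_box_times: "\<lbrakk>f \<in> arr \<A>; g \<in> arr \<A>\<rbrakk> \<Longrightarrow> Box f \<parallel> Box g \<approx> Box (f \<oslash> g)"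

end

definition cell_rel ::
  "('o, 'm, 'z) symmetric_category_scheme \<Rightarrow> (('o, 'm) cterm \<times> ('o, 'm) cterm) set" where
  "cell_rel \<A> = {(a, b). cell_eq \<A> a b}"

definition free_cornering :: "('o, 'm, 'z) symmetric_category_scheme
    \<Rightarrow> ('o, 'o pword, ('o, 'm) cterm set) double_category" ("\<C>") where
  "\<C> \<A> = \<lparr>hedge = obj_monoid \<A>, vedge = pword_monoid \<A>,
     cells = Collect (wf_cell \<A>) // cell_rel \<A>,
     ctop = qval (ttop \<A>), cbot = qval (tbot \<A>), cleft = qval tleft, cright = qval tright,
     hid = (\<lambda>A. cell_rel \<A> `` {HId A}), vid = (\<lambda>X. cell_rel \<A> `` {VId X}),
     hcomp = qop (cell_rel \<A>) HComp, vcomp = qop (cell_rel \<A>) VComp\<rparr>"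


section \<open>The category \<open>\<T> \<A>\<close>\<close>

text \<open>Arrow terms. The generators come in two versions, indexed by the polarity:
  \<open>Map White f\<close> is $f^\circ$ and \<open>Map Black f\<close> is the contravariant $f^\bullet$;
  \<open>Split\<close> and \<open>Merge\<close> are the left- and right-pointing triangles.\<close>

datatype ('o, 'm) tterm =
    Id "'o pword"  ("\<one>\<^sub>T")
  | Seq "('o, 'm) tterm" "('o, 'm) tterm"  (infixl ";;" 60)
  | Ten "('o, 'm) tterm" "('o, 'm) tterm"  (infixl "\<star>" 70)
  | Map polarity 'm
  | Split polarity 'o 'o
  | Merge polarity 'o 'o
  | Iota polarity
  | Kappa polarity
  | Sigma polarity 'o 'o
  | Eta 'o
  | Eps 'o

primrec tdom :: "('o, 'm, 'z) symmetric_category_scheme \<Rightarrow> ('o, 'm) tterm \<Rightarrow> 'o pword" where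
  "tdom \<A> (\<one>\<^sub>T X) = X"
| "tdom \<A> (t ;; u) = tdom \<A> t"
| "tdom \<A> (t \<star> u) = tdom \<A> t @ tdom \<A> u"
| "tdom \<A> (Map p f) = (case p of White \<Rightarrow> (src \<A> f)\<^sup>\<circ> | Black \<Rightarrow> (tgt \<A> f)\<^sup>\<bullet>)"
| "tdom \<A> (Split p A B) = [(A \<odot>\<^bsub>\<A>\<^esub> B, p)]"
| "tdom \<A> (Merge p A B) = [(A, p), (B, p)]"
| "tdom \<A> (Iota p) = []"
| "tdom \<A> (Kappa p) = [(ounit \<A>, p)]"
| "tdom \<A> (Sigma p A B) = [(A, p), (B, p)]"
| "tdom \<A> (Eta A) = []"
| "tdom \<A> (Eps A) = A\<^sup>\<circ> @ A\<^sup>\<bullet>"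

primrec tcod :: "('o, 'm, 'z) symmetric_category_scheme \<Rightarrow> ('o, 'm) tterm \<Rightarrow> 'o pword" where
  "tcod \<A> (\<one>\<^sub>T X) = X"
| "tcod \<A> (t ;; u) = tcod \<A> u"
| "tcod \<A> (t \<star> u) = tcod \<A> t @ tcod \<A> u"
| "tcod \<A> (Map p f) = (case p of White \<Rightarrow> (tgt \<A> f)\<^sup>\<circ> | Black \<Rightarrow> (src \<A> f)\<^sup>\<bullet>)"
| "tcod \<A> (Split p A B) = [(A, p), (B, p)]"
| "tcod \<A> (Merge p A B) = [(A \<odot>\<^bsub>\<A>\<^esub> B, p)]"
| "tcod \<A> (Iota p) = [(ounit \<A>, p)]"
| "tcod \<A> (Kappa p) = []"
| "tcod \<A> (Sigma p A B) = [(B, p), (A, p)]"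
| "tcod \<A> (Eta A) = A\<^sup>\<bullet> @ A\<^sup>\<circ>"
| "tcod \<A> (Eps A) = []"

primrec wf_t :: "('o, 'm, 'z) symmetric_category_scheme \<Rightarrow> ('o, 'm) tterm \<Rightarrow> bool" where
  "wf_t \<A> (\<one>\<^sub>T X) \<longleftrightarrow> X \<in> pwords \<A>"
| "wf_t \<A> (t ;; u) \<longleftrightarrow> wf_t \<A> t \<and> wf_t \<A> u \<and> tcod \<A> t = tdom \<A> u"
| "wf_t \<A> (t \<star> u) \<longleftrightarrow> wf_t \<A> t \<and> wf_t \<A> u"
| "wf_t \<A> (Map p f) \<longleftrightarrow> f \<in> arr \<A>"
| "wf_t \<A> (Split p A B) \<longleftrightarrow> A \<in> obj \<A> \<and> B \<in> obj \<A>"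
| "wf_t \<A> (Merge p A B) \<longleftrightarrow> A \<in> obj \<A> \<and> B \<in> obj \<A>"
| "wf_t \<A> (Iota p) \<longleftrightarrow> True"
| "wf_t \<A> (Kappa p) \<longleftrightarrow> True"
| "wf_t \<A> (Sigma p A B) \<longleftrightarrow> A \<in> obj \<A> \<and> B \<in> obj \<A>"
| "wf_t \<A> (Eta A) \<longleftrightarrow> A \<in> obj \<A>"
| "wf_t \<A> (Eps A) \<longleftrightarrow> A \<in> obj \<A>"

definition Nest_eta :: "'o \<Rightarrow> 'o \<Rightarrow> ('o, 'm) tterm" where
  "Nest_eta A B = Eta B ;; (\<one>\<^sub>T (B\<^sup>\<bullet>) \<star> Eta A \<star> \<one>\<^sub>T (B\<^sup>\<circ>))"

definition Nest_eps :: "'o \<Rightarrow> 'o \<Rightarrow> ('o, 'm) tterm" where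
  "Nest_eps A B = (\<one>\<^sub>T (A\<^sup>\<circ>) \<star> Eps B \<star> \<one>\<^sub>T (A\<^sup>\<bullet>)) ;; Eps A"

text \<open>The congruence on well-formed arrow terms generated by the laws of spatial strict monoidal
  categories and the defining equations of \<open>\<T> \<A>\<close>. An object \<open>A\<close> of polarity \<open>p\<close> is the
  one-letter word \<open>[(A, p)]\<close>.\<close>

context
  fixes \<A> :: "('o, 'm, 'z) symmetric_category_scheme" (structure)
begin

inductive t_eq :: "('o, 'm) tterm \<Rightarrow> ('o, 'm) tterm \<Rightarrow> bool" (infix "\<approx>" 50) where
  t_refl: "wf_t \<A> t \<Longrightarrow> t \<approx> t"
| t_sym: "t \<approx> u \<Longrightarrow> u \<approx> t"
| t_trans: "\<lbrakk>t \<approx> u; u \<approx> v\<rbrakk> \<Longrightarrow> t \<approx> v"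
| t_seq_cong: "\<lbrakk>t \<approx> t'; u \<approx> u'; tcod \<A> t = tdom \<A> u\<rbrakk> \<Longrightarrow> t ;; u \<approx> t' ;; u'"
| t_ten_cong: "\<lbrakk>t \<approx> t'; u \<approx> u'\<rbrakk> \<Longrightarrow> t \<star> u \<approx> t' \<star> u'"

| t_id_seq: "wf_t \<A> t \<Longrightarrow> \<one>\<^sub>T (tdom \<A> t) ;; t \<approx> t"
| t_seq_id: "wf_t \<A> t \<Longrightarrow> t ;; \<one>\<^sub>T (tcod \<A> t) \<approx> t"
| t_seq_assoc: "\<lbrakk>wf_t \<A> t; wf_t \<A> u; wf_t \<A> v; tcod \<A> t = tdom \<A> u; tcod \<A> u = tdom \<A> v\<rbrakk>
    \<Longrightarrow> (t ;; u) ;; v \<approx> t ;; (u ;; v)"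
| t_ten_id: "\<lbrakk>X \<in> pwords \<A>; Y \<in> pwords \<A>\<rbrakk> \<Longrightarrow> \<one>\<^sub>T X \<star> \<one>\<^sub>T Y \<approx> \<one>\<^sub>T (X @ Y)"
| t_interchange: "\<lbrakk>wf_t \<A> t; wf_t \<A> u; wf_t \<A> v; wf_t \<A> w; tcod \<A> t = tdom \<A> u; tcod \<A> v = tdom \<A> w\<rbrakk>
    \<Longrightarrow> (t ;; u) \<star> (v ;; w) \<approx> (t \<star> v) ;; (u \<star> w)"
| t_ten_assoc: "\<lbrakk>wf_t \<A> t; wf_t \<A> u; wf_t \<A> v\<rbrakk> \<Longrightarrow> (t \<star> u) \<star> v \<approx> t \<star> (u \<star> v)"
| t_unit_ten: "wf_t \<A> t \<Longrightarrow> \<one>\<^sub>T [] \<star> t \<approx> t"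
| t_ten_unit: "wf_t \<A> t \<Longrightarrow> t \<star> \<one>\<^sub>T [] \<approx> t"
| t_spatial: "\<lbrakk>wf_t \<A> h; tdom \<A> h = []; tcod \<A> h = []; X \<in> pwords \<A>\<rbrakk>
    \<Longrightarrow> h \<star> \<one>\<^sub>T X \<approx> \<one>\<^sub>T X \<star> h"

| t_split_merge: "\<lbrakk>A \<in> obj \<A>; B \<in> obj \<A>\<rbrakk> \<Longrightarrow> Split p A B ;; Merge p A B \<approx> \<one>\<^sub>T [(A \<odot> B, p)]"
| t_merge_split: "\<lbrakk>A \<in> obj \<A>; B \<in> obj \<A>\<rbrakk> \<Longrightarrow> Merge p A B ;; Split p A B \<approx> \<one>\<^sub>T [(A, p), (B, p)]"
| t_merge_assoc: "\<lbrakk>A \<in> obj \<A>; B \<in> obj \<A>; C \<in> obj \<A>\<rbrakk>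
    \<Longrightarrow> (Merge p A B \<star> \<one>\<^sub>T [(C, p)]) ;; Merge p (A \<odot> B) C
      \<approx> (\<one>\<^sub>T [(A, p)] \<star> Merge p B C) ;; Merge p A (B \<odot> C)"
| t_split_assoc: "\<lbrakk>A \<in> obj \<A>; B \<in> obj \<A>; C \<in> obj \<A>\<rbrakk>
    \<Longrightarrow> Split p (A \<odot> B) C ;; (Split p A B \<star> \<one>\<^sub>T [(C, p)])
      \<approx> Split p A (B \<odot> C) ;; (\<one>\<^sub>T [(A, p)] \<star> Split p B C)"

| t_iota_kappa: "Iota p ;; Kappa p \<approx> \<one>\<^sub>T []"
| t_kappa_iota: "Kappa p ;; Iota p \<approx> \<one>\<^sub>T [(ounit \<A>, p)]"

| t_iota_merge_left: "A \<in> obj \<A> \<Longrightarrow> (Iota p \<star> \<one>\<^sub>T [(A, p)]) ;; Merge p (ounit \<A>) A \<approx> \<one>\<^sub>T [(A, p)]"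
| t_iota_merge_right: "A \<in> obj \<A> \<Longrightarrow> (\<one>\<^sub>T [(A, p)] \<star> Iota p) ;; Merge p A (ounit \<A>) \<approx> \<one>\<^sub>T [(A, p)]"
| t_split_kappa_left: "A \<in> obj \<A> \<Longrightarrow> Split p (ounit \<A>) A ;; (Kappa p \<star> \<one>\<^sub>T [(A, p)]) \<approx> \<one>\<^sub>T [(A, p)]"
| t_split_kappa_right: "A \<in> obj \<A> \<Longrightarrow> Split p A (ounit \<A>) ;; (\<one>\<^sub>T [(A, p)] \<star> Kappa p) \<approx> \<one>\<^sub>T [(A, p)]"
| t_iota_split: "Iota p ;; Split p (ounit \<A>) (ounit \<A>) \<approx> Iota p \<star> Iota p"
| t_merge_kappa: "Merge p (ounit \<A>) (ounit \<A>) ;; Kappa p \<approx> Kappa p \<star> Kappa p"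

\<comment> \<open>the black arrow of \<open>f\<close> goes from the target of \<open>f\<close> to its source\<close>
| t_nat_white_left: "\<lbrakk>f \<in> arr \<A>; C \<in> obj \<A>\<rbrakk>
    \<Longrightarrow> (Map White f \<star> \<one>\<^sub>T (C\<^sup>\<circ>)) ;; Sigma White (tgt \<A> f) C
      \<approx> Sigma White (src \<A> f) C ;; (\<one>\<^sub>T (C\<^sup>\<circ>) \<star> Map White f)"
| t_nat_white_right: "\<lbrakk>f \<in> arr \<A>; C \<in> obj \<A>\<rbrakk>
    \<Longrightarrow> (\<one>\<^sub>T (C\<^sup>\<circ>) \<star> Map White f) ;; Sigma White C (tgt \<A> f)
      \<approx> Sigma White C (src \<A> f) ;; (Map White f \<star> \<one>\<^sub>T (C\<^sup>\<circ>))"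
| t_nat_black_left: "\<lbrakk>f \<in> arr \<A>; C \<in> obj \<A>\<rbrakk>
    \<Longrightarrow> (Map Black f \<star> \<one>\<^sub>T (C\<^sup>\<bullet>)) ;; Sigma Black (src \<A> f) C
      \<approx> Sigma Black (tgt \<A> f) C ;; (\<one>\<^sub>T (C\<^sup>\<bullet>) \<star> Map Black f)"
| t_nat_black_right: "\<lbrakk>f \<in> arr \<A>; C \<in> obj \<A>\<rbrakk>
    \<Longrightarrow> (\<one>\<^sub>T (C\<^sup>\<bullet>) \<star> Map Black f) ;; Sigma Black C (src \<A> f)
      \<approx> Sigma Black C (tgt \<A> f) ;; (Map Black f \<star> \<one>\<^sub>T (C\<^sup>\<bullet>))"

| t_merge_sigma_left: "\<lbrakk>A \<in> obj \<A>; B \<in> obj \<A>; C \<in> obj \<A>\<rbrakk>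
    \<Longrightarrow> (Merge p A B \<star> \<one>\<^sub>T [(C, p)]) ;; Sigma p (A \<odot> B) C
      \<approx> (\<one>\<^sub>T [(A, p)] \<star> Sigma p B C) ;; (Sigma p A C \<star> \<one>\<^sub>T [(B, p)]) ;; (\<one>\<^sub>T [(C, p)] \<star> Merge p A B)"
| t_merge_sigma_right: "\<lbrakk>A \<in> obj \<A>; B \<in> obj \<A>; C \<in> obj \<A>\<rbrakk>
    \<Longrightarrow> (\<one>\<^sub>T [(A, p)] \<star> Merge p B C) ;; Sigma p A (B \<odot> C)
      \<approx> (Sigma p A B \<star> \<one>\<^sub>T [(C, p)]) ;; (\<one>\<^sub>T [(B, p)] \<star> Sigma p A C) ;; (Merge p B C \<star> \<one>\<^sub>T [(A, p)])"
| t_sigma_split_left: "\<lbrakk>A \<in> obj \<A>; B \<in> obj \<A>; C \<in> obj \<A>\<rbrakk>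
    \<Longrightarrow> Sigma p (A \<odot> B) C ;; (\<one>\<^sub>T [(C, p)] \<star> Split p A B)
      \<approx> (Split p A B \<star> \<one>\<^sub>T [(C, p)]) ;; (\<one>\<^sub>T [(A, p)] \<star> Sigma p B C) ;; (Sigma p A C \<star> \<one>\<^sub>T [(B, p)])"
| t_sigma_split_right: "\<lbrakk>A \<in> obj \<A>; B \<in> obj \<A>; C \<in> obj \<A>\<rbrakk>
    \<Longrightarrow> Sigma p A (B \<odot> C) ;; (Split p B C \<star> \<one>\<^sub>T [(A, p)])
      \<approx> (\<one>\<^sub>T [(A, p)] \<star> Split p B C) ;; (Sigma p A B \<star> \<one>\<^sub>T [(C, p)]) ;; (\<one>\<^sub>T [(B, p)] \<star> Sigma p A C)"

| t_iota_sigma_left: "A \<in> obj \<A>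
    \<Longrightarrow> (Iota p \<star> \<one>\<^sub>T [(A, p)]) ;; Sigma p (ounit \<A>) A \<approx> \<one>\<^sub>T [(A, p)] \<star> Iota p"
| t_iota_sigma_right: "A \<in> obj \<A>
    \<Longrightarrow> (\<one>\<^sub>T [(A, p)] \<star> Iota p) ;; Sigma p A (ounit \<A>) \<approx> Iota p \<star> \<one>\<^sub>T [(A, p)]"
| t_sigma_kappa_left: "A \<in> obj \<A>
    \<Longrightarrow> Sigma p (ounit \<A>) A ;; (\<one>\<^sub>T [(A, p)] \<star> Kappa p) \<approx> Kappa p \<star> \<one>\<^sub>T [(A, p)]"
| t_sigma_kappa_right: "A \<in> obj \<A>
    \<Longrightarrow> Sigma p A (ounit \<A>) ;; (Kappa p \<star> \<one>\<^sub>T [(A, p)]) \<approx> \<one>\<^sub>T [(A, p)] \<star> Kappa p"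

| t_snake_white: "A \<in> obj \<A> \<Longrightarrow> (\<one>\<^sub>T (A\<^sup>\<circ>) \<star> Eta A) ;; (Eps A \<star> \<one>\<^sub>T (A\<^sup>\<circ>)) \<approx> \<one>\<^sub>T (A\<^sup>\<circ>)"
| t_snake_black: "A \<in> obj \<A> \<Longrightarrow> (Eta A \<star> \<one>\<^sub>T (A\<^sup>\<bullet>)) ;; (\<one>\<^sub>T (A\<^sup>\<bullet>) \<star> Eps A) \<approx> \<one>\<^sub>T (A\<^sup>\<bullet>)"
| t_eta_dinat: "f \<in> arr \<A>
    \<Longrightarrow> Eta (src \<A> f) ;; (\<one>\<^sub>T ((src \<A> f)\<^sup>\<bullet>) \<star> Map White f)
      \<approx> Eta (tgt \<A> f) ;; (Map Black f \<star> \<one>\<^sub>T ((tgt \<A> f)\<^sup>\<circ>))"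
| t_eps_dinat: "f \<in> arr \<A>
    \<Longrightarrow> (Map White f \<star> \<one>\<^sub>T ((tgt \<A> f)\<^sup>\<bullet>)) ;; Eps (tgt \<A> f)
      \<approx> (\<one>\<^sub>T ((src \<A> f)\<^sup>\<circ>) \<star> Map Black f) ;; Eps (src \<A> f)"

| t_eta_sigma: "\<lbrakk>A \<in> obj \<A>; B \<in> obj \<A>\<rbrakk>
    \<Longrightarrow> Nest_eta A B ;; (\<one>\<^sub>T (B\<^sup>\<bullet> @ A\<^sup>\<bullet>) \<star> Sigma White A B)
      \<approx> Nest_eta B A ;; (Sigma Black A B \<star> \<one>\<^sub>T (B\<^sup>\<circ> @ A\<^sup>\<circ>))"
| t_sigma_eps: "\<lbrakk>A \<in> obj \<A>; B \<in> obj \<A>\<rbrakk>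
    \<Longrightarrow> (Sigma White A B \<star> \<one>\<^sub>T (A\<^sup>\<bullet> @ B\<^sup>\<bullet>)) ;; Nest_eps B A
      \<approx> (\<one>\<^sub>T (A\<^sup>\<circ> @ B\<^sup>\<circ>) \<star> Sigma Black A B) ;; Nest_eps A B"

| t_eta_split_black: "\<lbrakk>A \<in> obj \<A>; B \<in> obj \<A>\<rbrakk>
    \<Longrightarrow> Eta (A \<odot> B) ;; (Split Black A B \<star> \<one>\<^sub>T ((A \<odot> B)\<^sup>\<circ>))
      \<approx> Nest_eta B A ;; (\<one>\<^sub>T (A\<^sup>\<bullet> @ B\<^sup>\<bullet>) \<star> Sigma White B A) ;; (\<one>\<^sub>T (A\<^sup>\<bullet> @ B\<^sup>\<bullet>) \<star> Merge White A B)"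
| t_eta_split_white: "\<lbrakk>A \<in> obj \<A>; B \<in> obj \<A>\<rbrakk>
    \<Longrightarrow> Eta (A \<odot> B) ;; (\<one>\<^sub>T ((A \<odot> B)\<^sup>\<bullet>) \<star> Split White A B)
      \<approx> Nest_eta A B ;; (Sigma Black B A \<star> \<one>\<^sub>T (A\<^sup>\<circ> @ B\<^sup>\<circ>)) ;; (Merge Black A B \<star> \<one>\<^sub>T (A\<^sup>\<circ> @ B\<^sup>\<circ>))"
| t_merge_white_eps: "\<lbrakk>A \<in> obj \<A>; B \<in> obj \<A>\<rbrakk>
    \<Longrightarrow> (Merge White A B \<star> \<one>\<^sub>T ((A \<odot> B)\<^sup>\<bullet>)) ;; Eps (A \<odot> B)
      \<approx> (\<one>\<^sub>T (A\<^sup>\<circ> @ B\<^sup>\<circ>) \<star> Split Black A B) ;; (\<one>\<^sub>T (A\<^sup>\<circ> @ B\<^sup>\<circ>) \<star> Sigma Black A B) ;; Nest_eps A B"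
| t_merge_black_eps: "\<lbrakk>A \<in> obj \<A>; B \<in> obj \<A>\<rbrakk>
    \<Longrightarrow> (\<one>\<^sub>T ((A \<odot> B)\<^sup>\<circ>) \<star> Merge Black A B) ;; Eps (A \<odot> B)
      \<approx> (Split White A B \<star> \<one>\<^sub>T (A\<^sup>\<bullet> @ B\<^sup>\<bullet>)) ;; (Sigma White A B \<star> \<one>\<^sub>T (A\<^sup>\<bullet> @ B\<^sup>\<bullet>)) ;; Nest_eps B A"

| t_map_white_seq: "\<lbrakk>f \<in> arr \<A>; g \<in> arr \<A>; tgt \<A> f = src \<A> g\<rbrakk>
    \<Longrightarrow> Map White f ;; Map White g \<approx> Map White (f \<Zsemi> g)"
| t_map_white_ten: "\<lbrakk>f \<in> arr \<A>; g \<in> arr \<A>\<rbrakk>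
    \<Longrightarrow> Split White (src \<A> f) (src \<A> g) ;; (Map White f \<star> Map White g) ;; Merge White (tgt \<A> f) (tgt \<A> g)
      \<approx> Map White (f \<oslash> g)"
| t_map_white_idt: "A \<in> obj \<A> \<Longrightarrow> Map White (idt \<A> A) \<approx> \<one>\<^sub>T (A\<^sup>\<circ>)"
| t_map_white_braid: "\<lbrakk>A \<in> obj \<A>; B \<in> obj \<A>\<rbrakk>
    \<Longrightarrow> Merge White A B ;; Map White (\<sigma> A B) ;; Split White B A \<approx> Sigma White A B"
| t_map_black_seq: "\<lbrakk>f \<in> arr \<A>; g \<in> arr \<A>; tgt \<A> f = src \<A> g\<rbrakk>
    \<Longrightarrow> Map Black g ;; Map Black f \<approx> Map Black (f \<Zsemi> g)"
| t_map_black_ten: "\<lbrakk>f \<in> arr \<A>; g \<in> arr \<A>\<rbrakk>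
    \<Longrightarrow> Split Black (tgt \<A> f) (tgt \<A> g) ;; (Map Black f \<star> Map Black g) ;; Merge Black (src \<A> f) (src \<A> g)
      \<approx> Map Black (f \<oslash> g)"
| t_map_black_idt: "A \<in> obj \<A> \<Longrightarrow> Map Black (idt \<A> A) \<approx> \<one>\<^sub>T (A\<^sup>\<bullet>)"
| t_map_black_braid: "\<lbrakk>A \<in> obj \<A>; B \<in> obj \<A>\<rbrakk>
    \<Longrightarrow> Merge Black A B ;; Map Black (\<sigma> B A) ;; Split Black B A \<approx> Sigma Black A B"

end

definition t_rel ::
  "('o, 'm, 'z) symmetric_category_scheme \<Rightarrow> (('o, 'm) tterm \<times> ('o, 'm) tterm) set" where
  "t_rel \<A> = {(t, u). t_eq \<A> t u}"

definition T_cat :: "('o, 'm, 'z) symmetric_category_scheme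
    \<Rightarrow> ('o pword, ('o, 'm) tterm set) monoidal_category" ("\<T>") where
  "\<T> \<A> = \<lparr>obj = pwords \<A>, arr = Collect (wf_t \<A>) // t_rel \<A>,
     src = qval (tdom \<A>), tgt = qval (tcod \<A>),
     idt = (\<lambda>X. t_rel \<A> `` {\<one>\<^sub>T X}), seq = qop (t_rel \<A>) Seq,
     otimes = (@), ounit = [], atimes = qop (t_rel \<A>) Ten\<rparr>"


section \<open>The presented structures satisfy the intended axioms\<close>

lemma qval_class:
  assumes "equiv S R" "x \<in> S" "\<And>y. (x, y) \<in> R \<Longrightarrow> p y = p x"
  shows "qval p (R `` {x}) = p x"
proof -
  have "x \<in> R `` {x}" using assms(1,2) by (rule equiv_class_self)
  moreover have "p y = p x" if "y \<in> R `` {x}" for y using assms(3) that by simp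
  ultimately have "p ` (R `` {x}) = {p x}" by blast
  then show ?thesis by (simp add: qval_def)
qed

lemma qop_class:
  assumes e: "equiv S R" and x: "x \<in> S" and y: "y \<in> S"
    and cong: "\<And>x' y'. (x, x') \<in> R \<Longrightarrow> (y, y') \<in> R \<Longrightarrow> (c x y, c x' y') \<in> R"
  shows "qop R c (R `` {x}) (R `` {y}) = R `` {c x y}"
proof -
  have c: "R `` {c x' y'} = R `` {c x y}" if "x' \<in> R `` {x}" "y' \<in> R `` {y}" for x' y'
    using equiv_class_eq[OF e cong[of x' y']] that by simp
  have "x \<in> R `` {x}" "y \<in> R `` {y}"
    using equiv_class_self[OF e x] equiv_class_self[OF e y] .
  then show ?thesis
    unfolding qop_def using c by blast
qed

context symmetric_strict_monoidal_category
begin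

lemma obj_closed:
  "A \<in> obj C \<Longrightarrow> B \<in> obj C \<Longrightarrow> A \<odot> B \<in> obj C" "ounit C \<in> obj C"
  "A \<in> obj C \<Longrightarrow> ounit C \<odot> A = A" "A \<in> obj C \<Longrightarrow> A \<odot> ounit C = A"
  "A \<in> obj C \<Longrightarrow> B \<in> obj C \<Longrightarrow> D \<in> obj C \<Longrightarrow> (A \<odot> B) \<odot> D = A \<odot> (B \<odot> D)"
  using obj_monoid by (auto simp: monoid_def obj_monoid_def)

lemmas base_simps = obj_closed src_obj tgt_obj idt_arr idt_src idt_tgt seq_arr seq_src seq_tgt
  atimes_arr atimes_src atimes_tgt braid_arr braid_src braid_tgt

lemma pwords_simps [simp]:
  "[] \<in> pwords C" "x # X \<in> pwords C \<longleftrightarrow> fst x \<in> obj C \<and> X \<in> pwords C"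
  "X @ Y \<in> pwords C \<longleftrightarrow> X \<in> pwords C \<and> Y \<in> pwords C"
  by (auto simp: pwords_def mem_Times_iff)

lemma wf_cell_boundaries:
  "wf_cell C a \<Longrightarrow> ttop C a \<in> obj C \<and> tbot C a \<in> obj C \<and> tleft a \<in> pwords C \<and> tright a \<in> pwords C"
  by (induction a) (auto simp: base_simps)

lemma cell_eq_wf:
  "cell_eq C a b \<Longrightarrow> wf_cell C a \<and> wf_cell C b \<and> ttop C a = ttop C b \<and> tbot C a = tbot C b
    \<and> tleft a = tleft b \<and> tright a = tright b"
  by (induction rule: cell_eq.induct) (auto simp: base_simps wf_cell_boundaries)

lemma wf_t_boundaries: "wf_t C t \<Longrightarrow> tdom C t \<in> pwords C \<and> tcod C t \<in> pwords C"
  by (induction t) (auto simp: base_simps split: polarity.splits)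

lemma t_eq_wf:
  "t_eq C t u \<Longrightarrow> wf_t C t \<and> wf_t C u \<and> tdom C t = tdom C u \<and> tcod C t = tcod C u"
  by (induction rule: t_eq.induct)
    (auto simp: base_simps wf_t_boundaries Nest_eta_def Nest_eps_def)

lemma equiv_cell: "equiv (Collect (wf_cell C)) (cell_rel C)"
  by (rule equivI) (auto simp: cell_rel_def refl_on_def sym_def trans_def
      dest: cell_eq_wf intro: c_refl c_sym c_trans)

lemma equiv_t: "equiv (Collect (wf_t C)) (t_rel C)"
  by (rule equivI) (auto simp: t_rel_def refl_on_def sym_def trans_def
      dest: t_eq_wf intro: t_refl t_sym t_trans)

lemma cell_rel_iff: "(a, b) \<in> cell_rel C \<longleftrightarrow> cell_eq C a b"
  by (simp add: cell_rel_def)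

lemma t_rel_iff: "(t, u) \<in> t_rel C \<longleftrightarrow> t_eq C t u"
  by (simp add: t_rel_def)

lemma cell_qval:
  assumes "wf_cell C a" "\<And>b. cell_eq C a b \<Longrightarrow> p a = p b"
  shows "qval p (cell_rel C `` {a}) = p a"
  using assms by (intro qval_class[OF equiv_cell]) (simp_all add: cell_rel_iff)

lemma free_cornering_simps:
  "wf_cell C a \<Longrightarrow> cell_rel C `` {a} \<in> cells (\<C> C)"
  "wf_cell C a \<Longrightarrow> ctop (\<C> C) (cell_rel C `` {a}) = ttop C a"
  "wf_cell C a \<Longrightarrow> cbot (\<C> C) (cell_rel C `` {a}) = tbot C a"
  "wf_cell C a \<Longrightarrow> cleft (\<C> C) (cell_rel C `` {a}) = tleft a"
  "wf_cell C a \<Longrightarrow> cright (\<C> C) (cell_rel C `` {a}) = tright a"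
  "hid (\<C> C) A = cell_rel C `` {HId A}"
  "vid (\<C> C) X = cell_rel C `` {VId X}"
  by (simp_all add: free_cornering_def quotientI cell_qval cell_eq_wf)

lemma free_cornering_comp:
  assumes "wf_cell C a" "wf_cell C b"
  shows "tright a = tleft b
      \<Longrightarrow> hcomp (\<C> C) (cell_rel C `` {a}) (cell_rel C `` {b}) = cell_rel C `` {a \<parallel> b}"
    and "tbot C a = ttop C b
      \<Longrightarrow> vcomp (\<C> C) (cell_rel C `` {a}) (cell_rel C `` {b}) = cell_rel C `` {a \<div> b}"
  using assms
  by (simp_all add: free_cornering_def)
    (rule qop_class[OF equiv_cell]; simp add: cell_rel_iff c_hcong c_vcong)+

lemma cell_class_eq: "cell_eq C a b \<Longrightarrow> cell_rel C `` {a} = cell_rel C `` {b}"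
  by (rule equiv_class_eq[OF equiv_cell]) (simp add: cell_rel_def)

lemma free_cornering_cellE:
  assumes "a \<in> cells (\<C> C)"
  obtains x where "wf_cell C x" "a = cell_rel C `` {x}"
  using assms by (auto simp: free_cornering_def elim: quotientE)

theorem free_cornering_double_category: "single_object_double_category (\<C> C)"
proof -
  have edges: "hedge (\<C> C) = obj_monoid C" "vedge (\<C> C) = pword_monoid C"
    "carrier (pword_monoid C) = pwords C" "\<one>\<^bsub>pword_monoid C\<^esub> = []"
    "X \<otimes>\<^bsub>pword_monoid C\<^esub> Y = X @ Y"
    "carrier (obj_monoid C) = obj C" "\<one>\<^bsub>obj_monoid C\<^esub> = ounit C"
    "A \<otimes>\<^bsub>obj_monoid C\<^esub> B = A \<odot> B" for X Y A B
    by (simp_all add: free_cornering_def pword_monoid_def obj_monoid_def)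
  have v: "monoid (pword_monoid C)"
    by unfold_locales (auto simp: pword_monoid_def)
  note laws = c_hassoc c_vassoc c_hunit_left c_hunit_right c_vunit_top c_vunit_bot c_hid c_vid
    c_unit c_interchange
  show ?thesis
    apply (rule single_object_double_category.intro)
    apply (erule free_cornering_cellE | simp add: edges v obj_monoid free_cornering_simps
        free_cornering_comp wf_cell_boundaries base_simps laws[THEN cell_class_eq])+
    done
qed

lemma t_qval:
  assumes "wf_t C t" "\<And>u. t_eq C t u \<Longrightarrow> p t = p u"
  shows "qval p (t_rel C `` {t}) = p t"
  using assms by (intro qval_class[OF equiv_t]) (simp_all add: t_rel_iff)

lemma T_simps:
  "wf_t C t \<Longrightarrow> t_rel C `` {t} \<in> arr (\<T> C)"
  "wf_t C t \<Longrightarrow> src (\<T> C) (t_rel C `` {t}) = tdom C t"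
  "wf_t C t \<Longrightarrow> tgt (\<T> C) (t_rel C `` {t}) = tcod C t"
  "idt (\<T> C) X = t_rel C `` {\<one>\<^sub>T X}"
  "obj (\<T> C) = pwords C" "X \<odot>\<^bsub>\<T> C\<^esub> Y = X @ Y" "ounit (\<T> C) = []"
  by (simp_all add: T_cat_def quotientI t_qval t_eq_wf)

lemma T_comp:
  assumes "wf_t C t" "wf_t C u"
  shows "tcod C t = tdom C u
      \<Longrightarrow> (t_rel C `` {t}) \<Zsemi>\<^bsub>\<T> C\<^esub> (t_rel C `` {u}) = t_rel C `` {t ;; u}"
    and "(t_rel C `` {t}) \<oslash>\<^bsub>\<T> C\<^esub> (t_rel C `` {u}) = t_rel C `` {t \<star> u}"
  using assms
  by (simp_all add: T_cat_def)
    (rule qop_class[OF equiv_t]; simp add: t_rel_iff t_seq_cong t_ten_cong)+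

lemma t_class_eq: "t_eq C t u \<Longrightarrow> t_rel C `` {t} = t_rel C `` {u}"
  by (rule equiv_class_eq[OF equiv_t]) (simp add: t_rel_def)

lemma T_arrE:
  assumes "f \<in> arr (\<T> C)"
  obtains t where "wf_t C t" "f = t_rel C `` {t}"
  using assms by (auto simp: T_cat_def elim: quotientE)

theorem T_spatial: "spatial_strict_monoidal_category (\<T> C)"
proof -
  have m: "monoid (obj_monoid (\<T> C))"
    by unfold_locales (auto simp: obj_monoid_def T_simps)
  have sp: "t_rel C `` {h \<star> \<one>\<^sub>T X} = t_rel C `` {\<one>\<^sub>T X \<star> h}"
    if "wf_t C h" "tdom C h = []" "tcod C h = []" "X \<in> pwords C" for h X
    using that by (intro t_class_eq t_spatial)
  note laws = t_id_seq t_seq_id t_seq_assoc t_ten_id t_interchange t_ten_assoc t_unit_ten t_ten_unit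
  have c: "category (\<T> C)"
    apply (rule category.intro)
    apply (erule T_arrE | simp add: T_simps T_comp wf_t_boundaries laws[THEN t_class_eq])+
    done
  have sm: "strict_monoidal_category (\<T> C)"
    apply (rule strict_monoidal_category.intro[OF c strict_monoidal_category_axioms.intro])
    apply (rule m)
    apply (erule T_arrE | simp add: T_simps T_comp wf_t_boundaries laws[THEN t_class_eq])+
    done
  show ?thesis
    apply (rule spatial_strict_monoidal_category.intro[OF sm
        spatial_strict_monoidal_category_axioms.intro])
    apply (erule T_arrE | simp add: T_simps T_comp wf_t_boundaries sp)+
    done
qed

end

end

theory Submission
  imports Defs
begin

text \<open>An arrow term \<open>t\<close> of \<open>\<T> \<A>\<close> is read as a horizontal cell \<open>horiz t\<close> by drawing
  each generator with corners and boxes. Conversely an arbitrary cell with top \<open>A\<close>, bottom \<open>B\<close>, left \<open>X\<close>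
  and right \<open>Y\<close> is bent into an arrow from \<open>A\<^sup>\<circ> @ X\<close> to \<open>Y @ B\<^sup>\<circ>\<close>; this turns \<open>\<T> \<A>\<close> into a model of the
  free cornering, so bending respects cell equality. Bending \<open>horiz t\<close> gives back \<open>t\<close> up to
  \<open>\<kappa>\<^sup>\<circ>\<close> and \<open>\<iota>\<^sup>\<circ>\<close>, and \<open>horiz\<close> of a bent cell gives back the cell up to corners, so
  \<open>horiz\<close> is faithful and full.

  For \<open>horiz\<close> to respect the equations of \<open>\<T> \<A>\<close>, cells that collect a one-coloured word, apply an arrow of
  \<open>\<A>\<close> to the product and emit a word are closed under both compositions, which reduces these equations to coherence
  in \<open>\<A>\<close>. Spatiality is different: it needs that an object of \<open>\<A>\<close> can be slid through an arbitrary
  cell by means of the braiding.\<close>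

text \<open>A chain of cell equations between two horizontal cells passes through composites whose
  parts have arbitrary boundaries. A translation back to \<open>\<T> C\<close> therefore cannot be
  defined by recursion on horizontal cells alone: every cell needs a value, and \<open>bend\<close>
  provides it. Two complications come from the edges. A horizontal edge is a single object while a
  vertical edge is a list, so the unit edge bends to the letter \<open>[(ounit C, White)]\<close>
  instead of the empty word, and a product edge bends to one letter instead of two.
  \<open>Iota\<close> and \<open>Kappa\<close>, which are mutually inverse, repair the first
  mismatch; \<open>Join\<close> and \<open>Unjoin\<close> repair the second. Horizontal edges are
  bent with the white colour only. The black generators have to be recovered from white ones as
  mates under \<open>Eta\<close> and \<open>Eps\<close>, which is where the equations mixing the two
  colours are needed. Both round trips hold only up to the two congruences, so the soundness of both
  translations has to be available before they are compared.\<close>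

lemma isomorphic_categoriesI:
  assumes "cat_functor D C F0 F1" and b0: "bij_betw F0 (obj D) (obj C)" and b1: "bij_betw F1 (arr D) (arr C)"
  shows "C \<cong>\<^sub>C D"
proof -
  interpret F: cat_functor D C F0 F1 by fact
  define G0 where "G0 = inv_into (obj D) F0"
  define G1 where "G1 = inv_into (arr D) F1"
  have G0: "A \<in> obj C \<Longrightarrow> G0 A \<in> obj D" "A \<in> obj C \<Longrightarrow> F0 (G0 A) = A" "B \<in> obj D \<Longrightarrow> G0 (F0 B) = B" for A B
    using b0 by (auto simp: G0_def bij_betw_def inv_into_into f_inv_into_f)
  have G1: "f \<in> arr C \<Longrightarrow> G1 f \<in> arr D" "f \<in> arr C \<Longrightarrow> F1 (G1 f) = f" "g \<in> arr D \<Longrightarrow> G1 (F1 g) = g" for f g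
    using b1 by (auto simp: G1_def bij_betw_def inv_into_into f_inv_into_f)
  have st: "src D (G1 f) = G0 (src C f)" "tgt D (G1 f) = G0 (tgt C f)" if "f \<in> arr C" for f
    using that F.on_src[of "G1 f"] F.on_tgt[of "G1 f"] G0(3) G1 F.dom.src_obj F.dom.tgt_obj by metis+
  have "cat_functor C D G0 G1"
  proof unfold_locales
    show "G1 (idt C A) = idt D (G0 A)" if "A \<in> obj C" for A
      using that F.on_idt[of "G0 A"] G0 G1 F.dom.idt_arr by metis
    show "G1 (f \<Zsemi>\<^bsub>C\<^esub> g) = G1 f \<Zsemi>\<^bsub>D\<^esub> G1 g" if "f \<in> arr C" "g \<in> arr C" "tgt C f = src C g" for f g
      using that F.on_seq[of "G1 f" "G1 g"] G1 st F.dom.seq_arr by metis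
  qed (simp_all add: G0 G1 st)
  then show ?thesis
    unfolding isomorphic_categories_def using assms(1) G0 G1 by blast
qed

section \<open>Unions over equivalence classes, ill-typed terms included\<close>

lemma UN_class:
  assumes "equiv W R" "\<And>w. (v, w) \<in> R \<Longrightarrow> F w = F v" "v \<notin> W \<Longrightarrow> F v = {}"
  shows "(\<Union>w\<in>R `` {v}. F w) = F v"
proof (cases "v \<in> W")
  case True
  with assms(1) have "v \<in> R `` {v}" by (rule equiv_class_self)
  then show ?thesis using assms(2) by blast
next
  case False
  then have "R `` {v} = {}" using assms(1) by (auto simp: equiv_def)
  with False assms(3) show ?thesis by simp
qed

text \<open>Elements outside \<open>W\<close> have the empty class, so two of them have equal
  classes without being related. This is what allows equations between classes without typing
  hypotheses.\<close>

lemma class_eqI: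
  assumes "equiv W R" "t \<in> W \<longleftrightarrow> u \<in> W" "t \<in> W \<Longrightarrow> (t, u) \<in> R"
  shows "R `` {t} = R `` {u}"
proof (cases "t \<in> W")
  case False
  then have "R `` {t} = {}" "R `` {u} = {}" using assms(1,2) by (auto simp: equiv_def)
  then show ?thesis by simp
qed (use assms(1,3) in \<open>rule equiv_class_eq\<close>)

section \<open>Calculating with arrow classes\<close>

context symmetric_strict_monoidal_category
begin

text \<open>On sets of terms the operations of \<open>\<T> C\<close> are total, the empty set acting as
  ``undefined'': an ill-typed term has an empty class. Hence associativity and the
  whiskering laws hold without side conditions and can be used freely for rewriting.\<close>

abbreviation tcls :: "('o, 'm) tterm \<Rightarrow> ('o, 'm) tterm set" ("\<langle>_\<rangle>")
  where "\<langle>t\<rangle> \<equiv> t_rel C `` {t}"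

abbreviation tseq (infixr "\<rhd>" 60) where "S \<rhd> T \<equiv> qop (t_rel C) Seq S T"
abbreviation tten (infixr "\<boxtimes>" 70) where "S \<boxtimes> T \<equiv> qop (t_rel C) Ten S T"

lemma tcls_eqI: "(wf_t C t \<longleftrightarrow> wf_t C u) \<Longrightarrow> (wf_t C t \<Longrightarrow> t_eq C t u) \<Longrightarrow> \<langle>t\<rangle> = \<langle>u\<rangle>"
  by (rule class_eqI[OF equiv_t]) (simp_all add: t_rel_iff)

lemma tcls_not_wf: "\<not> wf_t C t \<Longrightarrow> \<langle>t\<rangle> = {}"
  by (auto simp: t_rel_iff dest: t_eq_wf)

lemma UN_tcls:
  "(\<Union>w\<in>\<langle>v\<rangle>. \<langle>w ;; z\<rangle>) = \<langle>v ;; z\<rangle>" "(\<Union>w\<in>\<langle>v\<rangle>. \<langle>z ;; w\<rangle>) = \<langle>z ;; v\<rangle>"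
  "(\<Union>w\<in>\<langle>v\<rangle>. \<langle>w \<star> z\<rangle>) = \<langle>v \<star> z\<rangle>" "(\<Union>w\<in>\<langle>v\<rangle>. \<langle>z \<star> w\<rangle>) = \<langle>z \<star> v\<rangle>"
  by (rule UN_class[OF equiv_t];
      auto simp: t_rel_iff tcls_not_wf dest: t_eq_wf intro!: tcls_eqI t_seq_cong t_ten_cong intro: t_sym t_refl)+

lemma tcls_seq: "\<langle>t ;; u\<rangle> = \<langle>t\<rangle> \<rhd> \<langle>u\<rangle>" and tcls_ten: "\<langle>t \<star> u\<rangle> = \<langle>t\<rangle> \<boxtimes> \<langle>u\<rangle>"
  by (simp_all only: qop_def UN_tcls)

lemma UN_tcls2:
  "(\<Union>w\<in>\<langle>v\<rangle>. \<Union>z\<in>U. \<langle>w ;; f z\<rangle>) = (\<Union>z\<in>U. \<langle>v ;; f z\<rangle>)"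
  "(\<Union>w\<in>\<langle>v\<rangle>. \<Union>z\<in>U. \<langle>w \<star> f z\<rangle>) = (\<Union>z\<in>U. \<langle>v \<star> f z\<rangle>)"
  by (subst SUP_commute, simp only: UN_tcls)+

lemma UN_tcls3:
  "(\<Union>w\<in>\<langle>v\<rangle>. \<Union>y\<in>S. \<Union>z\<in>U. \<langle>w \<star> f y z\<rangle>) = (\<Union>y\<in>S. \<Union>z\<in>U. \<langle>v \<star> f y z\<rangle>)"
  by (subst SUP_commute, simp only: UN_tcls2)

text \<open>Unfolding the operations on sets gives nested unions over classes of terms. Collapsing
  the inner ones reduces an identity between sets to the same identity between classes of single
  terms, with equal outer unions on both sides.\<close>

lemmas UN_norm = qop_def UN_UN_flatten UN_tcls UN_tcls2 UN_tcls3

lemma tseq_assoc: "(S \<rhd> T) \<rhd> U = S \<rhd> T \<rhd> U"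
proof -
  have "\<langle>(x ;; y) ;; z\<rangle> = \<langle>x ;; (y ;; z)\<rangle>" for x y z
    by (rule tcls_eqI) (auto intro: t_seq_assoc)
  then show ?thesis by (simp only: UN_norm)
qed

lemma tten_assoc: "(S \<boxtimes> T) \<boxtimes> U = S \<boxtimes> T \<boxtimes> U"
proof -
  have "\<langle>(x \<star> y) \<star> z\<rangle> = \<langle>x \<star> (y \<star> z)\<rangle>" for x y z
    by (rule tcls_eqI) (auto intro: t_ten_assoc)
  then show ?thesis by (simp only: UN_norm)
qed

text \<open>Only identities are distributed over a composite. Cancelling the word \<open>X\<close>
  in \<open>X @ tcod C x = X @ tdom C y\<close> shows that both sides are well-formed together; in
  the general interchange law the word in the middle could factor in two different ways.\<close>

lemma whisker_left: "\<langle>\<one>\<^sub>T X\<rangle> \<boxtimes> (S \<rhd> T) = (\<langle>\<one>\<^sub>T X\<rangle> \<boxtimes> S) \<rhd> (\<langle>\<one>\<^sub>T X\<rangle> \<boxtimes> T)"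
proof -
  have "\<langle>\<one>\<^sub>T X \<star> (x ;; y)\<rangle> = \<langle>(\<one>\<^sub>T X \<star> x) ;; (\<one>\<^sub>T X \<star> y)\<rangle>" for x y
  proof (rule tcls_eqI)
    assume w: "wf_t C (\<one>\<^sub>T X \<star> (x ;; y))"
    then have "t_eq C (\<one>\<^sub>T X) (\<one>\<^sub>T X ;; \<one>\<^sub>T X)"
      using t_id_seq[of C "\<one>\<^sub>T X"] by (auto intro: t_sym)
    with w show "t_eq C (\<one>\<^sub>T X \<star> (x ;; y)) ((\<one>\<^sub>T X \<star> x) ;; (\<one>\<^sub>T X \<star> y))"
      by (auto intro!: t_trans[OF t_ten_cong t_interchange] t_refl)
  qed auto
  then show ?thesis by (simp only: UN_norm)
qed

lemma whisker_right: "(S \<rhd> T) \<boxtimes> \<langle>\<one>\<^sub>T X\<rangle> = (S \<boxtimes> \<langle>\<one>\<^sub>T X\<rangle>) \<rhd> (T \<boxtimes> \<langle>\<one>\<^sub>T X\<rangle>)"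
proof -
  have "\<langle>(x ;; y) \<star> \<one>\<^sub>T X\<rangle> = \<langle>(x \<star> \<one>\<^sub>T X) ;; (y \<star> \<one>\<^sub>T X)\<rangle>" for x y
  proof (rule tcls_eqI)
    assume w: "wf_t C ((x ;; y) \<star> \<one>\<^sub>T X)"
    then have "t_eq C (\<one>\<^sub>T X) (\<one>\<^sub>T X ;; \<one>\<^sub>T X)"
      using t_id_seq[of C "\<one>\<^sub>T X"] by (auto intro: t_sym)
    with w show "t_eq C ((x ;; y) \<star> \<one>\<^sub>T X) ((x \<star> \<one>\<^sub>T X) ;; (y \<star> \<one>\<^sub>T X))"
      by (auto intro!: t_trans[OF t_ten_cong t_interchange] t_refl)
  qed auto
  then show ?thesis by (simp only: UN_norm)
qed

lemma id_ten_id: "\<langle>\<one>\<^sub>T X\<rangle> \<boxtimes> \<langle>\<one>\<^sub>T Y\<rangle> = \<langle>\<one>\<^sub>T (X @ Y)\<rangle>"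
  unfolding tcls_ten[symmetric] by (rule tcls_eqI) (auto intro: t_ten_id)

lemma id_ten_id_ten: "\<langle>\<one>\<^sub>T X\<rangle> \<boxtimes> \<langle>\<one>\<^sub>T Y\<rangle> \<boxtimes> S = \<langle>\<one>\<^sub>T (X @ Y)\<rangle> \<boxtimes> S"
  by (simp only: tten_assoc[symmetric] id_ten_id)

lemma unit_ten: "\<langle>\<one>\<^sub>T []\<rangle> \<boxtimes> \<langle>t\<rangle> = \<langle>t\<rangle>" "\<langle>t\<rangle> \<boxtimes> \<langle>\<one>\<^sub>T []\<rangle> = \<langle>t\<rangle>"
  unfolding tcls_ten[symmetric] by (rule tcls_eqI; auto intro: t_unit_ten t_ten_unit)+

lemma unit_ten_ten: "\<langle>\<one>\<^sub>T []\<rangle> \<boxtimes> S \<boxtimes> T = S \<boxtimes> T"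
proof -
  have "\<langle>(\<one>\<^sub>T [] \<star> x) \<star> y\<rangle> = \<langle>x \<star> y\<rangle>" for x y
    by (simp only: tcls_ten unit_ten)
  then have "(\<langle>\<one>\<^sub>T []\<rangle> \<boxtimes> S) \<boxtimes> T = S \<boxtimes> T" by (simp only: UN_norm)
  then show ?thesis by (simp only: tten_assoc)
qed

text \<open>As rewrite rules these turn a term into a right-nested composite of factors padded by at
  most one identity on each side. Most calculations below take place in this form.\<close>

lemmas strict = tseq_assoc tten_assoc whisker_left whisker_right id_ten_id id_ten_id_ten
  unit_ten unit_ten_ten append.simps append_assoc append_Nil2

definition thom where
  "thom X Y = {S. \<exists>t. wf_t C t \<and> tdom C t = X \<and> tcod C t = Y \<and> S = \<langle>t\<rangle>}"

lemma thom_seqI: "S \<in> thom X Y \<Longrightarrow> T \<in> thom Y Z \<Longrightarrow> S \<rhd> T \<in> thom X Z"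
  unfolding thom_def by clarify (metis tcls_seq wf_t.simps(2) tdom.simps(2) tcod.simps(2))

lemma thom_cls: "wf_t C t \<Longrightarrow> \<langle>t\<rangle> \<in> thom (tdom C t) (tcod C t)"
  unfolding thom_def by blast

lemma id_seq: "S \<in> thom X Y \<Longrightarrow> \<langle>\<one>\<^sub>T X\<rangle> \<rhd> S = S"
  unfolding thom_def by clarify (simp add: t_class_eq t_id_seq flip: tcls_seq)

lemma seq_id: "S \<in> thom X Y \<Longrightarrow> S \<rhd> \<langle>\<one>\<^sub>T Y\<rangle> = S"
  unfolding thom_def by clarify (simp add: t_class_eq t_seq_id flip: tcls_seq)

lemma unit_ten_thom: "S \<in> thom X Y \<Longrightarrow> \<langle>\<one>\<^sub>T []\<rangle> \<boxtimes> S = S" "S \<in> thom X Y \<Longrightarrow> S \<boxtimes> \<langle>\<one>\<^sub>T []\<rangle> = S"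
  unfolding thom_def by (auto simp: unit_ten)

lemma exchange:
  assumes "S \<in> thom X X'" "T \<in> thom Y Y'"
  shows "(\<langle>\<one>\<^sub>T X\<rangle> \<boxtimes> T) \<rhd> (S \<boxtimes> \<langle>\<one>\<^sub>T Y'\<rangle>) = S \<boxtimes> T" "(S \<boxtimes> \<langle>\<one>\<^sub>T Y\<rangle>) \<rhd> (\<langle>\<one>\<^sub>T X'\<rangle> \<boxtimes> T) = S \<boxtimes> T"
proof -
  from assms obtain s t where st: "wf_t C s" "tdom C s = X" "tcod C s = X'" "S = \<langle>s\<rangle>"
    "wf_t C t" "tdom C t = Y" "tcod C t = Y'" "T = \<langle>t\<rangle>"
    unfolding thom_def by auto
  note b = wf_t_boundaries[OF st(1)] wf_t_boundaries[OF st(5)]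
  have "t_eq C ((\<one>\<^sub>T X \<star> t) ;; (s \<star> \<one>\<^sub>T Y')) (s \<star> t)"
    using st b by (intro t_trans[OF t_sym[OF t_interchange] t_ten_cong])
      (auto intro: t_id_seq t_seq_id)
  moreover have "t_eq C ((s \<star> \<one>\<^sub>T Y) ;; (\<one>\<^sub>T X' \<star> t)) (s \<star> t)"
    using st b by (intro t_trans[OF t_sym[OF t_interchange] t_ten_cong])
      (auto intro: t_id_seq t_seq_id)
  ultimately show "(\<langle>\<one>\<^sub>T X\<rangle> \<boxtimes> T) \<rhd> (S \<boxtimes> \<langle>\<one>\<^sub>T Y'\<rangle>) = S \<boxtimes> T"
    "(S \<boxtimes> \<langle>\<one>\<^sub>T Y\<rangle>) \<rhd> (\<langle>\<one>\<^sub>T X'\<rangle> \<boxtimes> T) = S \<boxtimes> T"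
    using st by (simp_all add: t_class_eq flip: tcls_seq tcls_ten)
qed

abbreviation tid ("\<^bold>1") where "\<^bold>1 X \<equiv> \<langle>\<one>\<^sub>T X\<rangle>"

text \<open>Makes an equation with a composite on its left-hand side applicable in the middle of a
  right-nested composite.\<close>

lemma seq_ext: "S \<rhd> T = R \<Longrightarrow> S \<rhd> T \<rhd> K = R \<rhd> K"
  by (simp flip: tseq_assoc)

text \<open>The four shapes are those in which a factor occurs after rewriting with
  \<open>strict\<close>: bare, or padded on the left, on the right, or on both sides.\<close>

lemma id_elim_left:
  assumes "wf_t C t"
  shows "X = tdom C t \<Longrightarrow> \<^bold>1 X \<rhd> \<langle>t\<rangle> = \<langle>t\<rangle>"
    and "X = U @ tdom C t \<Longrightarrow> U \<in> pwords C \<Longrightarrow> \<^bold>1 X \<rhd> \<^bold>1 U \<boxtimes> \<langle>t\<rangle> = \<^bold>1 U \<boxtimes> \<langle>t\<rangle>"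
    and "X = tdom C t @ V \<Longrightarrow> V \<in> pwords C \<Longrightarrow> \<^bold>1 X \<rhd> \<langle>t\<rangle> \<boxtimes> \<^bold>1 V = \<langle>t\<rangle> \<boxtimes> \<^bold>1 V"
    and "X = U @ tdom C t @ V \<Longrightarrow> U \<in> pwords C \<Longrightarrow> V \<in> pwords C
      \<Longrightarrow> \<^bold>1 X \<rhd> \<^bold>1 U \<boxtimes> \<langle>t\<rangle> \<boxtimes> \<^bold>1 V = \<^bold>1 U \<boxtimes> \<langle>t\<rangle> \<boxtimes> \<^bold>1 V"
  using assms by (auto simp flip: tcls_seq tcls_ten intro!: t_class_eq
    intro: t_id_seq[of C t] t_id_seq[of C "\<one>\<^sub>T U \<star> t", simplified]
      t_id_seq[of C "t \<star> \<one>\<^sub>T V", simplified] t_id_seq[of C "\<one>\<^sub>T U \<star> (t \<star> \<one>\<^sub>T V)", simplified])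

lemma id_elim_right:
  assumes "wf_t C t"
  shows "X = tcod C t \<Longrightarrow> \<langle>t\<rangle> \<rhd> \<^bold>1 X = \<langle>t\<rangle>"
    and "X = U @ tcod C t \<Longrightarrow> U \<in> pwords C \<Longrightarrow> (\<^bold>1 U \<boxtimes> \<langle>t\<rangle>) \<rhd> \<^bold>1 X = \<^bold>1 U \<boxtimes> \<langle>t\<rangle>"
    and "X = tcod C t @ V \<Longrightarrow> V \<in> pwords C \<Longrightarrow> (\<langle>t\<rangle> \<boxtimes> \<^bold>1 V) \<rhd> \<^bold>1 X = \<langle>t\<rangle> \<boxtimes> \<^bold>1 V"
    and "X = U @ tcod C t @ V \<Longrightarrow> U \<in> pwords C \<Longrightarrow> V \<in> pwords C
      \<Longrightarrow> (\<^bold>1 U \<boxtimes> \<langle>t\<rangle> \<boxtimes> \<^bold>1 V) \<rhd> \<^bold>1 X = \<^bold>1 U \<boxtimes> \<langle>t\<rangle> \<boxtimes> \<^bold>1 V"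
  using assms by (auto simp flip: tcls_seq tcls_ten intro!: t_class_eq
    intro: t_seq_id[of C t] t_seq_id[of C "\<one>\<^sub>T U \<star> t", simplified]
      t_seq_id[of C "t \<star> \<one>\<^sub>T V", simplified] t_seq_id[of C "\<one>\<^sub>T U \<star> (t \<star> \<one>\<^sub>T V)", simplified])

lemma id_seq_id: "X \<in> pwords C \<Longrightarrow> \<^bold>1 X \<rhd> \<^bold>1 X = \<^bold>1 X"
  by (rule id_elim_left) simp_all

lemmas id_elim = id_seq_id id_seq_id[THEN seq_ext] id_elim_left id_elim_left[THEN seq_ext] id_elim_right
  id_elim_right[THEN seq_ext]

abbreviation "br A B \<equiv> \<langle>Sigma White A B\<rangle>"
abbreviation "mg A B \<equiv> \<langle>Merge White A B\<rangle>"
abbreviation "sp A B \<equiv> \<langle>Split White A B\<rangle>"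

text \<open>The defining equations of \<open>\<T> C\<close>, restated for classes in the form
  produced by \<open>strict\<close>, so that they can serve as rewrite rules.\<close>

lemmas iota_kappa = t_iota_kappa[THEN t_class_eq, unfolded tcls_seq tcls_ten strict]
lemmas map_white_ten = t_map_white_ten[THEN t_class_eq, unfolded tcls_seq tcls_ten strict]
lemmas nat_white_right = t_nat_white_right[THEN t_class_eq, unfolded tcls_seq tcls_ten strict]
lemmas snake_white = t_snake_white[THEN t_class_eq, unfolded tcls_seq tcls_ten strict]
lemmas snake_black = t_snake_black[THEN t_class_eq, unfolded tcls_seq tcls_ten strict]
lemmas iota_merge_left = t_iota_merge_left[THEN t_class_eq, unfolded tcls_seq tcls_ten strict]
lemmas iota_merge_right = t_iota_merge_right[THEN t_class_eq, unfolded tcls_seq tcls_ten strict]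
lemmas kappa_iota = t_kappa_iota[THEN t_class_eq, unfolded tcls_seq tcls_ten strict]
lemmas map_white_braid = t_map_white_braid[THEN t_class_eq, unfolded tcls_seq tcls_ten strict]
lemmas map_white_idt = t_map_white_idt[THEN t_class_eq, unfolded tcls_seq tcls_ten strict]
lemmas map_white_seq = t_map_white_seq[THEN t_class_eq, unfolded tcls_seq tcls_ten strict]
lemmas merge_assoc = t_merge_assoc[THEN t_class_eq, unfolded tcls_seq tcls_ten strict]
lemmas merge_sigma_left = t_merge_sigma_left[THEN t_class_eq, unfolded tcls_seq tcls_ten strict]
lemmas merge_sigma_right = t_merge_sigma_right[THEN t_class_eq, unfolded tcls_seq tcls_ten strict]
lemmas merge_split = t_merge_split[THEN t_class_eq, unfolded tcls_seq tcls_ten strict]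
lemmas nat_white_left = t_nat_white_left[THEN t_class_eq, unfolded tcls_seq tcls_ten strict]
lemmas sigma_kappa_left = t_sigma_kappa_left[THEN t_class_eq, unfolded tcls_seq tcls_ten strict]
lemmas sigma_kappa_right = t_sigma_kappa_right[THEN t_class_eq, unfolded tcls_seq tcls_ten strict]
lemmas sigma_split_left = t_sigma_split_left[THEN t_class_eq, unfolded tcls_seq tcls_ten strict]
lemmas split_merge = t_split_merge[THEN t_class_eq, unfolded tcls_seq tcls_ten strict]

section \<open>Bending cells into arrows\<close>

text \<open>The presentation does not state that crossings are involutive. It follows from the
  symmetry of C because a crossing is a merge, the white copy of the braiding and a split: between
  two crossings the split cancels the merge, and the two braidings compose by functoriality.\<close>

lemma sigma_sigma:
  assumes "A \<in> obj C" "B \<in> obj C"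
  shows "br A B \<rhd> br B A = \<^bold>1 [(A, White), (B, White)]"
proof -
  have "mg A B \<rhd> \<langle>Map White (\<sigma> A B)\<rangle> \<rhd> (sp B A \<rhd> mg B A) \<rhd> \<langle>Map White (\<sigma> B A)\<rangle> \<rhd> sp A B
      = mg A B \<rhd> (\<langle>Map White (\<sigma> A B)\<rangle> \<rhd> \<langle>Map White (\<sigma> B A)\<rangle>) \<rhd> sp A B"
    by (simp add: split_merge assms id_elim tseq_assoc base_simps)
  also have "\<dots> = mg A B \<rhd> \<langle>Map White (idt C (A \<odot> B))\<rangle> \<rhd> sp A B"
    by (simp add: map_white_seq assms braid_symmetric base_simps)
  also have "\<dots> = \<^bold>1 [(A, White), (B, White)]"
    by (simp add: map_white_idt merge_split assms id_elim tseq_assoc base_simps)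
  finally show ?thesis
    by (simp add: tseq_assoc assms flip: map_white_braid)
qed

text \<open>One of the three crossings is expanded into merge, braiding and split, and each of these
  three is moved past the wire \<open>Z\<close>: the merge and the split by their compatibility with
  crossings, the braiding by naturality.\<close>

lemma yang_baxter:
  assumes "X \<in> obj C" "Y \<in> obj C" "Z \<in> obj C"
  shows "(\<^bold>1 (X\<^sup>\<circ>) \<boxtimes> br Y Z) \<rhd> (br X Z \<boxtimes> \<^bold>1 (Y\<^sup>\<circ>)) \<rhd> (\<^bold>1 (Z\<^sup>\<circ>) \<boxtimes> br X Y)
    = (br X Y \<boxtimes> \<^bold>1 (Z\<^sup>\<circ>)) \<rhd> (\<^bold>1 (Y\<^sup>\<circ>) \<boxtimes> br X Z) \<rhd> (br Y Z \<boxtimes> \<^bold>1 (X\<^sup>\<circ>))" (is "?l = ?r")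
proof -
  let ?s = "\<langle>Map White (\<sigma> X Y)\<rangle>" and ?z = "\<^bold>1 (Z\<^sup>\<circ>)"
  note b = map_white_braid[OF assms(1,2), symmetric]
  have "?l = (\<^bold>1 (X\<^sup>\<circ>) \<boxtimes> br Y Z) \<rhd> (br X Z \<boxtimes> \<^bold>1 (Y\<^sup>\<circ>)) \<rhd> (?z \<boxtimes> mg X Y) \<rhd> (?z \<boxtimes> ?s) \<rhd> (?z \<boxtimes> sp Y X)"
    by (simp only: b strict)
  also have "\<dots> = (mg X Y \<boxtimes> ?z) \<rhd> (br (X \<odot> Y) Z \<rhd> (?z \<boxtimes> ?s)) \<rhd> (?z \<boxtimes> sp Y X)"
    using merge_sigma_left[OF assms, of White] by (simp only: flip: tseq_assoc)
  also have "br (X \<odot> Y) Z \<rhd> (?z \<boxtimes> ?s) = (?s \<boxtimes> ?z) \<rhd> br (Y \<odot> X) Z"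
    using nat_white_left[of "\<sigma> X Y" Z] assms by (simp add: base_simps)
  also have "(mg X Y \<boxtimes> ?z) \<rhd> ((?s \<boxtimes> ?z) \<rhd> br (Y \<odot> X) Z) \<rhd> (?z \<boxtimes> sp Y X)
     = (mg X Y \<boxtimes> ?z) \<rhd> (?s \<boxtimes> ?z) \<rhd> (sp Y X \<boxtimes> ?z) \<rhd> (\<^bold>1 (Y\<^sup>\<circ>) \<boxtimes> br X Z) \<rhd> (br Y Z \<boxtimes> \<^bold>1 (X\<^sup>\<circ>))"
    using sigma_split_left[OF assms(2,1,3), of White] by (simp only: tseq_assoc)
  also have "\<dots> = ?r" by (simp only: b strict)
  finally show ?thesis .
qed

text \<open>The order of the two objects is reversed because a vertical word is read from top to bottom:
  in a cell \<open>a \<parallel> b\<close> it is the top edge of \<open>b\<close> that has to be bent to the left first.\<close>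

definition "Join A B = Sigma White B A ;; Merge White A B"
definition "Unjoin A B = Split White A B ;; Sigma White A B"

lemma join_simps [simp]:
  "tdom C (Join A B) = [(B, White), (A, White)]" "tcod C (Join A B) = [(A \<odot> B, White)]"
  "wf_t C (Join A B) \<longleftrightarrow> A \<in> obj C \<and> B \<in> obj C"
  "tdom C (Unjoin A B) = [(A \<odot> B, White)]" "tcod C (Unjoin A B) = [(B, White), (A, White)]"
  "wf_t C (Unjoin A B) \<longleftrightarrow> A \<in> obj C \<and> B \<in> obj C"
  by (auto simp: Join_def Unjoin_def)

lemma join_unjoin:
  assumes "A \<in> obj C" "B \<in> obj C"
  shows "\<langle>Join A B\<rangle> \<rhd> \<langle>Unjoin A B\<rangle> = \<^bold>1 [(B, White), (A, White)]"
    and "\<langle>Unjoin A B\<rangle> \<rhd> \<langle>Join A B\<rangle> = \<^bold>1 [(A \<odot> B, White)]"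
  using assms by (simp_all add: Join_def Unjoin_def tcls_seq tseq_assoc sigma_sigma
    sigma_sigma[THEN seq_ext] merge_split[THEN seq_ext]
    split_merge id_elim)

text \<open>Both sides reverse a word of three letters and then merge it. They differ in the order
  of the three crossings, which Yang-Baxter settles, and in the bracketing of the merge, which is
  associative.\<close>

lemma join_assoc:
  assumes "A \<in> obj C" "B \<in> obj C" "D \<in> obj C"
  shows "(\<^bold>1 (D\<^sup>\<circ>) \<boxtimes> \<langle>Join A B\<rangle>) \<rhd> \<langle>Join (A \<odot> B) D\<rangle> = (\<langle>Join B D\<rangle> \<boxtimes> \<^bold>1 (A\<^sup>\<circ>)) \<rhd> \<langle>Join A (B \<odot> D)\<rangle>"
proof -
  have "(\<^bold>1 (D\<^sup>\<circ>) \<boxtimes> \<langle>Join A B\<rangle>) \<rhd> \<langle>Join (A \<odot> B) D\<rangle>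
     = (\<^bold>1 (D\<^sup>\<circ>) \<boxtimes> br B A) \<rhd> ((\<^bold>1 (D\<^sup>\<circ>) \<boxtimes> mg A B) \<rhd> br D (A \<odot> B)) \<rhd> mg (A \<odot> B) D"
    by (simp only: Join_def tcls_seq strict)
  also have "\<dots> = ((\<^bold>1 (D\<^sup>\<circ>) \<boxtimes> br B A) \<rhd> (br D A \<boxtimes> \<^bold>1 (B\<^sup>\<circ>)) \<rhd> (\<^bold>1 (A\<^sup>\<circ>) \<boxtimes> br D B))
      \<rhd> (mg A B \<boxtimes> \<^bold>1 (D\<^sup>\<circ>)) \<rhd> mg (A \<odot> B) D"
    by (simp only: merge_sigma_right assms tseq_assoc)
  also have "\<dots> = ((br D B \<boxtimes> \<^bold>1 (A\<^sup>\<circ>)) \<rhd> (\<^bold>1 (B\<^sup>\<circ>) \<boxtimes> br D A) \<rhd> (br B A \<boxtimes> \<^bold>1 (D\<^sup>\<circ>)))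
      \<rhd> (\<^bold>1 (A\<^sup>\<circ>) \<boxtimes> mg B D) \<rhd> mg A (B \<odot> D)"
    by (simp only: yang_baxter[OF assms(3,2,1)] merge_assoc assms)
  also have "\<dots> = (br D B \<boxtimes> \<^bold>1 (A\<^sup>\<circ>)) \<rhd> ((mg B D \<boxtimes> \<^bold>1 (A\<^sup>\<circ>)) \<rhd> br (B \<odot> D) A) \<rhd> mg A (B \<odot> D)"
    by (simp only: merge_sigma_left assms tseq_assoc)
  also have "\<dots> = (\<langle>Join B D\<rangle> \<boxtimes> \<^bold>1 (A\<^sup>\<circ>)) \<rhd> \<langle>Join A (B \<odot> D)\<rangle>"
    by (simp only: Join_def tcls_seq strict)
  finally show ?thesis .
qed

lemma thom_gen: "wf_t C t \<Longrightarrow> X = tdom C t \<Longrightarrow> Y = tcod C t \<Longrightarrow> \<langle>t\<rangle> \<in> thom X Y"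
  using thom_cls by simp

lemma inverse_unique:
  assumes "S \<in> thom X Y" "T \<in> thom Y X" "T' \<in> thom Y X" "T \<rhd> S = \<^bold>1 Y" "S \<rhd> T' = \<^bold>1 X"
  shows "T = T'"
  by (metis assms id_seq seq_id tseq_assoc)

text \<open>Obtained from associativity of joining by uniqueness of inverses, which avoids repeating
  the calculation with crossings.\<close>

lemma unjoin_assoc:
  assumes "A \<in> obj C" "B \<in> obj C" "D \<in> obj C"
  shows "\<langle>Unjoin (A \<odot> B) D\<rangle> \<rhd> (\<^bold>1 (D\<^sup>\<circ>) \<boxtimes> \<langle>Unjoin A B\<rangle>)
    = \<langle>Unjoin A (B \<odot> D)\<rangle> \<rhd> (\<langle>Unjoin B D\<rangle> \<boxtimes> \<^bold>1 (A\<^sup>\<circ>))"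
proof (rule inverse_unique)
  let ?X = "[(D, White), (B, White), (A, White)]" and ?Y = "[(A \<odot> B \<odot> D, White)]"
  show "(\<^bold>1 (D\<^sup>\<circ>) \<boxtimes> \<langle>Join A B\<rangle>) \<rhd> \<langle>Join (A \<odot> B) D\<rangle> \<in> thom ?X ?Y"
    "\<langle>Unjoin (A \<odot> B) D\<rangle> \<rhd> (\<^bold>1 (D\<^sup>\<circ>) \<boxtimes> \<langle>Unjoin A B\<rangle>) \<in> thom ?Y ?X"
    "\<langle>Unjoin A (B \<odot> D)\<rangle> \<rhd> (\<langle>Unjoin B D\<rangle> \<boxtimes> \<^bold>1 (A\<^sup>\<circ>)) \<in> thom ?Y ?X"
    using assms by (auto simp flip: tcls_seq tcls_ten simp: base_simps intro!: thom_gen)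
  have "(\<langle>Unjoin (A \<odot> B) D\<rangle> \<rhd> \<^bold>1 (D\<^sup>\<circ>) \<boxtimes> \<langle>Unjoin A B\<rangle>) \<rhd> \<^bold>1 (D\<^sup>\<circ>) \<boxtimes> \<langle>Join A B\<rangle> \<rhd> \<langle>Join (A \<odot> B) D\<rangle>
    = \<langle>Unjoin (A \<odot> B) D\<rangle> \<rhd> \<^bold>1 (D\<^sup>\<circ>) \<boxtimes> (\<langle>Unjoin A B\<rangle> \<rhd> \<langle>Join A B\<rangle>) \<rhd> \<langle>Join (A \<odot> B) D\<rangle>"
    by (simp only: strict)
  also have "\<dots> = \<^bold>1 ?Y"
    using assms by (simp add: join_unjoin id_ten_id id_elim base_simps)
  finally show "(\<langle>Unjoin (A \<odot> B) D\<rangle> \<rhd> \<^bold>1 (D\<^sup>\<circ>) \<boxtimes> \<langle>Unjoin A B\<rangle>) \<rhd> \<^bold>1 (D\<^sup>\<circ>) \<boxtimes> \<langle>Join A B\<rangle> \<rhd> \<langle>Join (A \<odot> B) D\<rangle> = \<^bold>1 ?Y" .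
  have "(\<langle>Join B D\<rangle> \<boxtimes> \<^bold>1 (A\<^sup>\<circ>) \<rhd> \<langle>Join A (B \<odot> D)\<rangle>) \<rhd> \<langle>Unjoin A (B \<odot> D)\<rangle> \<rhd> \<langle>Unjoin B D\<rangle> \<boxtimes> \<^bold>1 (A\<^sup>\<circ>)
    = \<^bold>1 ?X"
  proof -
    have "(\<langle>Join B D\<rangle> \<boxtimes> \<^bold>1 (A\<^sup>\<circ>) \<rhd> \<langle>Join A (B \<odot> D)\<rangle>) \<rhd> \<langle>Unjoin A (B \<odot> D)\<rangle> \<rhd> \<langle>Unjoin B D\<rangle> \<boxtimes> \<^bold>1 (A\<^sup>\<circ>)
      = \<langle>Join B D\<rangle> \<boxtimes> \<^bold>1 (A\<^sup>\<circ>) \<rhd> \<langle>Unjoin B D\<rangle> \<boxtimes> \<^bold>1 (A\<^sup>\<circ>)"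
      using assms by (simp add: join_unjoin[THEN seq_ext] tseq_assoc id_elim base_simps)
    also have "\<dots> = (\<langle>Join B D\<rangle> \<rhd> \<langle>Unjoin B D\<rangle>) \<boxtimes> \<^bold>1 (A\<^sup>\<circ>)" by (simp only: strict)
    also have "\<dots> = \<^bold>1 ?X" using assms by (simp add: join_unjoin id_ten_id)
    finally show ?thesis .
  qed
  then show "((\<^bold>1 (D\<^sup>\<circ>) \<boxtimes> \<langle>Join A B\<rangle>) \<rhd> \<langle>Join (A \<odot> B) D\<rangle>) \<rhd> \<langle>Unjoin A (B \<odot> D)\<rangle> \<rhd> \<langle>Unjoin B D\<rangle> \<boxtimes> \<^bold>1 (A\<^sup>\<circ>) = \<^bold>1 ?X"
    by (simp add: join_assoc assms)
qed

lemma join_unit: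
  assumes "A \<in> obj C"
  shows "\<langle>Join (ounit C) A\<rangle> = \<^bold>1 (A\<^sup>\<circ>) \<boxtimes> \<langle>Kappa White\<rangle>" "\<langle>Join A (ounit C)\<rangle> = \<langle>Kappa White\<rangle> \<boxtimes> \<^bold>1 (A\<^sup>\<circ>)"
proof -
  \<comment> \<open>The identity on the unit letter is inserted in the form \<kappa> followed by
    \<iota>: \<kappa> removes the crossing, and \<iota> then cancels the merge.\<close>
  have "br A (ounit C) \<rhd> ((\<langle>Kappa White\<rangle> \<rhd> \<langle>Iota White\<rangle>) \<boxtimes> \<^bold>1 (A\<^sup>\<circ>)) \<rhd> mg (ounit C) A
    = \<^bold>1 (A\<^sup>\<circ>) \<boxtimes> \<langle>Kappa White\<rangle>"
    using assms by (simp add: sigma_kappa_right sigma_kappa_right[THEN seq_ext] whisker_right tseq_assoc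
       iota_merge_left id_elim)
  then show "\<langle>Join (ounit C) A\<rangle> = \<^bold>1 (A\<^sup>\<circ>) \<boxtimes> \<langle>Kappa White\<rangle>"
    using assms by (simp add: Join_def tcls_seq kappa_iota id_ten_id id_elim base_simps)
  have "br (ounit C) A \<rhd> (\<^bold>1 (A\<^sup>\<circ>) \<boxtimes> (\<langle>Kappa White\<rangle> \<rhd> \<langle>Iota White\<rangle>)) \<rhd> mg A (ounit C)
    = \<langle>Kappa White\<rangle> \<boxtimes> \<^bold>1 (A\<^sup>\<circ>)"
    using assms by (simp add: sigma_kappa_left sigma_kappa_left[THEN seq_ext] whisker_left tseq_assoc
       iota_merge_right id_elim)
  then show "\<langle>Join A (ounit C)\<rangle> = \<langle>Kappa White\<rangle> \<boxtimes> \<^bold>1 (A\<^sup>\<circ>)"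
    using assms by (simp add: Join_def tcls_seq kappa_iota id_ten_id id_elim base_simps)
qed

lemma unjoin_unit:
  assumes "A \<in> obj C"
  shows "\<langle>Unjoin (ounit C) A\<rangle> = \<^bold>1 (A\<^sup>\<circ>) \<boxtimes> \<langle>Iota White\<rangle>" "\<langle>Unjoin A (ounit C)\<rangle> = \<langle>Iota White\<rangle> \<boxtimes> \<^bold>1 (A\<^sup>\<circ>)"
proof -
  have "\<langle>Unjoin (ounit C) A\<rangle> \<rhd> (\<^bold>1 (A\<^sup>\<circ>) \<boxtimes> (\<langle>Kappa White\<rangle> \<rhd> \<langle>Iota White\<rangle>)) = \<^bold>1 (A\<^sup>\<circ>) \<boxtimes> \<langle>Iota White\<rangle>"
    using assms join_unjoin(2)[of "ounit C" A, THEN seq_ext]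
    by (simp add: join_unit whisker_left id_elim base_simps)
  then show "\<langle>Unjoin (ounit C) A\<rangle> = \<^bold>1 (A\<^sup>\<circ>) \<boxtimes> \<langle>Iota White\<rangle>"
    using assms by (simp add: kappa_iota id_ten_id id_elim base_simps)
  have "\<langle>Unjoin A (ounit C)\<rangle> \<rhd> ((\<langle>Kappa White\<rangle> \<rhd> \<langle>Iota White\<rangle>) \<boxtimes> \<^bold>1 (A\<^sup>\<circ>)) = \<langle>Iota White\<rangle> \<boxtimes> \<^bold>1 (A\<^sup>\<circ>)"
    using assms join_unjoin(2)[of A "ounit C", THEN seq_ext]
    by (simp add: join_unit whisker_right id_elim base_simps)
  then show "\<langle>Unjoin A (ounit C)\<rangle> = \<langle>Iota White\<rangle> \<boxtimes> \<^bold>1 (A\<^sup>\<circ>)"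
    using assms by (simp add: kappa_iota id_ten_id id_elim base_simps)
qed

text \<open>The unit edge is bent to a letter like any other object. The cells with a trivial top
  therefore start by deleting this letter with \<open>Kappa\<close>, and those with a trivial bottom
  end by creating it with \<open>Iota\<close>. In a horizontal composite the bent \<open>a\<close>
  runs before the bent \<open>b\<close>, because the right edge of \<open>a\<close> is the left edge
  of \<open>b\<close>.\<close>

primrec bend :: "('o, 'm) cterm \<Rightarrow> ('o, 'm) tterm" where
  "bend (HId A) = \<one>\<^sub>T (A\<^sup>\<circ>)"
| "bend (VId X) = (Kappa White \<star> \<one>\<^sub>T X) ;; (\<one>\<^sub>T X \<star> Iota White)"
| "bend (SW A) = \<one>\<^sub>T (A\<^sup>\<circ>) \<star> Iota White"
| "bend (RW A) = Kappa White \<star> \<one>\<^sub>T (A\<^sup>\<circ>)"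
| "bend (SB A) = Eps A ;; Iota White"
| "bend (RB A) = Kappa White ;; Eta A"
| "bend (Box f) = Map White f"
| "bend (a \<parallel> b) = (Unjoin (ttop C a) (ttop C b) \<star> \<one>\<^sub>T (tleft a)) ;; (\<one>\<^sub>T ((ttop C b)\<^sup>\<circ>) \<star> bend a)
     ;; (bend b \<star> \<one>\<^sub>T ((tbot C a)\<^sup>\<circ>)) ;; (\<one>\<^sub>T (tright b) \<star> Join (tbot C a) (tbot C b))"
| "bend (a \<div> b) = (bend a \<star> \<one>\<^sub>T (tleft b)) ;; (\<one>\<^sub>T (tright a) \<star> bend b)"

lemma bend_wf [simp]:
  "wf_cell C a \<Longrightarrow> wf_t C (bend a)"
  "wf_cell C a \<Longrightarrow> tdom C (bend a) = (ttop C a, White) # tleft a"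
  "wf_cell C a \<Longrightarrow> tcod C (bend a) = tright a @ (tbot C a)\<^sup>\<circ>"
proof -
  have "wf_cell C a \<Longrightarrow> wf_t C (bend a) \<and> tdom C (bend a) = (ttop C a, White) # tleft a
    \<and> tcod C (bend a) = tright a @ (tbot C a)\<^sup>\<circ>"
    by (induction a) (auto simp: wf_cell_boundaries base_simps)
  then show "wf_cell C a \<Longrightarrow> wf_t C (bend a)"
  "wf_cell C a \<Longrightarrow> tdom C (bend a) = (ttop C a, White) # tleft a"
  "wf_cell C a \<Longrightarrow> tcod C (bend a) = tright a @ (tbot C a)\<^sup>\<circ>" by blast+
qed

section \<open>Bending respects the equations between cells\<close>

lemma slide:
  assumes "wf_t C s" "wf_t C t"
  shows "\<^bold>1 (U @ tdom C s @ W) \<boxtimes> \<langle>t\<rangle> \<boxtimes> \<^bold>1 V \<rhd> \<^bold>1 U \<boxtimes> \<langle>s\<rangle> \<boxtimes> \<^bold>1 (W @ tcod C t @ V)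
    = \<^bold>1 U \<boxtimes> \<langle>s\<rangle> \<boxtimes> \<^bold>1 (W @ tdom C t @ V) \<rhd> \<^bold>1 (U @ tcod C s @ W) \<boxtimes> \<langle>t\<rangle> \<boxtimes> \<^bold>1 V"
proof -
  have "\<^bold>1 U \<boxtimes> ((\<^bold>1 (tdom C s) \<boxtimes> (\<^bold>1 W \<boxtimes> \<langle>t\<rangle>)) \<rhd> (\<langle>s\<rangle> \<boxtimes> \<^bold>1 (W @ tcod C t))) \<boxtimes> \<^bold>1 V
    = \<^bold>1 U \<boxtimes> ((\<langle>s\<rangle> \<boxtimes> \<^bold>1 (W @ tdom C t)) \<rhd> (\<^bold>1 (tcod C s) \<boxtimes> (\<^bold>1 W \<boxtimes> \<langle>t\<rangle>))) \<boxtimes> \<^bold>1 V"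
  proof (cases "W \<in> pwords C")
    case True
    then have "\<langle>\<one>\<^sub>T W \<star> t\<rangle> \<in> thom (W @ tdom C t) (W @ tcod C t)"
      using assms by (intro thom_gen) auto
    then have "\<^bold>1 W \<boxtimes> \<langle>t\<rangle> \<in> thom (W @ tdom C t) (W @ tcod C t)"
      by (simp only: tcls_ten)
    then show ?thesis using exchange[OF thom_cls[OF assms(1)]] by simp
  next
    \<comment> \<open>If \<open>W\<close> is not a word of objects, its identity has the empty class
      and both sides are empty.\<close>
    case False
    then have "\<^bold>1 W = {}" by (simp add: tcls_not_wf)
    then show ?thesis by (simp add: qop_def)
  qed
  then show ?thesis by (simp only: strict)
qed

text \<open>Carries an equation between composites to the padded positions in which it can occur
  after rewriting with \<open>strict\<close>; the collections below use it for the three pairs of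
  mutually inverse arrows.\<close>

lemma whisker_eq:
  assumes "S \<rhd> T = R"
  shows "\<^bold>1 U \<boxtimes> S \<rhd> \<^bold>1 U \<boxtimes> T = \<^bold>1 U \<boxtimes> R" "S \<boxtimes> \<^bold>1 V \<rhd> T \<boxtimes> \<^bold>1 V = R \<boxtimes> \<^bold>1 V"
    "\<^bold>1 U \<boxtimes> S \<boxtimes> \<^bold>1 V \<rhd> \<^bold>1 U \<boxtimes> T \<boxtimes> \<^bold>1 V = \<^bold>1 U \<boxtimes> R \<boxtimes> \<^bold>1 V"
  unfolding assms[symmetric] by (simp_all only: strict)

lemmas iota_kappa_whisker' = iota_kappa iota_kappa[THEN whisker_eq(1)] iota_kappa[THEN whisker_eq(2)] iota_kappa[THEN whisker_eq(3)]
lemmas iota_kappa_whisker = iota_kappa_whisker' iota_kappa_whisker'[THEN seq_ext]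
lemmas kappa_iota_whisker' = kappa_iota kappa_iota[THEN whisker_eq(1)] kappa_iota[THEN whisker_eq(2)] kappa_iota[THEN whisker_eq(3)]
lemmas kappa_iota_whisker = kappa_iota_whisker' kappa_iota_whisker'[THEN seq_ext]
lemmas join_unjoin_whisker' = join_unjoin join_unjoin[THEN whisker_eq(1)] join_unjoin[THEN whisker_eq(2)] join_unjoin[THEN whisker_eq(3)]
lemmas join_unjoin_whisker = join_unjoin_whisker' join_unjoin_whisker'[THEN seq_ext]

lemmas bend_norm = bend.simps tcls_seq tcls_ten strict ttop.simps tbot.simps tleft.simps tright.simps

text \<open>Splitting off the unit edge produces an \<iota> that cancels the \<kappa> of the bent
  identity. The \<iota> of the bent identity slides past the bent \<open>a\<close> and cancels the
  \<kappa> to which the final join reduces.\<close>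

lemma bend_hunit_left:
  assumes "wf_cell C a"
  shows "\<langle>bend (VId (tleft a) \<parallel> a)\<rangle> = \<langle>bend a\<rangle>"
  using assms slide[of "bend a" "Iota White" "[]" "[]" "[]", simplified strict, THEN seq_ext]
  by (simp add: bend_norm unjoin_unit join_unit wf_cell_boundaries iota_kappa_whisker id_elim)

lemma bend_hunit_right:
  assumes "wf_cell C a"
  shows "\<langle>bend (a \<parallel> VId (tright a))\<rangle> = \<langle>bend a\<rangle>"
  using assms slide[of "Kappa White" "bend a" "[]" "[]" "[]", simplified strict, THEN seq_ext]
  by (simp add: bend_norm unjoin_unit join_unit wf_cell_boundaries iota_kappa_whisker id_elim)

text \<open>On the right-hand side the join ending the upper row cancels the unjoin starting the
  lower row. What remains differs only in the order of the bent \<open>b\<close> and the bent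
  \<open>c\<close>, which act on disjoint parts of the word.\<close>

lemma bend_interchange:
  assumes "wf_cell C a" "wf_cell C b" "wf_cell C c" "wf_cell C d"
    "tbot C a = ttop C b" "tbot C c = ttop C d" "tright a = tleft c" "tright b = tleft d"
  shows "\<langle>bend ((a \<div> b) \<parallel> (c \<div> d))\<rangle> = \<langle>bend ((a \<parallel> c) \<div> (b \<parallel> d))\<rangle>"
  using assms slide[of "bend c" "bend b" "[]" "[]" "[]", simplified strict, THEN seq_ext]
  by (simp add: bend_norm join_unjoin_whisker wf_cell_boundaries id_elim)

text \<open>The join of the first two bottom edges slides past the bent \<open>c\<close>, and the
  unjoin of the last two top edges past the bent \<open>a\<close>. After that, associativity of
  joining and of unjoining applies.\<close>

lemma bend_hassoc:
  assumes "wf_cell C a" "wf_cell C b" "wf_cell C c" "tright a = tleft b" "tright b = tleft c"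
  shows "\<langle>bend ((a \<parallel> b) \<parallel> c)\<rangle> = \<langle>bend (a \<parallel> (b \<parallel> c))\<rangle>"
proof -
  let ?o = "\<lambda>A. [(A, White)]"
  let ?U = "\<lambda>A B. \<langle>Unjoin A B\<rangle>" and ?J = "\<lambda>A B. \<langle>Join A B\<rangle>"
  note o = assms wf_cell_boundaries[OF assms(1)] wf_cell_boundaries[OF assms(2)] wf_cell_boundaries[OF assms(3)]
  have "\<langle>bend ((a \<parallel> b) \<parallel> c)\<rangle> = 
      (?U (ttop C a \<odot> ttop C b) (ttop C c) \<rhd> \<^bold>1 (?o (ttop C c)) \<boxtimes> ?U (ttop C a) (ttop C b)) \<boxtimes> \<^bold>1 (tleft a)
    \<rhd> \<^bold>1 [(ttop C c, White), (ttop C b, White)] \<boxtimes> \<langle>bend a\<rangle> 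
    \<rhd> \<^bold>1 (?o (ttop C c)) \<boxtimes> \<langle>bend b\<rangle> \<boxtimes> \<^bold>1 (?o (tbot C a))
    \<rhd> (\<^bold>1 ((ttop C c, White) # tright b) \<boxtimes> ?J (tbot C a) (tbot C b) 
    \<rhd> \<langle>bend c\<rangle> \<boxtimes> \<^bold>1 (?o (tbot C a \<odot> tbot C b)))
    \<rhd> \<^bold>1 (tright c) \<boxtimes> ?J (tbot C a \<odot> tbot C b) (tbot C c)"
    by (simp only: bend_norm)
  also have "\<^bold>1 ((ttop C c, White) # tright b) \<boxtimes> ?J (tbot C a) (tbot C b) 
    \<rhd> \<langle>bend c\<rangle> \<boxtimes> \<^bold>1 (?o (tbot C a \<odot> tbot C b)) =
     \<langle>bend c\<rangle> \<boxtimes> \<^bold>1 [(tbot C b, White), (tbot C a, White)] \<rhd> 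
     \<^bold>1 (tright c @ ?o (tbot C c)) \<boxtimes> ?J (tbot C a) (tbot C b)"
    using slide[of "bend c" "Join (tbot C a) (tbot C b)" "[]" "[]" "[]", simplified strict] o by simp
  also have "?U (ttop C a \<odot> ttop C b) (ttop C c) \<rhd> \<^bold>1 (?o (ttop C c)) \<boxtimes> ?U (ttop C a) (ttop C b)
    = ?U (ttop C a) (ttop C b \<odot> ttop C c) \<rhd> ?U (ttop C b) (ttop C c) \<boxtimes> \<^bold>1 (?o (ttop C a))"
    using o by (intro unjoin_assoc) auto
  also have "(?U (ttop C a) (ttop C b \<odot> ttop C c) \<rhd> ?U (ttop C b) (ttop C c) \<boxtimes> \<^bold>1 (?o (ttop C a))) \<boxtimes> \<^bold>1 (tleft a)
    \<rhd> \<^bold>1 [(ttop C c, White), (ttop C b, White)] \<boxtimes> \<langle>bend a\<rangle> 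
    \<rhd> \<^bold>1 (?o (ttop C c)) \<boxtimes> \<langle>bend b\<rangle> \<boxtimes> \<^bold>1 (?o (tbot C a))
    \<rhd> (\<langle>bend c\<rangle> \<boxtimes> \<^bold>1 [(tbot C b, White), (tbot C a, White)] \<rhd> 
     \<^bold>1 (tright c @ ?o (tbot C c)) \<boxtimes> ?J (tbot C a) (tbot C b))
    \<rhd> \<^bold>1 (tright c) \<boxtimes> ?J (tbot C a \<odot> tbot C b) (tbot C c)
    = ?U (ttop C a) (ttop C b \<odot> ttop C c) \<boxtimes> \<^bold>1 (tleft a)
    \<rhd> (?U (ttop C b) (ttop C c) \<boxtimes> \<^bold>1 ((ttop C a, White) # tleft a)
    \<rhd> \<^bold>1 [(ttop C c, White), (ttop C b, White)] \<boxtimes> \<langle>bend a\<rangle>)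
    \<rhd> \<^bold>1 (?o (ttop C c)) \<boxtimes> \<langle>bend b\<rangle> \<boxtimes> \<^bold>1 (?o (tbot C a))
    \<rhd> \<langle>bend c\<rangle> \<boxtimes> \<^bold>1 [(tbot C b, White), (tbot C a, White)]
    \<rhd> \<^bold>1 (tright c) \<boxtimes> (\<^bold>1 (?o (tbot C c)) \<boxtimes> ?J (tbot C a) (tbot C b) \<rhd> ?J (tbot C a \<odot> tbot C b) (tbot C c))"
    by (simp only: strict)
  also have "?U (ttop C b) (ttop C c) \<boxtimes> \<^bold>1 ((ttop C a, White) # tleft a)
    \<rhd> \<^bold>1 [(ttop C c, White), (ttop C b, White)] \<boxtimes> \<langle>bend a\<rangle>
    = \<^bold>1 (?o (ttop C b \<odot> ttop C c)) \<boxtimes> \<langle>bend a\<rangle>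
    \<rhd> ?U (ttop C b) (ttop C c) \<boxtimes> \<^bold>1 (tleft b @ ?o (tbot C a))"
    using slide[of "Unjoin (ttop C b) (ttop C c)" "bend a" "[]" "[]" "[]", simplified strict] o by simp
  also have "\<^bold>1 (?o (tbot C c)) \<boxtimes> ?J (tbot C a) (tbot C b) \<rhd> ?J (tbot C a \<odot> tbot C b) (tbot C c)
    = ?J (tbot C b) (tbot C c) \<boxtimes> \<^bold>1 (?o (tbot C a)) \<rhd> ?J (tbot C a) (tbot C b \<odot> tbot C c)"
    using o by (intro join_assoc) auto
  finally show ?thesis by (simp only: bend_norm)
qed

text \<open>Naturality moves both arrows out from between the two crossings, one contained in the
  unjoin and one in the join. The crossings then meet and cancel.\<close>

lemma bend_box_times:
  assumes "f \<in> arr C" "g \<in> arr C"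
  shows "\<langle>bend (Box f \<parallel> Box g)\<rangle> = \<langle>bend (Box (f \<oslash> g))\<rangle>"
proof -
  let ?f = "\<langle>Map White f\<rangle>" and ?g = "\<langle>Map White g\<rangle>"
  have "\<langle>bend (Box f \<parallel> Box g)\<rangle> = sp (src C f) (src C g) \<rhd> br (src C f) (src C g) \<rhd> 
     \<^bold>1 ((src C g)\<^sup>\<circ>) \<boxtimes> ?f \<rhd> ?g \<boxtimes> \<^bold>1 ((tgt C f)\<^sup>\<circ>) \<rhd> br (tgt C g) (tgt C f) \<rhd> mg (tgt C f) (tgt C g)"
    by (simp only: bend_norm Join_def Unjoin_def)
  also have "\<dots> = sp (src C f) (src C g) \<rhd> ?f \<boxtimes> \<^bold>1 ((src C g)\<^sup>\<circ>) \<rhd> \<^bold>1 ((tgt C f)\<^sup>\<circ>) \<boxtimes> ?g \<rhd> mg (tgt C f) (tgt C g)"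
    using assms by (simp add: nat_white_left[symmetric, THEN seq_ext] nat_white_right[symmetric, THEN seq_ext]
      sigma_sigma[THEN seq_ext] base_simps id_elim tseq_assoc)
  also have "?f \<boxtimes> \<^bold>1 ((src C g)\<^sup>\<circ>) \<rhd> \<^bold>1 ((tgt C f)\<^sup>\<circ>) \<boxtimes> ?g \<rhd> mg (tgt C f) (tgt C g) = (?f \<boxtimes> ?g) \<rhd> mg (tgt C f) (tgt C g)"
    using exchange(2)[OF thom_cls thom_cls, of "Map White f" "Map White g"] assms
    by (simp flip: tseq_assoc)
  also have "sp (src C f) (src C g) \<rhd> \<dots> = \<langle>bend (Box (f \<oslash> g))\<rangle>"
    using assms by (simp add: map_white_ten)
  finally show ?thesis .
qed

lemma bend_yank:
  assumes "A \<in> obj C"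
  shows "\<langle>bend (SW A \<parallel> RW A)\<rangle> = \<langle>bend (HId A)\<rangle>" "\<langle>bend (RW A \<div> SW A)\<rangle> = \<langle>bend (VId (A\<^sup>\<circ>))\<rangle>"
    "\<langle>bend (RB A \<parallel> SB A)\<rangle> = \<langle>bend (HId A)\<rangle>" "\<langle>bend (RB A \<div> SB A)\<rangle> = \<langle>bend (VId (A\<^sup>\<bullet>))\<rangle>"
proof -
  show "\<langle>bend (SW A \<parallel> RW A)\<rangle> = \<langle>bend (HId A)\<rangle>"
    using assms slide[of "Kappa White" "Iota White" "[]" "A\<^sup>\<circ>" "[]", simplified strict, THEN seq_ext]
    by (simp add: bend_norm unjoin_unit join_unit iota_kappa_whisker id_elim)
  show "\<langle>bend (RW A \<div> SW A)\<rangle> = \<langle>bend (VId (A\<^sup>\<circ>))\<rangle>"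
    using assms by (simp add: bend_norm)
  show "\<langle>bend (RB A \<parallel> SB A)\<rangle> = \<langle>bend (HId A)\<rangle>"
    \<comment> \<open>Only the black yanking equations need duality: the horizontal one becomes the
      snake equation of the white letter, the vertical one below that of the black letter.\<close>
    using assms by (simp add: bend_norm unjoin_unit join_unit iota_kappa_whisker id_elim snake_white[THEN seq_ext])
  show "\<langle>bend (RB A \<div> SB A)\<rangle> = \<langle>bend (VId (A\<^sup>\<bullet>))\<rangle>"
    using assms snake_black[OF assms, THEN seq_ext] snake_black[OF assms, THEN whisker_eq(1), of "[(ounit C, White)]"]
    by (simp add: bend_norm id_elim)
qed

theorem bend_sound: "cell_eq C a b \<Longrightarrow> \<langle>bend a\<rangle> = \<langle>bend b\<rangle>"
proof (induction rule: cell_eq.induct)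
  case (c_hcong a a' b b')
  then show ?case using cell_eq_wf[OF c_hcong(1)] cell_eq_wf[OF c_hcong(2)] by (simp add: bend_norm)
next
  case (c_vcong a a' b b')
  then show ?case using cell_eq_wf[OF c_vcong(1)] cell_eq_wf[OF c_vcong(2)] by (simp add: bend_norm)
next
  case (c_hid A B)
  then show ?case by (simp add: bend_norm join_unjoin id_elim base_simps)
next
  case (c_vid X Y)
  then show ?case by (simp add: bend_norm iota_kappa_whisker id_elim)
next
  case c_unit
  then show ?case by (simp add: bend_norm kappa_iota)
next
  case (c_vunit_top a)
  then show ?case by (simp add: bend_norm id_elim wf_cell_boundaries)
next
  case (c_vunit_bot a)
  then show ?case by (simp add: bend_norm id_elim wf_cell_boundaries)
next
  case (c_box_seq f g)
  then show ?case
    by (simp add: bend_norm t_map_white_seq[THEN t_class_eq, unfolded tcls_seq tcls_ten strict])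
next
  case (c_box_idt A)
  then show ?case by (simp add: bend_norm map_white_idt)
qed ((rule bend_yank bend_box_times bend_hassoc bend_interchange bend_hunit_left
  bend_hunit_right; assumption) | simp only: bend_norm)+

section \<open>Calculating with cells\<close>

abbreviation ccls :: "('o, 'm) cterm \<Rightarrow> ('o, 'm) cterm set" ("\<guillemotleft>_\<guillemotright>")
  where "\<guillemotleft>a\<guillemotright> \<equiv> cell_rel C `` {a}"

abbreviation hseq (infixr "\<interleave>" 65) where "S \<interleave> T \<equiv> qop (cell_rel C) HComp S T"
abbreviation vseq (infixr "\<Sslash>" 70) where "S \<Sslash> T \<equiv> qop (cell_rel C) VComp S T"

text \<open>The device used for arrow terms makes both compositions of cells associative without
  side conditions. Interchange is kept with typing hypotheses: when two stacks stand side by side,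
  the common edge may factor differently in the left and in the right stack.\<close>

lemma ccls_eqI: "(wf_cell C a \<longleftrightarrow> wf_cell C b) \<Longrightarrow> (wf_cell C a \<Longrightarrow> cell_eq C a b) \<Longrightarrow> \<guillemotleft>a\<guillemotright> = \<guillemotleft>b\<guillemotright>"
  by (rule class_eqI[OF equiv_cell]) (simp_all add: cell_rel_iff)

lemma ccls_not_wf: "\<not> wf_cell C a \<Longrightarrow> \<guillemotleft>a\<guillemotright> = {}"
  by (auto simp: cell_rel_iff dest: cell_eq_wf)

lemma UN_ccls:
  "(\<Union>x\<in>\<guillemotleft>a\<guillemotright>. \<guillemotleft>x \<parallel> b\<guillemotright>) = \<guillemotleft>a \<parallel> b\<guillemotright>" "(\<Union>x\<in>\<guillemotleft>a\<guillemotright>. \<guillemotleft>b \<parallel> x\<guillemotright>) = \<guillemotleft>b \<parallel> a\<guillemotright>"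
  "(\<Union>x\<in>\<guillemotleft>a\<guillemotright>. \<guillemotleft>x \<div> b\<guillemotright>) = \<guillemotleft>a \<div> b\<guillemotright>" "(\<Union>x\<in>\<guillemotleft>a\<guillemotright>. \<guillemotleft>b \<div> x\<guillemotright>) = \<guillemotleft>b \<div> a\<guillemotright>"
  by (rule UN_class[OF equiv_cell];
      auto simp: cell_rel_iff ccls_not_wf dest: cell_eq_wf intro!: ccls_eqI c_hcong c_vcong intro: c_sym c_refl)+

lemma UN_ccls2:
  "(\<Union>x\<in>\<guillemotleft>a\<guillemotright>. \<Union>y\<in>T. \<guillemotleft>x \<parallel> f y\<guillemotright>) = (\<Union>y\<in>T. \<guillemotleft>a \<parallel> f y\<guillemotright>)"
  "(\<Union>x\<in>\<guillemotleft>a\<guillemotright>. \<Union>y\<in>T. \<guillemotleft>x \<div> f y\<guillemotright>) = (\<Union>y\<in>T. \<guillemotleft>a \<div> f y\<guillemotright>)"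
  by (subst SUP_commute, simp only: UN_ccls)+

lemma ccls_h: "\<guillemotleft>a \<parallel> b\<guillemotright> = \<guillemotleft>a\<guillemotright> \<interleave> \<guillemotleft>b\<guillemotright>" and ccls_v: "\<guillemotleft>a \<div> b\<guillemotright> = \<guillemotleft>a\<guillemotright> \<Sslash> \<guillemotleft>b\<guillemotright>"
  by (simp_all only: qop_def UN_ccls)

lemma hseq_assoc: "(S \<interleave> T) \<interleave> U = S \<interleave> T \<interleave> U"
proof -
  have "\<guillemotleft>(x \<parallel> y) \<parallel> z\<guillemotright> = \<guillemotleft>x \<parallel> (y \<parallel> z)\<guillemotright>" for x y z
    by (rule ccls_eqI) (auto intro: c_hassoc)
  then show ?thesis by (simp only: qop_def UN_UN_flatten UN_ccls UN_ccls2)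
qed

lemma vseq_assoc: "(S \<Sslash> T) \<Sslash> U = S \<Sslash> T \<Sslash> U"
proof -
  have "\<guillemotleft>(x \<div> y) \<div> z\<guillemotright> = \<guillemotleft>x \<div> (y \<div> z)\<guillemotright>" for x y z
    by (rule ccls_eqI) (auto intro: c_vassoc)
  then show ?thesis by (simp only: qop_def UN_UN_flatten UN_ccls UN_ccls2)
qed

lemma vseq_ext: "S \<Sslash> T = R \<Longrightarrow> S \<Sslash> T \<Sslash> K = R \<Sslash> K"
  by (simp flip: vseq_assoc)

lemma hseq_ext: "S \<interleave> T = R \<Longrightarrow> S \<interleave> T \<interleave> K = R \<interleave> K"
  by (simp flip: hseq_assoc)

text \<open>Reflecting a cell left to right exchanges the two colours, so statements about
  white and black corners are treated together: \<open>hcomp_pol p\<close> is horizontal composition for white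
  and its mirror image for black, and \<open>near\<close>, \<open>far\<close> are the left and right boundaries, mirrored for black.\<close>

definition hcomp_pol :: "polarity \<Rightarrow> ('o, 'm) cterm \<Rightarrow> ('o, 'm) cterm \<Rightarrow> ('o, 'm) cterm" where
  "hcomp_pol p a b = (case p of White \<Rightarrow> a \<parallel> b | Black \<Rightarrow> b \<parallel> a)"
definition near :: "polarity \<Rightarrow> ('o, 'm) cterm \<Rightarrow> 'o pword" where
  "near p a = (case p of White \<Rightarrow> tleft a | Black \<Rightarrow> tright a)"
definition far :: "polarity \<Rightarrow> ('o, 'm) cterm \<Rightarrow> 'o pword" where
  "far p a = (case p of White \<Rightarrow> tright a | Black \<Rightarrow> tleft a)"
definition otimes_pol :: "polarity \<Rightarrow> 'o \<Rightarrow> 'o \<Rightarrow> 'o" where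
  "otimes_pol p A B = (case p of White \<Rightarrow> A \<odot> B | Black \<Rightarrow> B \<odot> A)"
definition atimes_pol :: "polarity \<Rightarrow> 'm \<Rightarrow> 'm \<Rightarrow> 'm" where
  "atimes_pol p f g = (case p of White \<Rightarrow> f \<oslash> g | Black \<Rightarrow> g \<oslash> f)"
definition hseq_pol where
  "hseq_pol p S T = (case p of White \<Rightarrow> S \<interleave> T | Black \<Rightarrow> T \<interleave> S)"
definition corner_in :: "polarity \<Rightarrow> 'o \<Rightarrow> ('o, 'm) cterm" where
  "corner_in p A = (case p of White \<Rightarrow> RW A | Black \<Rightarrow> RB A)"
definition corner_out :: "polarity \<Rightarrow> 'o \<Rightarrow> ('o, 'm) cterm" where
  "corner_out p A = (case p of White \<Rightarrow> SW A | Black \<Rightarrow> SB A)"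

lemmas pol_defs = hcomp_pol_def near_def far_def otimes_pol_def atimes_pol_def hseq_pol_def corner_in_def corner_out_def

lemma pol_simps [simp]:
  "ttop C (hcomp_pol p a b) = otimes_pol p (ttop C a) (ttop C b)" "tbot C (hcomp_pol p a b) = otimes_pol p (tbot C a) (tbot C b)"
  "near p (hcomp_pol p a b) = near p a" "far p (hcomp_pol p a b) = far p b"
  "wf_cell C (hcomp_pol p a b) \<longleftrightarrow> wf_cell C a \<and> wf_cell C b \<and> far p a = near p b"
  "near p (a \<div> b) = near p a @ near p b" "far p (a \<div> b) = far p a @ far p b"
  "near p (HId A) = []" "far p (HId A) = []" "near p (Box f) = []" "far p (Box f) = []"
  "near p (VId X) = X" "far p (VId X) = X"
  "wf_cell C (corner_in p A) \<longleftrightarrow> A \<in> obj C" "wf_cell C (corner_out p A) \<longleftrightarrow> A \<in> obj C"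
  "ttop C (corner_in p A) = ounit C" "tbot C (corner_in p A) = A" "near p (corner_in p A) = [(A, p)]" "far p (corner_in p A) = []"
  "ttop C (corner_out p A) = A" "tbot C (corner_out p A) = ounit C" "near p (corner_out p A) = []" "far p (corner_out p A) = [(A, p)]"
  by (cases p; auto simp: pol_defs)+

lemma otimes_pol_simps [simp]:
  "A \<in> obj C \<Longrightarrow> B \<in> obj C \<Longrightarrow> otimes_pol p A B \<in> obj C"
  "A \<in> obj C \<Longrightarrow> otimes_pol p A (ounit C) = A" "A \<in> obj C \<Longrightarrow> otimes_pol p (ounit C) A = A"
  "A \<in> obj C \<Longrightarrow> B \<in> obj C \<Longrightarrow> D \<in> obj C \<Longrightarrow> otimes_pol p (otimes_pol p A B) D = otimes_pol p A (otimes_pol p B D)"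
  "ounit C \<in> obj C"
  by (cases p; auto simp: pol_defs base_simps)+

lemma hpol_assoc: "hseq_pol p (hseq_pol p S T) U = hseq_pol p S (hseq_pol p T U)"
  by (cases p) (simp_all add: hseq_pol_def hseq_assoc)

lemma ccls_hcp: "\<guillemotleft>hcomp_pol p a b\<guillemotright> = hseq_pol p \<guillemotleft>a\<guillemotright> \<guillemotleft>b\<guillemotright>"
  by (cases p) (simp_all add: hseq_pol_def hcomp_pol_def ccls_h)

lemmas ccls_push = ccls_hcp ccls_v ccls_h vseq_assoc hpol_assoc hseq_assoc

lemma hpol_interchange:
  assumes "wf_cell C a" "wf_cell C b" "wf_cell C c" "wf_cell C d"
    "tbot C a = ttop C b" "tbot C c = ttop C d" "far p a = near p c" "far p b = near p d"
  shows "\<guillemotleft>hcomp_pol p (a \<div> b) (c \<div> d)\<guillemotright> = \<guillemotleft>hcomp_pol p a c \<div> hcomp_pol p b d\<guillemotright>"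
  using assms by (cases p) (auto simp: pol_defs intro!: cell_class_eq c_interchange)

lemma hpol_vid:
  "wf_cell C a \<Longrightarrow> X = near p a \<Longrightarrow> hseq_pol p \<guillemotleft>VId X\<guillemotright> \<guillemotleft>a\<guillemotright> = \<guillemotleft>a\<guillemotright>"
  "wf_cell C a \<Longrightarrow> X = far p a \<Longrightarrow> hseq_pol p \<guillemotleft>a\<guillemotright> \<guillemotleft>VId X\<guillemotright> = \<guillemotleft>a\<guillemotright>"
  by (cases p; simp add: pol_defs cell_class_eq c_hunit_left c_hunit_right flip: ccls_h)+

lemma hid_unit: "\<guillemotleft>HId (ounit C)\<guillemotright> = \<guillemotleft>VId []\<guillemotright>"
  by (intro cell_class_eq c_unit)

lemma hpol_hid:
  "A \<in> obj C \<Longrightarrow> B \<in> obj C \<Longrightarrow> hseq_pol p \<guillemotleft>HId A\<guillemotright> \<guillemotleft>HId B\<guillemotright> = \<guillemotleft>HId (otimes_pol p A B)\<guillemotright>"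
  by (cases p) (simp_all add: pol_defs cell_class_eq c_hid flip: ccls_h)

lemma hpol_box:
  "f \<in> arr C \<Longrightarrow> g \<in> arr C \<Longrightarrow> hseq_pol p \<guillemotleft>Box f\<guillemotright> \<guillemotleft>Box g\<guillemotright> = \<guillemotleft>Box (atimes_pol p f g)\<guillemotright>"
  by (cases p) (simp_all add: pol_defs cell_class_eq c_box_times flip: ccls_h)

lemma hpol_yank: "A \<in> obj C \<Longrightarrow> hseq_pol p \<guillemotleft>corner_out p A\<guillemotright> \<guillemotleft>corner_in p A\<guillemotright> = \<guillemotleft>HId A\<guillemotright>"
  by (cases p) (simp_all add: pol_defs cell_class_eq c_yank_white_h c_yank_black_h flip: ccls_h)

lemma vseq_yank: "A \<in> obj C \<Longrightarrow> \<guillemotleft>corner_in p A\<guillemotright> \<Sslash> \<guillemotleft>corner_out p A\<guillemotright> = \<guillemotleft>VId [(A, p)]\<guillemotright>"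
  by (cases p) (simp_all add: pol_defs cell_class_eq c_yank_white_v c_yank_black_v flip: ccls_v)

lemma vseq_hid:
  "wf_cell C a \<Longrightarrow> A = ttop C a \<Longrightarrow> \<guillemotleft>HId A\<guillemotright> \<Sslash> \<guillemotleft>a\<guillemotright> = \<guillemotleft>a\<guillemotright>"
  "wf_cell C a \<Longrightarrow> A = tbot C a \<Longrightarrow> \<guillemotleft>a\<guillemotright> \<Sslash> \<guillemotleft>HId A\<guillemotright> = \<guillemotleft>a\<guillemotright>"
  by (simp_all add: cell_class_eq c_vunit_top c_vunit_bot flip: ccls_v)

lemma vseq_unit:
  "wf_cell C a \<Longrightarrow> ttop C a = ounit C \<Longrightarrow> \<guillemotleft>VId []\<guillemotright> \<Sslash> \<guillemotleft>a\<guillemotright> = \<guillemotleft>a\<guillemotright>"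
  "wf_cell C a \<Longrightarrow> tbot C a = ounit C \<Longrightarrow> \<guillemotleft>a\<guillemotright> \<Sslash> \<guillemotleft>VId []\<guillemotright> = \<guillemotleft>a\<guillemotright>"
  by (simp_all flip: hid_unit add: vseq_hid)

lemma vseq_vid: "X \<in> pwords C \<Longrightarrow> Y \<in> pwords C \<Longrightarrow> \<guillemotleft>VId X\<guillemotright> \<Sslash> \<guillemotleft>VId Y\<guillemotright> = \<guillemotleft>VId (X @ Y)\<guillemotright>"
  by (simp add: cell_class_eq c_vid flip: ccls_v)

lemma vseq_box: "f \<in> arr C \<Longrightarrow> g \<in> arr C \<Longrightarrow> tgt C f = src C g \<Longrightarrow> \<guillemotleft>Box f\<guillemotright> \<Sslash> \<guillemotleft>Box g\<guillemotright> = \<guillemotleft>Box (f \<Zsemi> g)\<guillemotright>"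
  by (simp add: cell_class_eq c_box_seq flip: ccls_v)

lemma box_idt: "A \<in> obj C \<Longrightarrow> \<guillemotleft>Box (idt C A)\<guillemotright> = \<guillemotleft>HId A\<guillemotright>"
  by (simp add: cell_class_eq c_box_idt)

lemma wf_cell_simps [simp]:
  assumes "wf_cell C a"
  shows "ttop C a \<in> obj C" "tbot C a \<in> obj C" "tleft a \<in> pwords C" "tright a \<in> pwords C"
  using wf_cell_boundaries[OF assms] by blast+

text \<open>Neighbouring cells with a trivial common edge can be drawn at different heights, since
  identities on horizontal edges fill the gaps. Together with \<open>hpol_below\<close> this
  exchanges their order, which is how disjoint parts of a drawing are moved past each other.\<close>

lemma hpol_above:
  assumes "wf_cell C a" "wf_cell C c" "far p a = []" "near p c = []"
  shows "hseq_pol p \<guillemotleft>a\<guillemotright> \<guillemotleft>c\<guillemotright> = hseq_pol p \<guillemotleft>a\<guillemotright> \<guillemotleft>HId (ttop C c)\<guillemotright> \<Sslash> hseq_pol p \<guillemotleft>HId (tbot C a)\<guillemotright> \<guillemotleft>c\<guillemotright>"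
  using hpol_interchange[of a "HId (tbot C a)" "HId (ttop C c)" c p] assms
  by (simp add: ccls_push vseq_hid)

lemma hpol_below:
  assumes "wf_cell C a" "wf_cell C c" "far p a = []" "near p c = []"
  shows "hseq_pol p \<guillemotleft>a\<guillemotright> \<guillemotleft>c\<guillemotright> = hseq_pol p \<guillemotleft>HId (ttop C a)\<guillemotright> \<guillemotleft>c\<guillemotright> \<Sslash> hseq_pol p \<guillemotleft>a\<guillemotright> \<guillemotleft>HId (tbot C c)\<guillemotright>"
  using hpol_interchange[of "HId (ttop C a)" a c "HId (tbot C c)" p] assms
  by (simp add: ccls_push vseq_hid)

section \<open>Collecting and emitting one-coloured words\<close>

definition word :: "polarity \<Rightarrow> 'o list \<Rightarrow> 'o pword" where "word p X = map (\<lambda>A. (A, p)) X"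

lemma word_simps [simp]: "word p [] = []" "word p (A # X) = (A, p) # word p X" "word p (X @ Y) = word p X @ word p Y"
  "word p X \<in> pwords C \<longleftrightarrow> set X \<subseteq> obj C"
  by (auto simp: word_def pwords_def)

text \<open>The topmost letter enters first and runs down on the far side of all later ones. The
  product is thus taken in reverse order for \<open>White\<close> and, after mirroring, in the order
  of the word for \<open>Black\<close>.\<close>

primrec prod_obj :: "polarity \<Rightarrow> 'o list \<Rightarrow> 'o" where
  "prod_obj p [] = ounit C"
| "prod_obj p (A # X) = otimes_pol p (prod_obj p X) A"

primrec recv :: "polarity \<Rightarrow> 'o list \<Rightarrow> ('o, 'm) cterm" where
  "recv p [] = HId (ounit C)"
| "recv p (A # X) = corner_in p A \<div> hcomp_pol p (recv p X) (HId A)"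

primrec send :: "polarity \<Rightarrow> 'o list \<Rightarrow> ('o, 'm) cterm" where
  "send p [] = HId (ounit C)"
| "send p (A # X) = hcomp_pol p (HId (prod_obj p X)) (corner_out p A) \<div> send p X"

lemma prod_obj_closed [simp]: "set X \<subseteq> obj C \<Longrightarrow> prod_obj p X \<in> obj C"
  by (induction X) auto

lemma prod_obj_append: "set X \<subseteq> obj C \<Longrightarrow> set Y \<subseteq> obj C \<Longrightarrow> prod_obj p (X @ Y) = otimes_pol p (prod_obj p Y) (prod_obj p X)"
  by (induction X) auto

lemma recv_send_simps [simp]:
  assumes "set X \<subseteq> obj C"
  shows "wf_cell C (recv p X)" "ttop C (recv p X) = ounit C" "tbot C (recv p X) = prod_obj p X"
    "near p (recv p X) = word p X" "far p (recv p X) = []"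
    "wf_cell C (send p X)" "tbot C (send p X) = ounit C" "ttop C (send p X) = prod_obj p X"
    "far p (send p X) = word p X" "near p (send p X) = []"
proof -
  have "set X \<subseteq> obj C \<Longrightarrow> wf_cell C (recv p X) \<and> ttop C (recv p X) = ounit C \<and> tbot C (recv p X) = prod_obj p X
    \<and> near p (recv p X) = word p X \<and> far p (recv p X) = [] \<and> 
    wf_cell C (send p X) \<and> tbot C (send p X) = ounit C \<and> ttop C (send p X) = prod_obj p X
    \<and> far p (send p X) = word p X \<and> near p (send p X) = []"
    by (induction X) auto
  with assms show "wf_cell C (recv p X)" "ttop C (recv p X) = ounit C" "tbot C (recv p X) = prod_obj p X"
    "near p (recv p X) = word p X" "far p (recv p X) = []"
    "wf_cell C (send p X)" "tbot C (send p X) = ounit C" "ttop C (send p X) = prod_obj p X"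
    "far p (send p X) = word p X" "near p (send p X) = []" by auto
qed

lemma hpol_send_recv: "set X \<subseteq> obj C \<Longrightarrow> hseq_pol p \<guillemotleft>send p X\<guillemotright> \<guillemotleft>recv p X\<guillemotright> = \<guillemotleft>HId (prod_obj p X)\<guillemotright>"
proof (induction X)
  case Nil
  then show ?case by (simp add: hpol_hid)
next
  case (Cons A X)
  have "hseq_pol p \<guillemotleft>send p (A # X)\<guillemotright> \<guillemotleft>recv p (A # X)\<guillemotright>
    = hseq_pol p \<guillemotleft>HId (prod_obj p X)\<guillemotright> (hseq_pol p \<guillemotleft>corner_out p A\<guillemotright> \<guillemotleft>corner_in p A\<guillemotright>) \<Sslash> hseq_pol p (hseq_pol p \<guillemotleft>send p X\<guillemotright> \<guillemotleft>recv p X\<guillemotright>) \<guillemotleft>HId A\<guillemotright>"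
    using Cons.prems hpol_interchange[of "hcomp_pol p (HId (prod_obj p X)) (corner_out p A)" "send p X" "corner_in p A" "hcomp_pol p (recv p X) (HId A)" p]
    by (simp add: ccls_push)
  then show ?case using Cons by (simp add: hpol_yank hpol_hid vseq_hid)
qed

lemma hpol_hid_unit:
  "wf_cell C a \<Longrightarrow> near p a = [] \<Longrightarrow> hseq_pol p \<guillemotleft>HId (ounit C)\<guillemotright> \<guillemotleft>a\<guillemotright> = \<guillemotleft>a\<guillemotright>"
  "wf_cell C a \<Longrightarrow> far p a = [] \<Longrightarrow> hseq_pol p \<guillemotleft>a\<guillemotright> \<guillemotleft>HId (ounit C)\<guillemotright> = \<guillemotleft>a\<guillemotright>"
  by (simp_all add: hid_unit hpol_vid)

text \<open>Emitting uses the far boundary and collecting the near one, so the two do not interfere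
  and collecting may come first. This brings two stacked cells into the order collect, apply,
  emit.\<close>

lemma vseq_send_recv:
  assumes "set X \<subseteq> obj C" "set Y \<subseteq> obj C"
  shows "\<guillemotleft>send p Y\<guillemotright> \<Sslash> \<guillemotleft>recv p X\<guillemotright> = hseq_pol p \<guillemotleft>recv p X\<guillemotright> \<guillemotleft>HId (prod_obj p Y)\<guillemotright> \<Sslash> hseq_pol p \<guillemotleft>HId (prod_obj p X)\<guillemotright> \<guillemotleft>send p Y\<guillemotright>"
  using hpol_above[of "recv p X" "send p Y" p] hpol_below[of "recv p X" "send p Y" p] assms
  by (simp add: hpol_hid_unit)

lemma vseq_recv_send: "set X \<subseteq> obj C \<Longrightarrow> \<guillemotleft>recv p X\<guillemotright> \<Sslash> \<guillemotleft>send p X\<guillemotright> = \<guillemotleft>VId (word p X)\<guillemotright>"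
proof (induction X)
  case Nil
  then show ?case by (simp add: hid_unit vseq_vid)
next
  case (Cons A X)
  \<comment> \<open>The far boundary of \<open>recv\<close> is trivial, so the wire \<open>A\<close>
    may leave before \<open>X\<close> is collected; its two corners become adjacent and yank to an
    identity.\<close>
  have "hseq_pol p \<guillemotleft>recv p X\<guillemotright> \<guillemotleft>HId A\<guillemotright> \<Sslash> hseq_pol p \<guillemotleft>HId (prod_obj p X)\<guillemotright> \<guillemotleft>corner_out p A\<guillemotright> = \<guillemotleft>corner_out p A\<guillemotright> \<Sslash> \<guillemotleft>recv p X\<guillemotright>"
    using hpol_above[of "recv p X" "corner_out p A" p] hpol_below[of "recv p X" "corner_out p A" p] Cons
    by (simp add: hpol_hid_unit)
  from this[THEN vseq_ext] have "\<guillemotleft>recv p (A # X)\<guillemotright> \<Sslash> \<guillemotleft>send p (A # X)\<guillemotright> = (\<guillemotleft>corner_in p A\<guillemotright> \<Sslash> \<guillemotleft>corner_out p A\<guillemotright>) \<Sslash> \<guillemotleft>recv p X\<guillemotright> \<Sslash> \<guillemotleft>send p X\<guillemotright>"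
    by (simp add: ccls_push)
  then show ?case using Cons by (simp add: vseq_yank vseq_vid)
qed

text \<open>For \<open>Black\<close> the drawing is mirrored: as a horizontal cell it runs from the
  word of \<open>Y\<close> to the word of \<open>X\<close>, in accordance with the contravariance of
  black arrows.\<close>

definition via :: "polarity \<Rightarrow> 'o list \<Rightarrow> 'm \<Rightarrow> 'o list \<Rightarrow> ('o, 'm) cterm" where
  "via p X f Y = recv p X \<div> (Box f \<div> send p Y)"

definition "typed p X f Y \<longleftrightarrow> set X \<subseteq> obj C \<and> set Y \<subseteq> obj C \<and> f \<in> arr C \<and> src C f = prod_obj p X \<and> tgt C f = prod_obj p Y"

lemma via_simps [simp]:
  assumes "typed p X f Y"
  shows "wf_cell C (via p X f Y)" "ttop C (via p X f Y) = ounit C" "tbot C (via p X f Y) = ounit C"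
    "near p (via p X f Y) = word p X" "far p (via p X f Y) = word p Y"
  using assms by (simp_all add: via_def typed_def)

lemma hpol_send_via:
  assumes "typed p X f Y"
  shows "hseq_pol p \<guillemotleft>send p X\<guillemotright> \<guillemotleft>via p X f Y\<guillemotright> = \<guillemotleft>Box f\<guillemotright> \<Sslash> \<guillemotleft>send p Y\<guillemotright>"
  \<comment> \<open>Padding \<open>send p X\<close> from below with the unit edge places it next to
    \<open>recv p X\<close> alone, so that the two yank.\<close>
  using hpol_interchange[of "send p X" "HId (ounit C)" "recv p X" "Box f \<div> send p Y" p] assms
    hpol_hid_unit(1)[of "Box f \<div> send p Y" p] vseq_hid(1)[of "Box f \<div> send p Y"]
  by (simp add: via_def typed_def vseq_hid ccls_push hpol_send_recv)

lemma hpol_via_recv: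
  assumes "typed p X f Y"
  shows "hseq_pol p \<guillemotleft>via p X f Y\<guillemotright> \<guillemotleft>recv p Y\<guillemotright> = \<guillemotleft>recv p X\<guillemotright> \<Sslash> \<guillemotleft>Box f\<guillemotright>"
  using hpol_interchange[of "recv p X \<div> Box f" "send p Y" "HId (ounit C)" "recv p Y" p] assms
    hpol_hid_unit(2)[of "recv p X \<div> Box f" p]
  by (simp add: via_def typed_def vseq_hid ccls_push hpol_send_recv)

lemma hpol_via_via:
  assumes "typed p X f Y" "typed p Y g Z"
  shows "hseq_pol p \<guillemotleft>via p X f Y\<guillemotright> \<guillemotleft>via p Y g Z\<guillemotright> = \<guillemotleft>via p X (f \<Zsemi> g) Z\<guillemotright>" (is ?eq)
    and "typed p X (f \<Zsemi> g) Z"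
proof -
  show "typed p X (f \<Zsemi> g) Z" using assms by (simp add: typed_def base_simps)
  have "hseq_pol p \<guillemotleft>via p X f Y\<guillemotright> \<guillemotleft>via p Y g Z\<guillemotright> = hseq_pol p \<guillemotleft>via p X f Y\<guillemotright> \<guillemotleft>recv p Y\<guillemotright> \<Sslash> \<guillemotleft>Box g\<guillemotright> \<Sslash> \<guillemotleft>send p Z\<guillemotright>"
    using hpol_interchange[of "via p X f Y" "HId (ounit C)" "recv p Y" "Box g \<div> send p Z" p] assms
      hpol_hid_unit(1)[of "Box g \<div> send p Z" p]
    by (simp add: via_def[of p Y g Z] typed_def vseq_hid ccls_push)
  then show ?eq using assms
    by (simp add: hpol_via_recv vseq_assoc) (simp add: via_def ccls_push vseq_box[THEN vseq_ext] typed_def)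
qed

lemma recv_append:
  "set X \<subseteq> obj C \<Longrightarrow> set Y \<subseteq> obj C \<Longrightarrow> \<guillemotleft>recv p (X @ Y)\<guillemotright> = \<guillemotleft>recv p X\<guillemotright> \<Sslash> hseq_pol p \<guillemotleft>recv p Y\<guillemotright> \<guillemotleft>HId (prod_obj p X)\<guillemotright>"
proof (induction X)
  case Nil
  then show ?case by (simp add: hpol_hid_unit vseq_hid)
next
  case (Cons A X)
  have "hseq_pol p (\<guillemotleft>recv p X\<guillemotright> \<Sslash> hseq_pol p \<guillemotleft>recv p Y\<guillemotright> \<guillemotleft>HId (prod_obj p X)\<guillemotright>) \<guillemotleft>HId A\<guillemotright>
     = hseq_pol p \<guillemotleft>recv p X\<guillemotright> \<guillemotleft>HId A\<guillemotright> \<Sslash> hseq_pol p \<guillemotleft>recv p Y\<guillemotright> \<guillemotleft>HId (otimes_pol p (prod_obj p X) A)\<guillemotright>"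
    using hpol_interchange[of "recv p X" "hcomp_pol p (recv p Y) (HId (prod_obj p X))" "HId A" "HId A" p] Cons
    by (simp add: ccls_push vseq_hid hpol_hid)
  with Cons show ?case by (simp add: ccls_push)
qed

lemma send_append:
  "set X \<subseteq> obj C \<Longrightarrow> set Y \<subseteq> obj C \<Longrightarrow> \<guillemotleft>send p (X @ Y)\<guillemotright> = hseq_pol p \<guillemotleft>HId (prod_obj p Y)\<guillemotright> \<guillemotleft>send p X\<guillemotright> \<Sslash> \<guillemotleft>send p Y\<guillemotright>"
proof (induction X)
  case Nil
  then show ?case by (simp add: hpol_hid vseq_hid)
next
  case (Cons A X)
  have "hseq_pol p \<guillemotleft>HId (prod_obj p Y)\<guillemotright> (hseq_pol p \<guillemotleft>HId (prod_obj p X)\<guillemotright> \<guillemotleft>corner_out p A\<guillemotright> \<Sslash> \<guillemotleft>send p X\<guillemotright>)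
     = hseq_pol p \<guillemotleft>HId (otimes_pol p (prod_obj p Y) (prod_obj p X))\<guillemotright> \<guillemotleft>corner_out p A\<guillemotright> \<Sslash> hseq_pol p \<guillemotleft>HId (prod_obj p Y)\<guillemotright> \<guillemotleft>send p X\<guillemotright>"
    using hpol_interchange[of "HId (prod_obj p Y)" "HId (prod_obj p Y)" "hcomp_pol p (HId (prod_obj p X)) (corner_out p A)" "send p X" p] Cons
    by (simp add: ccls_push vseq_hid hpol_hid flip: hpol_assoc)
  with Cons show ?case by (simp add: ccls_push prod_obj_append)
qed

text \<open>The lower word is collected on the near side of the upper one, hence the factor
  \<open>g\<close> precedes \<open>f\<close>. Three exchanges of disjoint parts sort the stack:
  collecting \<open>X'\<close> moves above emitting \<open>Y\<close> and above \<open>f\<close>, and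
  emitting \<open>Y\<close> moves below \<open>g\<close>.\<close>

lemma vseq_via_via:
  assumes "typed p X f Y" "typed p X' g Y'"
  shows "\<guillemotleft>via p X f Y\<guillemotright> \<Sslash> \<guillemotleft>via p X' g Y'\<guillemotright> = \<guillemotleft>via p (X @ X') (atimes_pol p g f) (Y @ Y')\<guillemotright>" (is ?eq)
    and "typed p (X @ X') (atimes_pol p g f) (Y @ Y')"
proof -
  show "typed p (X @ X') (atimes_pol p g f) (Y @ Y')"
    using assms by (cases p) (auto simp: typed_def base_simps prod_obj_append atimes_pol_def otimes_pol_def)
  let ?PX = "\<guillemotleft>HId (prod_obj p X)\<guillemotright>" and ?PX' = "\<guillemotleft>HId (prod_obj p X')\<guillemotright>" and ?PY = "\<guillemotleft>HId (prod_obj p Y)\<guillemotright>" and ?PY' = "\<guillemotleft>HId (prod_obj p Y')\<guillemotright>"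
  note a = assms[unfolded typed_def]
  have "\<guillemotleft>via p X f Y\<guillemotright> \<Sslash> \<guillemotleft>via p X' g Y'\<guillemotright>
    = \<guillemotleft>recv p X\<guillemotright> \<Sslash> (\<guillemotleft>Box f\<guillemotright> \<Sslash> hseq_pol p \<guillemotleft>recv p X'\<guillemotright> ?PY) \<Sslash> (hseq_pol p ?PX' \<guillemotleft>send p Y\<guillemotright> \<Sslash> \<guillemotleft>Box g\<guillemotright>) \<Sslash> \<guillemotleft>send p Y'\<guillemotright>"
    using a by (simp add: via_def ccls_push vseq_send_recv[THEN vseq_ext])
  also have "\<guillemotleft>Box f\<guillemotright> \<Sslash> hseq_pol p \<guillemotleft>recv p X'\<guillemotright> ?PY = hseq_pol p \<guillemotleft>recv p X'\<guillemotright> ?PX \<Sslash> hseq_pol p ?PX' \<guillemotleft>Box f\<guillemotright>"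
    using hpol_above[of "recv p X'" "Box f" p] hpol_below[of "recv p X'" "Box f" p] a
    by (simp add: hpol_hid_unit)
  also have "hseq_pol p ?PX' \<guillemotleft>send p Y\<guillemotright> \<Sslash> \<guillemotleft>Box g\<guillemotright> = hseq_pol p \<guillemotleft>Box g\<guillemotright> ?PY \<Sslash> hseq_pol p ?PY' \<guillemotleft>send p Y\<guillemotright>"
    using hpol_above[of "Box g" "send p Y" p] hpol_below[of "Box g" "send p Y" p] a
    by (simp add: hpol_hid_unit)
  also have "\<guillemotleft>recv p X\<guillemotright> \<Sslash> (hseq_pol p \<guillemotleft>recv p X'\<guillemotright> ?PX \<Sslash> hseq_pol p ?PX' \<guillemotleft>Box f\<guillemotright>) \<Sslash> (hseq_pol p \<guillemotleft>Box g\<guillemotright> ?PY \<Sslash> hseq_pol p ?PY' \<guillemotleft>send p Y\<guillemotright>) \<Sslash> \<guillemotleft>send p Y'\<guillemotright>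
    = (\<guillemotleft>recv p X\<guillemotright> \<Sslash> hseq_pol p \<guillemotleft>recv p X'\<guillemotright> ?PX) \<Sslash> (hseq_pol p ?PX' \<guillemotleft>Box f\<guillemotright> \<Sslash> hseq_pol p \<guillemotleft>Box g\<guillemotright> ?PY) \<Sslash> (hseq_pol p ?PY' \<guillemotleft>send p Y\<guillemotright> \<Sslash> \<guillemotleft>send p Y'\<guillemotright>)"
    by (simp only: vseq_assoc)
  also have "hseq_pol p ?PX' \<guillemotleft>Box f\<guillemotright> \<Sslash> hseq_pol p \<guillemotleft>Box g\<guillemotright> ?PY = \<guillemotleft>Box (atimes_pol p g f)\<guillemotright>"
    using hpol_below[of "Box g" "Box f" p] a by (simp add: hpol_box)
  also have "(\<guillemotleft>recv p X\<guillemotright> \<Sslash> hseq_pol p \<guillemotleft>recv p X'\<guillemotright> ?PX) \<Sslash> \<guillemotleft>Box (atimes_pol p g f)\<guillemotright> \<Sslash> (hseq_pol p ?PY' \<guillemotleft>send p Y\<guillemotright> \<Sslash> \<guillemotleft>send p Y'\<guillemotright>)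
    = \<guillemotleft>via p (X @ X') (atimes_pol p g f) (Y @ Y')\<guillemotright>"
    using a by (simp add: via_def ccls_v recv_append send_append)
  finally show ?eq .
qed

lemma vid_via: "set X \<subseteq> obj C \<Longrightarrow> \<guillemotleft>VId (word p X)\<guillemotright> = \<guillemotleft>via p X (idt C (prod_obj p X)) X\<guillemotright>"
  "set X \<subseteq> obj C \<Longrightarrow> typed p X (idt C (prod_obj p X)) X"
  by (simp_all add: via_def ccls_push box_idt vseq_hid vseq_recv_send typed_def base_simps)

section \<open>From arrows to horizontal cells\<close>

text \<open>A white word is emitted from the right end of the product, so the last factor leaves
  first, and a white split or merge needs a braiding to preserve the order of the letters. Black
  words are handled on the opposite sides and keep the order of the factors, so no braiding occurs
  there.\<close>

primrec horiz :: "('o, 'm) tterm \<Rightarrow> ('o, 'm) cterm" where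
  "horiz (\<one>\<^sub>T X) = VId X"
| "horiz (t ;; u) = horiz t \<parallel> horiz u"
| "horiz (t \<star> u) = horiz t \<div> horiz u"
| "horiz (Map p f) = corner_in p (src C f) \<div> Box f \<div> corner_out p (tgt C f)"
| "horiz (Split p A B) = (case p of
     White \<Rightarrow> RW (A \<odot> B) \<div> Box (\<sigma> A B) \<div> (HId B \<parallel> SW A) \<div> SW B
   | Black \<Rightarrow> RB A \<div> (HId A \<parallel> RB B) \<div> SB (A \<odot> B))"
| "horiz (Merge p A B) = (case p of
     White \<Rightarrow> RW A \<div> (RW B \<parallel> HId A) \<div> Box (\<sigma> B A) \<div> SW (A \<odot> B)
   | Black \<Rightarrow> RB (A \<odot> B) \<div> (SB A \<parallel> HId B) \<div> SB B)"
| "horiz (Iota p) = (case p of White \<Rightarrow> SW (ounit C) | Black \<Rightarrow> RB (ounit C))"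
| "horiz (Kappa p) = (case p of White \<Rightarrow> RW (ounit C) | Black \<Rightarrow> SB (ounit C))"
| "horiz (Sigma p A B) = (case p of
     White \<Rightarrow> RW A \<div> (RW B \<parallel> HId A) \<div> Box (\<sigma> B A) \<div> (HId A \<parallel> SW B) \<div> SW A
   | Black \<Rightarrow> RB B \<div> (HId B \<parallel> RB A) \<div> Box (\<sigma> B A) \<div> (SB A \<parallel> HId B) \<div> SB B)"
| "horiz (Eta A) = RB A \<div> SW A"
| "horiz (Eps A) = RW A \<div> SB A"

lemma horiz_wf [simp]:
  assumes "wf_t C t"
  shows "wf_cell C (horiz t)" "ttop C (horiz t) = ounit C" "tbot C (horiz t) = ounit C"
    "tleft (horiz t) = tdom C t" "tright (horiz t) = tcod C t"
proof -
  have "wf_t C t \<Longrightarrow> wf_cell C (horiz t) \<and> ttop C (horiz t) = ounit C \<and> tbot C (horiz t) = ounit C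
    \<and> tleft (horiz t) = tdom C t \<and> tright (horiz t) = tcod C t"
    by (induction t) (auto simp: base_simps corner_in_def corner_out_def split: polarity.splits)
  with assms show "wf_cell C (horiz t)" "ttop C (horiz t) = ounit C" "tbot C (horiz t) = ounit C"
    "tleft (horiz t) = tdom C t" "tright (horiz t) = tcod C t" by blast+
qed

lemma hpol_cases [simp]: "hseq_pol White S T = S \<interleave> T" "hseq_pol Black S T = T \<interleave> S"
  by (simp_all add: hseq_pol_def)

lemma pol_cases [simp]:
  "corner_in White A = RW A" "corner_in Black A = RB A" "corner_out White A = SW A" "corner_out Black A = SB A"
  "atimes_pol White f g = f \<oslash> g" "atimes_pol Black f g = g \<oslash> f" "otimes_pol White A B = A \<odot> B" "otimes_pol Black A B = B \<odot> A"
  "near White a = tleft a" "near Black a = tright a" "far White a = tright a" "far Black a = tleft a"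
  "hcomp_pol White a b = a \<parallel> b" "hcomp_pol Black a b = b \<parallel> a"
  by (simp_all add: pol_defs)

lemma recv_send_short:
  assumes "A \<in> obj C"
  shows "\<guillemotleft>recv p [A]\<guillemotright> = \<guillemotleft>corner_in p A\<guillemotright>" "\<guillemotleft>send p [A]\<guillemotright> = \<guillemotleft>corner_out p A\<guillemotright>"
    "B \<in> obj C \<Longrightarrow> \<guillemotleft>recv p [A, B]\<guillemotright> = \<guillemotleft>corner_in p A\<guillemotright> \<Sslash> hseq_pol p \<guillemotleft>corner_in p B\<guillemotright> \<guillemotleft>HId A\<guillemotright>"
    "B \<in> obj C \<Longrightarrow> \<guillemotleft>send p [A, B]\<guillemotright> = hseq_pol p \<guillemotleft>HId B\<guillemotright> \<guillemotleft>corner_out p A\<guillemotright> \<Sslash> \<guillemotleft>corner_out p B\<guillemotright>"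
  using assms by (simp_all add: ccls_push hpol_hid vseq_hid hpol_hid_unit)

text \<open>A hexagon makes the braiding with the unit idempotent, symmetry makes it invertible, and
  an invertible idempotent is an identity.\<close>

lemma braid_unit:
  assumes "A \<in> obj C"
  shows "\<sigma> A (ounit C) = idt C A" "\<sigma> (ounit C) A = idt C A"
proof -
  let ?s = "\<sigma> A (ounit C)" and ?s' = "\<sigma> (ounit C) A"
  note t = assms base_simps
  have s: "?s = ?s \<Zsemi> ?s"
    using braid_hexagon1[of A "ounit C" "ounit C"] t by (simp add: unit_atimes atimes_unit)
  have "idt C A = ?s \<Zsemi> ?s'" using braid_symmetric[of A "ounit C"] t by simp
  also have "\<dots> = (?s \<Zsemi> ?s) \<Zsemi> ?s'" by (simp only: s[symmetric])
  also have "\<dots> = ?s \<Zsemi> (?s \<Zsemi> ?s')" using t seq_assoc[of ?s ?s ?s'] by simp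
  also have "\<dots> = ?s" using braid_symmetric[of A "ounit C"] t seq_idt[of ?s] by simp
  finally show 1: "?s = idt C A" by simp
  show "?s' = idt C A" using braid_symmetric[of A "ounit C"] t 1 idt_seq[of ?s'] by simp
qed

lemma vseq_hid_h:
  "wf_cell C (a \<parallel> b) \<Longrightarrow> A = ttop C a \<odot> ttop C b \<Longrightarrow> \<guillemotleft>HId A\<guillemotright> \<Sslash> (\<guillemotleft>a\<guillemotright> \<interleave> \<guillemotleft>b\<guillemotright>) = \<guillemotleft>a\<guillemotright> \<interleave> \<guillemotleft>b\<guillemotright>"
  using vseq_hid(1)[of "a \<parallel> b"] by (simp add: ccls_h)

lemma horiz_gen:
  "f \<in> arr C \<Longrightarrow> \<guillemotleft>horiz (Map p f)\<guillemotright> = \<guillemotleft>via p [src C f] f [tgt C f]\<guillemotright>"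
  "A \<in> obj C \<Longrightarrow> B \<in> obj C \<Longrightarrow> \<guillemotleft>horiz (Split White A B)\<guillemotright> = \<guillemotleft>via White [A \<odot> B] (\<sigma> A B) [A, B]\<guillemotright>"
  "A \<in> obj C \<Longrightarrow> B \<in> obj C \<Longrightarrow> \<guillemotleft>horiz (Merge White A B)\<guillemotright> = \<guillemotleft>via White [A, B] (\<sigma> B A) [A \<odot> B]\<guillemotright>"
  "A \<in> obj C \<Longrightarrow> B \<in> obj C \<Longrightarrow> \<guillemotleft>horiz (Sigma White A B)\<guillemotright> = \<guillemotleft>via White [A, B] (\<sigma> B A) [B, A]\<guillemotright>"
  "A \<in> obj C \<Longrightarrow> B \<in> obj C \<Longrightarrow> \<guillemotleft>horiz (Split Black A B)\<guillemotright> = \<guillemotleft>via Black [A, B] (idt C (A \<odot> B)) [A \<odot> B]\<guillemotright>"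
  "A \<in> obj C \<Longrightarrow> B \<in> obj C \<Longrightarrow> \<guillemotleft>horiz (Merge Black A B)\<guillemotright> = \<guillemotleft>via Black [A \<odot> B] (idt C (A \<odot> B)) [A, B]\<guillemotright>"
  "A \<in> obj C \<Longrightarrow> B \<in> obj C \<Longrightarrow> \<guillemotleft>horiz (Sigma Black A B)\<guillemotright> = \<guillemotleft>via Black [B, A] (\<sigma> B A) [A, B]\<guillemotright>"
  "\<guillemotleft>horiz (Iota White)\<guillemotright> = \<guillemotleft>via White [] (idt C (ounit C)) [ounit C]\<guillemotright>"
  "\<guillemotleft>horiz (Kappa White)\<guillemotright> = \<guillemotleft>via White [ounit C] (idt C (ounit C)) []\<guillemotright>"
  "\<guillemotleft>horiz (Iota Black)\<guillemotright> = \<guillemotleft>via Black [ounit C] (idt C (ounit C)) []\<guillemotright>"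
  "\<guillemotleft>horiz (Kappa Black)\<guillemotright> = \<guillemotleft>via Black [] (idt C (ounit C)) [ounit C]\<guillemotright>"
            apply (simp_all add: via_def ccls_v vseq_assoc recv_send_short base_simps del: recv.simps send.simps)
        apply (simp_all add: ccls_push box_idt vseq_hid vseq_hid_h vseq_hid_h[THEN vseq_ext] vseq_hid[THEN vseq_ext] base_simps)
  done

lemma vid_short:
  assumes "A \<in> obj C"
  shows "\<guillemotleft>VId [(A, p)]\<guillemotright> = \<guillemotleft>via p [A] (idt C A) [A]\<guillemotright>"
    "B \<in> obj C \<Longrightarrow> \<guillemotleft>VId [(A, p), (B, p)]\<guillemotright> = \<guillemotleft>via p [A, B] (idt C (otimes_pol p B A)) [A, B]\<guillemotright>"
  using assms vid_via(1)[of "[A]" p] vid_via(1)[of "[A, B]" p] by simp_all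

lemma vid_nil: "\<guillemotleft>VId []\<guillemotright> = \<guillemotleft>via p [] (idt C (ounit C)) []\<guillemotright>"
  using vid_via(1)[of "[]" p] by simp

lemma hseq_via_via:
  "typed White X f Y \<Longrightarrow> typed White Y g Z \<Longrightarrow> \<guillemotleft>via White X f Y\<guillemotright> \<interleave> \<guillemotleft>via White Y g Z\<guillemotright> = \<guillemotleft>via White X (f \<Zsemi> g) Z\<guillemotright>"
  "typed Black X f Y \<Longrightarrow> typed Black Y g Z \<Longrightarrow> \<guillemotleft>via Black Y g Z\<guillemotright> \<interleave> \<guillemotleft>via Black X f Y\<guillemotright> = \<guillemotleft>via Black X (f \<Zsemi> g) Z\<guillemotright>"
  using hpol_via_via[of White X f Y g Z] hpol_via_via[of Black X f Y g Z] by simp_all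

lemmas via_calc = vid_short horiz_gen hseq_via_via vseq_via_via
lemmas horiz_push = horiz.simps(1-3) ccls_h ccls_v

section \<open>Braid calculations in the base category\<close>

lemma yang_baxter_base:
  assumes "X \<in> obj C" "Y \<in> obj C" "Z \<in> obj C"
  shows "(idt C X \<oslash> \<sigma> Y Z) \<Zsemi> ((\<sigma> X Z \<oslash> idt C Y) \<Zsemi> (idt C Z \<oslash> \<sigma> X Y))
    = (\<sigma> X Y \<oslash> idt C Z) \<Zsemi> ((idt C Y \<oslash> \<sigma> X Z) \<Zsemi> (\<sigma> Y Z \<oslash> idt C X))"
  using braid_natural[of "\<sigma> X Y" "idt C Z"] braid_hexagon2[of X Y Z] braid_hexagon2[of Y X Z] assms
  by (simp add: base_simps seq_assoc)

lemma seq_ext_base: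
  assumes "f \<Zsemi> g = h" "f \<in> arr C" "g \<in> arr C" "k \<in> arr C" "tgt C f = src C g" "tgt C g = src C k"
  shows "f \<Zsemi> (g \<Zsemi> k) = h \<Zsemi> k"
  using assms seq_assoc[of f g k] by simp

lemma yang_baxter_base_ext:
  assumes "X \<in> obj C" "Y \<in> obj C" "Z \<in> obj C" "k \<in> arr C" "src C k = Z \<odot> (Y \<odot> X)"
  shows "(idt C X \<oslash> \<sigma> Y Z) \<Zsemi> ((\<sigma> X Z \<oslash> idt C Y) \<Zsemi> ((idt C Z \<oslash> \<sigma> X Y) \<Zsemi> k))
    = (\<sigma> X Y \<oslash> idt C Z) \<Zsemi> ((idt C Y \<oslash> \<sigma> X Z) \<Zsemi> ((\<sigma> Y Z \<oslash> idt C X) \<Zsemi> k))"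
  using arg_cong[OF yang_baxter_base[OF assms(1-3)], of "\<lambda>x. x \<Zsemi> k"] assms
  by (simp add: base_simps seq_assoc)

lemma braid_cancel:
  assumes "A \<in> obj C" "B \<in> obj C" "D \<in> obj C"
  shows "(\<sigma> A B \<oslash> idt C D) \<Zsemi> (\<sigma> B A \<oslash> idt C D) = idt C (A \<odot> (B \<odot> D))"
    "(idt C D \<oslash> \<sigma> A B) \<Zsemi> (idt C D \<oslash> \<sigma> B A) = idt C (D \<odot> (A \<odot> B))"
  using interchange[of "\<sigma> A B" "\<sigma> B A" "idt C D" "idt C D"] interchange[of "idt C D" "idt C D" "\<sigma> A B" "\<sigma> B A"]
    idt_seq[of "idt C D"] assms
  by (simp_all add: base_simps braid_symmetric atimes_idt)

lemma braid_cancel_ext: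
  assumes "A \<in> obj C" "B \<in> obj C" "D \<in> obj C" "k \<in> arr C"
  shows "src C k = A \<odot> B \<Longrightarrow> \<sigma> A B \<Zsemi> (\<sigma> B A \<Zsemi> k) = k"
    "src C k = A \<odot> (B \<odot> D) \<Longrightarrow> (\<sigma> A B \<oslash> idt C D) \<Zsemi> ((\<sigma> B A \<oslash> idt C D) \<Zsemi> k) = k"
    "src C k = D \<odot> (A \<odot> B) \<Longrightarrow> (idt C D \<oslash> \<sigma> A B) \<Zsemi> ((idt C D \<oslash> \<sigma> B A) \<Zsemi> k) = k"
  using seq_ext_base[OF braid_symmetric[OF assms(1,2)], of k] seq_ext_base[OF braid_cancel(1)[OF assms(1-3)], of k]
    seq_ext_base[OF braid_cancel(2)[OF assms(1-3)], of k] idt_seq[of k] assms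
  by (simp_all add: base_simps)

lemma idt_elim:
  assumes "f \<in> arr C"
  shows "X = src C f \<Longrightarrow> idt C X \<Zsemi> f = f" "X = tgt C f \<Longrightarrow> f \<Zsemi> idt C X = f"
  using assms by (simp_all add: idt_seq seq_idt)

text \<open>Stacking two white maps multiplies their arrows in reverse order; the braidings drawn in
  the white split and merge conjugate the product back. This is the tensor equation for white
  maps.\<close>

lemma braid_conj:
  assumes "f \<in> arr C" "g \<in> arr C"
  shows "\<sigma> (src C f) (src C g) \<Zsemi> (g \<oslash> f \<Zsemi> \<sigma> (tgt C g) (tgt C f)) = f \<oslash> g"
  using assms braid_natural[OF assms] braid_symmetric[of "tgt C f" "tgt C g"]
    seq_assoc[of "f \<oslash> g" "\<sigma> (tgt C f) (tgt C g)" "\<sigma> (tgt C g) (tgt C f)"]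
    seq_assoc[of "\<sigma> (src C f) (src C g)" "g \<oslash> f" "\<sigma> (tgt C g) (tgt C f)"]
  by (simp add: base_simps idt_elim)

text \<open>The hexagons expand braidings of products into braidings of single objects. Symmetry and
  Yang-Baxter, used in one orientation, then bring the composites arising from the one-coloured
  equations to a common form.\<close>

lemmas base_calc = base_simps atimes_idt atimes_assoc braid_symmetric idt_elim seq_assoc braid_hexagon1
  braid_hexagon2 braid_unit unit_atimes atimes_unit yang_baxter_base yang_baxter_base_ext braid_cancel braid_cancel_ext

section \<open>Cups and caps: cells with both words on the same side\<close>

definition cup :: "'o list \<Rightarrow> 'm \<Rightarrow> 'o list \<Rightarrow> ('o, 'm) cterm" where
  "cup P f X = recv Black P \<div> (Box f \<div> send White X)"
definition cap :: "'o list \<Rightarrow> 'm \<Rightarrow> 'o list \<Rightarrow> ('o, 'm) cterm" where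
  "cap X f P = recv White X \<div> (Box f \<div> send Black P)"

text \<open>The black leg leads into \<open>f\<close> and the white leg out of it, so one-coloured
  cells attached to the legs act before and after \<open>f\<close>. With the dual fact for caps, the
  dinaturality equations and those relating \<eta> and \<epsilon> to crossings, splits and merges
  become equations between arrows of C.\<close>

lemma cup_absorb:
  assumes "set P \<subseteq> obj C" "set X \<subseteq> obj C" "f \<in> arr C" "src C f = prod_obj Black P" "tgt C f = prod_obj White X"
    "typed Black P' g P" "typed White X h Y"
  shows "\<guillemotleft>cup P f X\<guillemotright> \<interleave> (\<guillemotleft>via Black P' g P\<guillemotright> \<Sslash> \<guillemotleft>via White X h Y\<guillemotright>) = \<guillemotleft>cup P' (g \<Zsemi> (f \<Zsemi> h)) Y\<guillemotright>"
proof -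
  note [simp] = recv_send_simps(4,5,9,10)[of _ White, simplified] recv_send_simps(4,5,9,10)[of _ Black, simplified]
    via_simps(4,5)[of White, simplified] via_simps(4,5)[of Black, simplified]
  have "\<guillemotleft>cup P f X\<guillemotright> \<interleave> (\<guillemotleft>via Black P' g P\<guillemotright> \<Sslash> \<guillemotleft>via White X h Y\<guillemotright>) = 
     (\<guillemotleft>recv Black P\<guillemotright> \<interleave> \<guillemotleft>via Black P' g P\<guillemotright>) \<Sslash> ((\<guillemotleft>Box f\<guillemotright> \<Sslash> \<guillemotleft>send White X\<guillemotright>) \<interleave> \<guillemotleft>via White X h Y\<guillemotright>)"
    using hpol_interchange[of "recv Black P" "Box f \<div> send White X" "via Black P' g P" "via White X h Y" White] assms
    by (simp add: cup_def ccls_push)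
  also have "(\<guillemotleft>Box f\<guillemotright> \<Sslash> \<guillemotleft>send White X\<guillemotright>) \<interleave> \<guillemotleft>via White X h Y\<guillemotright> = \<guillemotleft>Box f\<guillemotright> \<Sslash> (\<guillemotleft>send White X\<guillemotright> \<interleave> \<guillemotleft>via White X h Y\<guillemotright>)"
    using hpol_interchange[of "Box f" "send White X" "HId (ounit C)" "via White X h Y" White] assms
      hpol_hid_unit(2)[of "Box f" White]
    by (simp add: ccls_push vseq_hid)
  finally show ?thesis
    using hpol_send_via[OF assms(7)] hpol_via_recv[OF assms(6)] assms
    by (simp add: cup_def ccls_v vseq_assoc vseq_box[THEN vseq_ext] typed_def base_simps)
qed

lemma cap_absorb:
  assumes "set P \<subseteq> obj C" "set X \<subseteq> obj C" "f \<in> arr C" "src C f = prod_obj White X" "tgt C f = prod_obj Black P"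
    "typed Black P g P'" "typed White Y h X"
  shows "(\<guillemotleft>via White Y h X\<guillemotright> \<Sslash> \<guillemotleft>via Black P g P'\<guillemotright>) \<interleave> \<guillemotleft>cap X f P\<guillemotright> = \<guillemotleft>cap Y (h \<Zsemi> (f \<Zsemi> g)) P'\<guillemotright>"
proof -
  note [simp] = recv_send_simps(4,5,9,10)[of _ White, simplified] recv_send_simps(4,5,9,10)[of _ Black, simplified]
    via_simps(4,5)[of White, simplified] via_simps(4,5)[of Black, simplified]
  have "(\<guillemotleft>via White Y h X\<guillemotright> \<Sslash> \<guillemotleft>via Black P g P'\<guillemotright>) \<interleave> \<guillemotleft>cap X f P\<guillemotright> = 
     (\<guillemotleft>via White Y h X\<guillemotright> \<interleave> \<guillemotleft>recv White X\<guillemotright>) \<Sslash> (\<guillemotleft>via Black P g P'\<guillemotright> \<interleave> (\<guillemotleft>Box f\<guillemotright> \<Sslash> \<guillemotleft>send Black P\<guillemotright>))"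
    using hpol_interchange[of "via White Y h X" "via Black P g P'" "recv White X" "Box f \<div> send Black P" White] assms
    by (simp add: cap_def ccls_push)
  also have "\<guillemotleft>via Black P g P'\<guillemotright> \<interleave> (\<guillemotleft>Box f\<guillemotright> \<Sslash> \<guillemotleft>send Black P\<guillemotright>) = \<guillemotleft>Box f\<guillemotright> \<Sslash> (\<guillemotleft>via Black P g P'\<guillemotright> \<interleave> \<guillemotleft>send Black P\<guillemotright>)"
    using hpol_interchange[of "HId (ounit C)" "via Black P g P'" "Box f" "send Black P" White] assms
      hpol_hid_unit(1)[of "Box f" White]
    by (simp add: ccls_push vseq_hid)
  finally show ?thesis
    using hpol_via_recv[OF assms(7)] hpol_send_via[OF assms(6)] assms
    by (simp add: cap_def ccls_v vseq_assoc vseq_box[THEN vseq_ext] typed_def base_simps)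
qed

lemma hseq_interchange3:
  assumes "wf_cell C (a \<div> (b \<div> c))" "wf_cell C (a' \<div> (b' \<div> c'))" "tright a = tleft a'" "tright b = tleft b'" "tright c = tleft c'"
  shows "(\<guillemotleft>a\<guillemotright> \<Sslash> \<guillemotleft>b\<guillemotright> \<Sslash> \<guillemotleft>c\<guillemotright>) \<interleave> (\<guillemotleft>a'\<guillemotright> \<Sslash> \<guillemotleft>b'\<guillemotright> \<Sslash> \<guillemotleft>c'\<guillemotright>) = (\<guillemotleft>a\<guillemotright> \<interleave> \<guillemotleft>a'\<guillemotright>) \<Sslash> (\<guillemotleft>b\<guillemotright> \<interleave> \<guillemotleft>b'\<guillemotright>) \<Sslash> (\<guillemotleft>c\<guillemotright> \<interleave> \<guillemotleft>c'\<guillemotright>)"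
  using hpol_interchange[of a "b \<div> c" a' "b' \<div> c'" White] hpol_interchange[of b c b' c' White] assms
  by (simp add: ccls_push)

lemma hseq_vid:
  "wf_cell C a \<Longrightarrow> X = tleft a \<Longrightarrow> \<guillemotleft>VId X\<guillemotright> \<interleave> \<guillemotleft>a\<guillemotright> = \<guillemotleft>a\<guillemotright>"
  "wf_cell C a \<Longrightarrow> X = tright a \<Longrightarrow> \<guillemotleft>a\<guillemotright> \<interleave> \<guillemotleft>VId X\<guillemotright> = \<guillemotleft>a\<guillemotright>"
  using hpol_vid[of a X White] by simp_all

lemma horiz_eta:
  assumes "A \<in> obj C"
  shows "\<guillemotleft>horiz (Eta A)\<guillemotright> = \<guillemotleft>cup [A] (idt C A) [A]\<guillemotright>" "\<guillemotleft>horiz (Eps A)\<guillemotright> = \<guillemotleft>cap [A] (idt C A) [A]\<guillemotright>"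
  using assms by (simp_all add: cup_def cap_def ccls_v recv_send_short box_idt vseq_hid del: recv.simps send.simps)

lemma horiz_nest:
  assumes "A \<in> obj C" "B \<in> obj C"
  shows "\<guillemotleft>horiz (Nest_eta A B)\<guillemotright> = \<guillemotleft>cup [B, A] (idt C (B \<odot> A)) [A, B]\<guillemotright>"
    "\<guillemotleft>horiz (Nest_eps A B)\<guillemotright> = \<guillemotleft>cap [A, B] (idt C (B \<odot> A)) [B, A]\<guillemotright>"
proof -
  \<comment> \<open>The outer cup is stretched by an identity on its wire \<open>B\<close>, so that
    both factors have three layers. Interchange then works layer by layer and puts the inner cup to
    the right of that wire.\<close>
  have "\<guillemotleft>horiz (Nest_eta A B)\<guillemotright> = (\<guillemotleft>RB B\<guillemotright> \<Sslash> \<guillemotleft>HId B\<guillemotright> \<Sslash> \<guillemotleft>SW B\<guillemotright>) \<interleave> (\<guillemotleft>VId (B\<^sup>\<bullet>)\<guillemotright> \<Sslash> \<guillemotleft>RB A \<div> SW A\<guillemotright> \<Sslash> \<guillemotleft>VId (B\<^sup>\<circ>)\<guillemotright>)"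
    using assms by (simp add: Nest_eta_def ccls_push vseq_hid)
  also have "\<dots> = \<guillemotleft>RB B\<guillemotright> \<Sslash> (\<guillemotleft>HId B\<guillemotright> \<interleave> \<guillemotleft>RB A \<div> SW A\<guillemotright>) \<Sslash> \<guillemotleft>SW B\<guillemotright>"
    using assms by (subst hseq_interchange3) (simp_all add: base_simps hseq_vid)
  also have "\<guillemotleft>HId B\<guillemotright> \<interleave> \<guillemotleft>RB A \<div> SW A\<guillemotright> = (\<guillemotleft>HId B\<guillemotright> \<interleave> \<guillemotleft>RB A\<guillemotright>) \<Sslash> (\<guillemotleft>HId B\<guillemotright> \<interleave> \<guillemotleft>SW A\<guillemotright>)"
    using assms hpol_interchange[of "HId B" "HId B" "RB A" "SW A" White] by (simp add: ccls_push vseq_hid)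
  finally show "\<guillemotleft>horiz (Nest_eta A B)\<guillemotright> = \<guillemotleft>cup [B, A] (idt C (B \<odot> A)) [A, B]\<guillemotright>"
    using assms by (simp add: cup_def ccls_v recv_send_short box_idt vseq_hid vseq_hid_h vseq_hid_h[THEN vseq_ext] base_simps vseq_assoc del: recv.simps send.simps)
  have "\<guillemotleft>horiz (Nest_eps A B)\<guillemotright> = (\<guillemotleft>VId (A\<^sup>\<circ>)\<guillemotright> \<Sslash> \<guillemotleft>RW B \<div> SB B\<guillemotright> \<Sslash> \<guillemotleft>VId (A\<^sup>\<bullet>)\<guillemotright>) \<interleave> (\<guillemotleft>RW A\<guillemotright> \<Sslash> \<guillemotleft>HId A\<guillemotright> \<Sslash> \<guillemotleft>SB A\<guillemotright>)"
    using assms by (simp add: Nest_eps_def ccls_push vseq_hid)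
  also have "\<dots> = \<guillemotleft>RW A\<guillemotright> \<Sslash> (\<guillemotleft>RW B \<div> SB B\<guillemotright> \<interleave> \<guillemotleft>HId A\<guillemotright>) \<Sslash> \<guillemotleft>SB A\<guillemotright>"
    using assms by (subst hseq_interchange3) (simp_all add: base_simps hseq_vid)
  also have "\<guillemotleft>RW B \<div> SB B\<guillemotright> \<interleave> \<guillemotleft>HId A\<guillemotright> = (\<guillemotleft>RW B\<guillemotright> \<interleave> \<guillemotleft>HId A\<guillemotright>) \<Sslash> (\<guillemotleft>SB B\<guillemotright> \<interleave> \<guillemotleft>HId A\<guillemotright>)"
    using assms hpol_interchange[of "RW B" "SB B" "HId A" "HId A" White] by (simp add: ccls_push vseq_hid)
  finally show "\<guillemotleft>horiz (Nest_eps A B)\<guillemotright> = \<guillemotleft>cap [A, B] (idt C (B \<odot> A)) [B, A]\<guillemotright>"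
    using assms by (simp add: cap_def ccls_v recv_send_short box_idt vseq_hid vseq_hid_h vseq_hid_h[THEN vseq_ext] base_simps vseq_assoc del: recv.simps send.simps)
qed

section \<open>Sliding a wire through an arbitrary cell\<close>

text \<open>The cell by which a wire \<open>A\<close> running downwards crosses the letter \<open>x\<close>.\<close>

definition crossing1 :: "'o \<Rightarrow> 'o \<times> polarity \<Rightarrow> ('o, 'm) cterm" where
  "crossing1 A x = (case x of
     (B, White) \<Rightarrow> (RW B \<parallel> HId A) \<div> (Box (\<sigma> B A) \<div> (HId A \<parallel> SW B))
   | (B, Black) \<Rightarrow> (HId A \<parallel> RB B) \<div> (Box (\<sigma> A B) \<div> (SB B \<parallel> HId A)))"

primrec crossing :: "'o \<Rightarrow> 'o pword \<Rightarrow> ('o, 'm) cterm" where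
  "crossing A [] = HId A"
| "crossing A (x # X) = crossing1 A x \<div> crossing A X"

lemma crossing1_wf [simp]:
  assumes "A \<in> obj C" "fst x \<in> obj C"
  shows "wf_cell C (crossing1 A x)" "ttop C (crossing1 A x) = A" "tbot C (crossing1 A x) = A"
    "tleft (crossing1 A x) = [x]" "tright (crossing1 A x) = [x]"
  using assms by (auto simp: crossing1_def base_simps split: prod.splits polarity.splits)

lemma crossing_wf [simp]:
  assumes "A \<in> obj C" "X \<in> pwords C"
  shows "wf_cell C (crossing A X)" "ttop C (crossing A X) = A" "tbot C (crossing A X) = A"
    "tleft (crossing A X) = X" "tright (crossing A X) = X"
proof -
  have "X \<in> pwords C \<Longrightarrow> wf_cell C (crossing A X) \<and> ttop C (crossing A X) = A \<and> tbot C (crossing A X) = A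
    \<and> tleft (crossing A X) = X \<and> tright (crossing A X) = X"
    using assms(1) by (induction X) auto
  with assms(2) show "wf_cell C (crossing A X)" "ttop C (crossing A X) = A" "tbot C (crossing A X) = A"
    "tleft (crossing A X) = X" "tright (crossing A X) = X" by blast+
qed

lemma crossing_append:
  "A \<in> obj C \<Longrightarrow> X \<in> pwords C \<Longrightarrow> Y \<in> pwords C \<Longrightarrow> \<guillemotleft>crossing A (X @ Y)\<guillemotright> = \<guillemotleft>crossing A X\<guillemotright> \<Sslash> \<guillemotleft>crossing A Y\<guillemotright>"
  by (induction X) (simp_all add: vseq_hid ccls_push)

lemma hseq_hid_unit:
  "wf_cell C a \<Longrightarrow> tleft a = [] \<Longrightarrow> \<guillemotleft>HId (ounit C)\<guillemotright> \<interleave> \<guillemotleft>a\<guillemotright> = \<guillemotleft>a\<guillemotright>"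
  "wf_cell C a \<Longrightarrow> tright a = [] \<Longrightarrow> \<guillemotleft>a\<guillemotright> \<interleave> \<guillemotleft>HId (ounit C)\<guillemotright> = \<guillemotleft>a\<guillemotright>"
  using hpol_hid_unit[of a White] by simp_all

lemma vseq_braid: "A \<in> obj C \<Longrightarrow> B \<in> obj C \<Longrightarrow> \<guillemotleft>Box (\<sigma> A B)\<guillemotright> \<Sslash> \<guillemotleft>Box (\<sigma> B A)\<guillemotright> = \<guillemotleft>HId (A \<odot> B)\<guillemotright>"
  by (simp add: vseq_box braid_symmetric box_idt base_simps)

lemma hseq_hid: "A \<in> obj C \<Longrightarrow> B \<in> obj C \<Longrightarrow> \<guillemotleft>HId A\<guillemotright> \<interleave> \<guillemotleft>HId B\<guillemotright> = \<guillemotleft>HId (A \<odot> B)\<guillemotright>"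
  using hpol_hid[of A B White] by simp

lemma hseq_yank:
  "A \<in> obj C \<Longrightarrow> \<guillemotleft>SW A\<guillemotright> \<interleave> \<guillemotleft>RW A\<guillemotright> = \<guillemotleft>HId A\<guillemotright>" "A \<in> obj C \<Longrightarrow> \<guillemotleft>RB A\<guillemotright> \<interleave> \<guillemotleft>SB A\<guillemotright> = \<guillemotleft>HId A\<guillemotright>"
  using hpol_yank[of A White] hpol_yank[of A Black] by simp_all

lemma vseq_hid_ext:
  "wf_cell C a \<Longrightarrow> A = ttop C a \<Longrightarrow> \<guillemotleft>HId A\<guillemotright> \<Sslash> \<guillemotleft>a\<guillemotright> \<Sslash> K = \<guillemotleft>a\<guillemotright> \<Sslash> K"
  "wf_cell C (a \<parallel> b) \<Longrightarrow> A = ttop C a \<odot> ttop C b \<Longrightarrow> \<guillemotleft>HId A\<guillemotright> \<Sslash> (\<guillemotleft>a\<guillemotright> \<interleave> \<guillemotleft>b\<guillemotright>) \<Sslash> K = (\<guillemotleft>a\<guillemotright> \<interleave> \<guillemotleft>b\<guillemotright>) \<Sslash> K"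
  "wf_cell C (a \<parallel> b) \<Longrightarrow> A = tbot C a \<odot> tbot C b \<Longrightarrow> (\<guillemotleft>a\<guillemotright> \<interleave> \<guillemotleft>b\<guillemotright>) \<Sslash> \<guillemotleft>HId A\<guillemotright> = \<guillemotleft>a\<guillemotright> \<interleave> \<guillemotleft>b\<guillemotright>"
  using vseq_hid(1)[of a A] vseq_hid_h[of a b A] vseq_hid(2)[of "a \<parallel> b" A]
  by (simp_all add: ccls_h flip: vseq_assoc)

text \<open>A crossing consists of two corners with a braiding between them. The neighbouring corner
  yanks against one of the two; the braiding and the other corner remain.\<close>

lemma crossing_corner:
  assumes "A \<in> obj C" "B \<in> obj C"
  shows "\<guillemotleft>SW B\<guillemotright> \<interleave> \<guillemotleft>crossing1 A (B, White)\<guillemotright> = \<guillemotleft>Box (\<sigma> B A)\<guillemotright> \<Sslash> (\<guillemotleft>HId A\<guillemotright> \<interleave> \<guillemotleft>SW B\<guillemotright>)"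
    "\<guillemotleft>crossing1 A (B, White)\<guillemotright> \<interleave> \<guillemotleft>RW B\<guillemotright> = (\<guillemotleft>RW B\<guillemotright> \<interleave> \<guillemotleft>HId A\<guillemotright>) \<Sslash> \<guillemotleft>Box (\<sigma> B A)\<guillemotright>"
    "\<guillemotleft>crossing1 A (B, Black)\<guillemotright> \<interleave> \<guillemotleft>SB B\<guillemotright> = \<guillemotleft>Box (\<sigma> A B)\<guillemotright> \<Sslash> (\<guillemotleft>SB B\<guillemotright> \<interleave> \<guillemotleft>HId A\<guillemotright>)"
    "\<guillemotleft>RB B\<guillemotright> \<interleave> \<guillemotleft>crossing1 A (B, Black)\<guillemotright> = (\<guillemotleft>HId A\<guillemotright> \<interleave> \<guillemotleft>RB B\<guillemotright>) \<Sslash> \<guillemotleft>Box (\<sigma> A B)\<guillemotright>"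
proof -
  note s = assms base_simps hseq_hid_unit vseq_hid hseq_hid vseq_hid_ext vseq_hid_h
  let ?I = "HId (ounit C)"
  have "(\<guillemotleft>SW B\<guillemotright> \<Sslash> \<guillemotleft>?I\<guillemotright> \<Sslash> \<guillemotleft>?I\<guillemotright>) \<interleave> (\<guillemotleft>RW B \<parallel> HId A\<guillemotright> \<Sslash> \<guillemotleft>Box (\<sigma> B A)\<guillemotright> \<Sslash> \<guillemotleft>HId A \<parallel> SW B\<guillemotright>)
    = (\<guillemotleft>SW B\<guillemotright> \<interleave> \<guillemotleft>RW B \<parallel> HId A\<guillemotright>) \<Sslash> (\<guillemotleft>?I\<guillemotright> \<interleave> \<guillemotleft>Box (\<sigma> B A)\<guillemotright>) \<Sslash> (\<guillemotleft>?I\<guillemotright> \<interleave> \<guillemotleft>HId A \<parallel> SW B\<guillemotright>)"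
    by (rule hseq_interchange3) (simp_all add: s)
  then show "\<guillemotleft>SW B\<guillemotright> \<interleave> \<guillemotleft>crossing1 A (B, White)\<guillemotright> = \<guillemotleft>Box (\<sigma> B A)\<guillemotright> \<Sslash> (\<guillemotleft>HId A\<guillemotright> \<interleave> \<guillemotleft>SW B\<guillemotright>)"
    by (simp add: s crossing1_def ccls_push hseq_yank[THEN hseq_ext] hseq_hid_unit[THEN hseq_ext])
  have "(\<guillemotleft>RW B \<parallel> HId A\<guillemotright> \<Sslash> \<guillemotleft>Box (\<sigma> B A)\<guillemotright> \<Sslash> \<guillemotleft>HId A \<parallel> SW B\<guillemotright>) \<interleave> (\<guillemotleft>?I\<guillemotright> \<Sslash> \<guillemotleft>?I\<guillemotright> \<Sslash> \<guillemotleft>RW B\<guillemotright>)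
    = (\<guillemotleft>RW B \<parallel> HId A\<guillemotright> \<interleave> \<guillemotleft>?I\<guillemotright>) \<Sslash> (\<guillemotleft>Box (\<sigma> B A)\<guillemotright> \<interleave> \<guillemotleft>?I\<guillemotright>) \<Sslash> (\<guillemotleft>HId A \<parallel> SW B\<guillemotright> \<interleave> \<guillemotleft>RW B\<guillemotright>)"
    by (rule hseq_interchange3) (simp_all add: s)
  then show "\<guillemotleft>crossing1 A (B, White)\<guillemotright> \<interleave> \<guillemotleft>RW B\<guillemotright> = (\<guillemotleft>RW B\<guillemotright> \<interleave> \<guillemotleft>HId A\<guillemotright>) \<Sslash> \<guillemotleft>Box (\<sigma> B A)\<guillemotright>"
    by (simp add: s crossing1_def ccls_push hseq_yank)
  have "(\<guillemotleft>HId A \<parallel> RB B\<guillemotright> \<Sslash> \<guillemotleft>Box (\<sigma> A B)\<guillemotright> \<Sslash> \<guillemotleft>SB B \<parallel> HId A\<guillemotright>) \<interleave> (\<guillemotleft>SB B\<guillemotright> \<Sslash> \<guillemotleft>?I\<guillemotright> \<Sslash> \<guillemotleft>?I\<guillemotright>)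
    = (\<guillemotleft>HId A \<parallel> RB B\<guillemotright> \<interleave> \<guillemotleft>SB B\<guillemotright>) \<Sslash> (\<guillemotleft>Box (\<sigma> A B)\<guillemotright> \<interleave> \<guillemotleft>?I\<guillemotright>) \<Sslash> (\<guillemotleft>SB B \<parallel> HId A\<guillemotright> \<interleave> \<guillemotleft>?I\<guillemotright>)"
    by (rule hseq_interchange3) (simp_all add: s)
  then show "\<guillemotleft>crossing1 A (B, Black)\<guillemotright> \<interleave> \<guillemotleft>SB B\<guillemotright> = \<guillemotleft>Box (\<sigma> A B)\<guillemotright> \<Sslash> (\<guillemotleft>SB B\<guillemotright> \<interleave> \<guillemotleft>HId A\<guillemotright>)"
    by (simp add: s crossing1_def ccls_push hseq_yank)
  have "(\<guillemotleft>?I\<guillemotright> \<Sslash> \<guillemotleft>?I\<guillemotright> \<Sslash> \<guillemotleft>RB B\<guillemotright>) \<interleave> (\<guillemotleft>HId A \<parallel> RB B\<guillemotright> \<Sslash> \<guillemotleft>Box (\<sigma> A B)\<guillemotright> \<Sslash> \<guillemotleft>SB B \<parallel> HId A\<guillemotright>)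
    = (\<guillemotleft>?I\<guillemotright> \<interleave> \<guillemotleft>HId A \<parallel> RB B\<guillemotright>) \<Sslash> (\<guillemotleft>?I\<guillemotright> \<interleave> \<guillemotleft>Box (\<sigma> A B)\<guillemotright>) \<Sslash> (\<guillemotleft>RB B\<guillemotright> \<interleave> \<guillemotleft>SB B \<parallel> HId A\<guillemotright>)"
    by (rule hseq_interchange3) (simp_all add: s)
  then show "\<guillemotleft>RB B\<guillemotright> \<interleave> \<guillemotleft>crossing1 A (B, Black)\<guillemotright> = (\<guillemotleft>HId A\<guillemotright> \<interleave> \<guillemotleft>RB B\<guillemotright>) \<Sslash> \<guillemotleft>Box (\<sigma> A B)\<guillemotright>"
    by (simp add: s crossing1_def ccls_push hseq_yank[THEN hseq_ext] hseq_hid_unit[THEN hseq_ext])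
qed

text \<open>Naturality of the braiding, extended from boxes to all cells by induction. Corners
  reduce to yanking and symmetry of the braiding, horizontal composites to a hexagon, and vertical
  composites to the fact that crossings of a concatenated word stack.\<close>

lemma crossing_natural:
  assumes "A \<in> obj C"
  shows "wf_cell C a \<Longrightarrow> (\<guillemotleft>crossing A (tleft a)\<guillemotright> \<interleave> \<guillemotleft>a\<guillemotright>) \<Sslash> \<guillemotleft>Box (\<sigma> A (tbot C a))\<guillemotright>
    = \<guillemotleft>Box (\<sigma> A (ttop C a))\<guillemotright> \<Sslash> (\<guillemotleft>a\<guillemotright> \<interleave> \<guillemotleft>crossing A (tright a)\<guillemotright>)"
proof (induction a)
  case (HId P)
  then show ?case using assms by (simp add: hseq_hid vseq_hid base_simps)
next
  case (VId X)
  then show ?case using assms by (simp add: hseq_vid braid_unit box_idt vseq_hid)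
next
  case (SW B)
  then show ?case using assms
    by (simp add: braid_unit box_idt vseq_hid vseq_hid_ext crossing_corner vseq_braid[THEN vseq_ext] vseq_hid_h base_simps ccls_push)
next
  case (RW B)
  then show ?case using assms
    by (simp add: braid_unit box_idt vseq_hid vseq_hid_ext crossing_corner vseq_braid vseq_hid_h base_simps ccls_push)
next
  case (SB B)
  then show ?case using assms
    by (simp add: braid_unit box_idt vseq_hid vseq_hid_ext crossing_corner vseq_braid[THEN vseq_ext] vseq_hid_h base_simps ccls_push)
next
  case (RB B)
  then show ?case using assms
    by (simp add: braid_unit box_idt vseq_hid vseq_hid_ext crossing_corner vseq_braid vseq_hid_h base_simps ccls_push)
next
  case (Box f)
  then show ?case using assms braid_natural[of "idt C A" f] hpol_box[of "idt C A" f White] hpol_box[of f "idt C A" White]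
    by (simp add: box_idt vseq_box base_simps)
next
  case (HComp a b)
  let ?c = "crossing A"
  note s = assms HComp.prems base_simps
  \<comment> \<open>By the hexagon the wire crosses the two factors of a product edge one after the
    other, so the hypothesis for \<open>a\<close> can be used first and the one for \<open>b\<close>
    afterwards.\<close>
  have 1: "\<guillemotleft>Box (\<sigma> A (tbot C a \<odot> tbot C b))\<guillemotright> = (\<guillemotleft>Box (\<sigma> A (tbot C a))\<guillemotright> \<interleave> \<guillemotleft>HId (tbot C b)\<guillemotright>)
     \<Sslash> (\<guillemotleft>HId (tbot C a)\<guillemotright> \<interleave> \<guillemotleft>Box (\<sigma> A (tbot C b))\<guillemotright>)"
    using s hpol_box[of "\<sigma> A (tbot C a)" "idt C (tbot C b)" White] hpol_box[of "idt C (tbot C a)" "\<sigma> A (tbot C b)" White]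
    by (simp add: braid_hexagon1 vseq_box box_idt flip: vseq_box)
  have 2: "\<guillemotleft>Box (\<sigma> A (ttop C a \<odot> ttop C b))\<guillemotright> = (\<guillemotleft>Box (\<sigma> A (ttop C a))\<guillemotright> \<interleave> \<guillemotleft>HId (ttop C b)\<guillemotright>)
     \<Sslash> (\<guillemotleft>HId (ttop C a)\<guillemotright> \<interleave> \<guillemotleft>Box (\<sigma> A (ttop C b))\<guillemotright>)"
    using s hpol_box[of "\<sigma> A (ttop C a)" "idt C (ttop C b)" White] hpol_box[of "idt C (ttop C a)" "\<sigma> A (ttop C b)" White]
    by (simp add: braid_hexagon1 vseq_box box_idt flip: vseq_box)
  have 3: "(\<guillemotleft>?c (tleft a)\<guillemotright> \<interleave> \<guillemotleft>a\<guillemotright> \<interleave> \<guillemotleft>b\<guillemotright>) \<Sslash> (\<guillemotleft>Box (\<sigma> A (tbot C a))\<guillemotright> \<interleave> \<guillemotleft>HId (tbot C b)\<guillemotright>)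
    = ((\<guillemotleft>?c (tleft a)\<guillemotright> \<interleave> \<guillemotleft>a\<guillemotright>) \<Sslash> \<guillemotleft>Box (\<sigma> A (tbot C a))\<guillemotright>) \<interleave> \<guillemotleft>b\<guillemotright>"
    using s hpol_interchange[of "?c (tleft a) \<parallel> a" "Box (\<sigma> A (tbot C a))" b "HId (tbot C b)" White]
    by (simp add: ccls_push vseq_hid)
  have 4: "(\<guillemotleft>Box (\<sigma> A (ttop C a))\<guillemotright> \<Sslash> (\<guillemotleft>a\<guillemotright> \<interleave> \<guillemotleft>?c (tright a)\<guillemotright>)) \<interleave> \<guillemotleft>b\<guillemotright>
    = (\<guillemotleft>Box (\<sigma> A (ttop C a))\<guillemotright> \<interleave> \<guillemotleft>HId (ttop C b)\<guillemotright>) \<Sslash> (\<guillemotleft>a\<guillemotright> \<interleave> \<guillemotleft>?c (tright a)\<guillemotright> \<interleave> \<guillemotleft>b\<guillemotright>)"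
    using s hpol_interchange[of "Box (\<sigma> A (ttop C a))" "a \<parallel> ?c (tright a)" "HId (ttop C b)" b White]
    by (simp add: ccls_push vseq_hid)
  have 5: "(\<guillemotleft>a\<guillemotright> \<interleave> \<guillemotleft>?c (tright a)\<guillemotright> \<interleave> \<guillemotleft>b\<guillemotright>) \<Sslash> (\<guillemotleft>HId (tbot C a)\<guillemotright> \<interleave> \<guillemotleft>Box (\<sigma> A (tbot C b))\<guillemotright>)
    = \<guillemotleft>a\<guillemotright> \<interleave> ((\<guillemotleft>?c (tright a)\<guillemotright> \<interleave> \<guillemotleft>b\<guillemotright>) \<Sslash> \<guillemotleft>Box (\<sigma> A (tbot C b))\<guillemotright>)"
    using s hpol_interchange[of a "HId (tbot C a)" "?c (tright a) \<parallel> b" "Box (\<sigma> A (tbot C b))" White]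
    by (simp add: ccls_push vseq_hid)
  have 6: "\<guillemotleft>a\<guillemotright> \<interleave> (\<guillemotleft>Box (\<sigma> A (ttop C b))\<guillemotright> \<Sslash> (\<guillemotleft>b\<guillemotright> \<interleave> \<guillemotleft>?c (tright b)\<guillemotright>))
    = (\<guillemotleft>HId (ttop C a)\<guillemotright> \<interleave> \<guillemotleft>Box (\<sigma> A (ttop C b))\<guillemotright>) \<Sslash> (\<guillemotleft>a\<guillemotright> \<interleave> \<guillemotleft>b\<guillemotright> \<interleave> \<guillemotleft>?c (tright b)\<guillemotright>)"
    using s hpol_interchange[of "HId (ttop C a)" a "Box (\<sigma> A (ttop C b))" "b \<parallel> ?c (tright b)" White]
    by (simp add: ccls_push vseq_hid)
  have "(\<guillemotleft>?c (tleft a)\<guillemotright> \<interleave> \<guillemotleft>a\<guillemotright> \<interleave> \<guillemotleft>b\<guillemotright>) \<Sslash> \<guillemotleft>Box (\<sigma> A (tbot C a \<odot> tbot C b))\<guillemotright>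
    = \<guillemotleft>Box (\<sigma> A (ttop C a \<odot> ttop C b))\<guillemotright> \<Sslash> (\<guillemotleft>a\<guillemotright> \<interleave> \<guillemotleft>b\<guillemotright> \<interleave> \<guillemotleft>?c (tright b)\<guillemotright>)"
  proof -
    have ih: "(\<guillemotleft>?c (tleft a)\<guillemotright> \<interleave> \<guillemotleft>a\<guillemotright>) \<Sslash> \<guillemotleft>Box (\<sigma> A (tbot C a))\<guillemotright> = \<guillemotleft>Box (\<sigma> A (ttop C a))\<guillemotright> \<Sslash> (\<guillemotleft>a\<guillemotright> \<interleave> \<guillemotleft>?c (tright a)\<guillemotright>)"
      "(\<guillemotleft>?c (tright a)\<guillemotright> \<interleave> \<guillemotleft>b\<guillemotright>) \<Sslash> \<guillemotleft>Box (\<sigma> A (tbot C b))\<guillemotright> = \<guillemotleft>Box (\<sigma> A (ttop C b))\<guillemotright> \<Sslash> (\<guillemotleft>b\<guillemotright> \<interleave> \<guillemotleft>?c (tright b)\<guillemotright>)"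
      using HComp by simp_all
    show ?thesis
      by (simp only: 1 2 3[unfolded ih(1) 4, THEN vseq_ext] 5[unfolded ih(2) 6] vseq_assoc)
  qed
  then show ?case by (simp add: ccls_push)
next
  case (VComp a b)
  let ?c = "crossing A"
  note s = assms VComp.prems base_simps
  have "\<guillemotleft>?c (tleft a @ tleft b)\<guillemotright> \<interleave> \<guillemotleft>a \<div> b\<guillemotright> = (\<guillemotleft>?c (tleft a)\<guillemotright> \<interleave> \<guillemotleft>a\<guillemotright>) \<Sslash> (\<guillemotleft>?c (tleft b)\<guillemotright> \<interleave> \<guillemotleft>b\<guillemotright>)"
    using s hpol_interchange[of "?c (tleft a)" "?c (tleft b)" a b White] by (simp add: ccls_push crossing_append)
  moreover have "\<guillemotleft>a \<div> b\<guillemotright> \<interleave> \<guillemotleft>?c (tright a @ tright b)\<guillemotright> = (\<guillemotleft>a\<guillemotright> \<interleave> \<guillemotleft>?c (tright a)\<guillemotright>) \<Sslash> (\<guillemotleft>b\<guillemotright> \<interleave> \<guillemotleft>?c (tright b)\<guillemotright>)"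
    using s hpol_interchange[of a b "?c (tright a)" "?c (tright b)" White] by (simp add: ccls_push crossing_append)
  moreover have "(\<guillemotleft>?c (tleft a)\<guillemotright> \<interleave> \<guillemotleft>a\<guillemotright>) \<Sslash> (\<guillemotleft>?c (tleft b)\<guillemotright> \<interleave> \<guillemotleft>b\<guillemotright>) \<Sslash> \<guillemotleft>Box (\<sigma> A (tbot C b))\<guillemotright>
    = \<guillemotleft>Box (\<sigma> A (ttop C a))\<guillemotright> \<Sslash> (\<guillemotleft>a\<guillemotright> \<interleave> \<guillemotleft>?c (tright a)\<guillemotright>) \<Sslash> (\<guillemotleft>b\<guillemotright> \<interleave> \<guillemotleft>?c (tright b)\<guillemotright>)"
  proof -
    have "(\<guillemotleft>?c (tleft a)\<guillemotright> \<interleave> \<guillemotleft>a\<guillemotright>) \<Sslash> (\<guillemotleft>?c (tleft b)\<guillemotright> \<interleave> \<guillemotleft>b\<guillemotright>) \<Sslash> \<guillemotleft>Box (\<sigma> A (tbot C b))\<guillemotright>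
      = (\<guillemotleft>?c (tleft a)\<guillemotright> \<interleave> \<guillemotleft>a\<guillemotright>) \<Sslash> \<guillemotleft>Box (\<sigma> A (tbot C a))\<guillemotright> \<Sslash> (\<guillemotleft>b\<guillemotright> \<interleave> \<guillemotleft>?c (tright b)\<guillemotright>)"
      using VComp by simp
    also have "\<dots> = ((\<guillemotleft>?c (tleft a)\<guillemotright> \<interleave> \<guillemotleft>a\<guillemotright>) \<Sslash> \<guillemotleft>Box (\<sigma> A (tbot C a))\<guillemotright>) \<Sslash> (\<guillemotleft>b\<guillemotright> \<interleave> \<guillemotleft>?c (tright b)\<guillemotright>)"
      by (simp only: vseq_assoc)
    also have "\<dots> = (\<guillemotleft>Box (\<sigma> A (ttop C a))\<guillemotright> \<Sslash> (\<guillemotleft>a\<guillemotright> \<interleave> \<guillemotleft>?c (tright a)\<guillemotright>)) \<Sslash> (\<guillemotleft>b\<guillemotright> \<interleave> \<guillemotleft>?c (tright b)\<guillemotright>)"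
      using VComp by simp
    finally show ?thesis by (simp only: vseq_assoc)
  qed
  ultimately show ?case by (simp add: vseq_assoc)
qed

text \<open>A cell with trivial boundary meets no crossing, so it can be moved across any wire.\<close>

lemma closed_commute:
  assumes "wf_cell C h" "tleft h = []" "tright h = []" "ttop C h = ounit C" "tbot C h = ounit C" "A \<in> obj C"
  shows "\<guillemotleft>HId A\<guillemotright> \<interleave> \<guillemotleft>h\<guillemotright> = \<guillemotleft>h\<guillemotright> \<interleave> \<guillemotleft>HId A\<guillemotright>"
  using crossing_natural[of A h] assms
  by (simp add: braid_unit box_idt vseq_hid_ext vseq_hid_h obj_closed)

text \<open>Yanking opens each letter of \<open>X\<close> into a wire between two corners. The cell
  \<open>h\<close> slips below the first corner on the far side of this wire, crosses to the near
  side by \<open>closed_commute\<close>, and leaves below the second corner.\<close>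

lemma closed_slide:
  assumes "wf_cell C h" "tleft h = []" "tright h = []" "ttop C h = ounit C" "tbot C h = ounit C" "X \<in> pwords C"
  shows "\<guillemotleft>h\<guillemotright> \<Sslash> \<guillemotleft>VId X\<guillemotright> = \<guillemotleft>VId X\<guillemotright> \<Sslash> \<guillemotleft>h\<guillemotright>"
  using assms(6)
proof (induction X)
  case Nil
  then show ?case using assms by (simp add: vseq_unit)
next
  case (Cons x X)
  obtain A p where x: "x = (A, p)" by (cases x)
  with Cons.prems have A: "A \<in> obj C" by simp
  have t: "near p h = []" "far p h = []" using assms by (cases p; simp)+
  have c: "hseq_pol p \<guillemotleft>h\<guillemotright> \<guillemotleft>HId A\<guillemotright> = hseq_pol p \<guillemotleft>HId A\<guillemotright> \<guillemotleft>h\<guillemotright>"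
    using closed_commute[OF assms(1-5) A] by (cases p) simp_all
  have r: "\<guillemotleft>h\<guillemotright> \<Sslash> \<guillemotleft>corner_in p A\<guillemotright> = \<guillemotleft>corner_in p A\<guillemotright> \<Sslash> hseq_pol p \<guillemotleft>HId A\<guillemotright> \<guillemotleft>h\<guillemotright>"
    using hpol_above[of "corner_in p A" h p] hpol_below[of "corner_in p A" h p] assms A t by (simp add: hpol_hid_unit)
  have s: "hseq_pol p \<guillemotleft>h\<guillemotright> \<guillemotleft>HId A\<guillemotright> \<Sslash> \<guillemotleft>corner_out p A\<guillemotright> = \<guillemotleft>corner_out p A\<guillemotright> \<Sslash> \<guillemotleft>h\<guillemotright>"
    using hpol_above[of h "corner_out p A" p] hpol_below[of h "corner_out p A" p] assms A t by (simp add: hpol_hid_unit)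
  have v: "\<guillemotleft>VId [x]\<guillemotright> = \<guillemotleft>corner_in p A\<guillemotright> \<Sslash> \<guillemotleft>corner_out p A\<guillemotright>" using vseq_yank[OF A] x by simp
  have "\<guillemotleft>h\<guillemotright> \<Sslash> \<guillemotleft>VId [x]\<guillemotright> = (\<guillemotleft>h\<guillemotright> \<Sslash> \<guillemotleft>corner_in p A\<guillemotright>) \<Sslash> \<guillemotleft>corner_out p A\<guillemotright>"
    by (simp only: v vseq_assoc)
  also have "\<dots> = \<guillemotleft>corner_in p A\<guillemotright> \<Sslash> hseq_pol p \<guillemotleft>h\<guillemotright> \<guillemotleft>HId A\<guillemotright> \<Sslash> \<guillemotleft>corner_out p A\<guillemotright>"
    by (simp only: r c vseq_assoc)
  also have "\<dots> = \<guillemotleft>VId [x]\<guillemotright> \<Sslash> \<guillemotleft>h\<guillemotright>" by (simp only: s v vseq_assoc)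
  finally have h: "\<guillemotleft>h\<guillemotright> \<Sslash> \<guillemotleft>VId [x]\<guillemotright> = \<guillemotleft>VId [x]\<guillemotright> \<Sslash> \<guillemotleft>h\<guillemotright>" .
  have e: "\<guillemotleft>VId (x # X)\<guillemotright> = \<guillemotleft>VId [x]\<guillemotright> \<Sslash> \<guillemotleft>VId X\<guillemotright>"
    using Cons.prems vseq_vid[of "[x]" X] by simp
  show ?case using Cons by (simp add: e vseq_assoc h[THEN vseq_ext])
qed

section \<open>Drawing respects the equations between arrows\<close>

declare horiz.simps [simp del]

theorem horiz_sound: "t_eq C t u \<Longrightarrow> \<guillemotleft>horiz t\<guillemotright> = \<guillemotleft>horiz u\<guillemotright>"
proof (induction rule: t_eq.induct)
  case (t_seq_cong t t' u u')
  then show ?case by (simp add: horiz_push)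
next
  case (t_ten_cong t t' u u')
  then show ?case by (simp add: horiz_push)
next
  case (t_id_seq t)
  then show ?case using hpol_vid(1)[of "horiz t" _ White] by (simp add: horiz_push)
next
  case (t_seq_id t)
  then show ?case using hpol_vid(2)[of "horiz t" _ White] by (simp add: horiz_push)
next
  case (t_seq_assoc t u v)
  then show ?case by (simp add: horiz_push hseq_assoc)
next
  case (t_ten_id X Y)
  then show ?case by (simp add: horiz_push vseq_vid)
next
  case (t_interchange t u v w)
  then show ?case using hpol_interchange[of "horiz t" "horiz v" "horiz u" "horiz w" White] by (simp add: horiz_push)
next
  case (t_ten_assoc t u v)
  then show ?case by (simp add: horiz_push vseq_assoc)
next
  case (t_unit_ten t)
  then show ?case by (simp add: horiz_push vseq_unit)
next
  case (t_ten_unit t)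
  then show ?case by (simp add: horiz_push vseq_unit)
next
  case (t_split_merge A B p)
  \<comment> \<open>Each side becomes a single \<open>via\<close> cell between the same words, and
    \<open>base_calc\<close> identifies the two arrows of C. The other equations within one colour
    follow the same pattern.\<close>
  then show ?case by (cases p; simp add: horiz_push via_calc vid_nil[of p] typed_def base_calc)
next
  case (t_merge_split A B p)
  then show ?case by (cases p; simp add: horiz_push via_calc vid_nil[of p] typed_def base_calc)
next
  case (t_merge_assoc A B D p)
  then show ?case by (cases p; simp add: horiz_push via_calc vid_nil[of p] typed_def base_calc)
next
  case (t_split_assoc A B D p)
  then show ?case by (cases p; simp add: horiz_push via_calc vid_nil[of p] typed_def base_calc)
next
  case (t_iota_kappa p)
  then show ?case by (cases p; simp add: horiz_push via_calc vid_nil[of p] typed_def base_calc)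
next
  case (t_kappa_iota p)
  then show ?case by (cases p; simp add: horiz_push via_calc vid_nil[of p] typed_def base_calc)
next
  case (t_iota_merge_left A p)
  then show ?case by (cases p; simp add: horiz_push via_calc vid_nil[of p] typed_def base_calc)
next
  case (t_iota_merge_right A p)
  then show ?case by (cases p; simp add: horiz_push via_calc vid_nil[of p] typed_def base_calc)
next
  case (t_split_kappa_left A p)
  then show ?case by (cases p; simp add: horiz_push via_calc vid_nil[of p] typed_def base_calc)
next
  case (t_split_kappa_right A p)
  then show ?case by (cases p; simp add: horiz_push via_calc vid_nil[of p] typed_def base_calc)
next
  case (t_iota_split p)
  then show ?case by (cases p; simp add: horiz_push via_calc vid_nil[of p] typed_def base_calc)
next
  case (t_merge_kappa p)
  then show ?case by (cases p; simp add: horiz_push via_calc vid_nil[of p] typed_def base_calc)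
next
  case (t_nat_white_left f D)
  then show ?case using braid_natural[of f "idt C D"] braid_natural[of "idt C D" f]
    by (simp add: horiz_push via_calc typed_def base_calc)
next
  case (t_nat_white_right f D)
  then show ?case using braid_natural[of f "idt C D"] braid_natural[of "idt C D" f]
    by (simp add: horiz_push via_calc typed_def base_calc)
next
  case (t_nat_black_left f D)
  then show ?case using braid_natural[of f "idt C D"] braid_natural[of "idt C D" f]
    by (simp add: horiz_push via_calc typed_def base_calc)
next
  case (t_nat_black_right f D)
  then show ?case using braid_natural[of f "idt C D"] braid_natural[of "idt C D" f]
    by (simp add: horiz_push via_calc typed_def base_calc)
next
  case (t_merge_sigma_left A B D p)
  then show ?case by (cases p; simp add: horiz_push via_calc vid_nil[of p] typed_def base_calc)
next
  case (t_merge_sigma_right A B D p)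
  then show ?case by (cases p; simp add: horiz_push via_calc vid_nil[of p] typed_def base_calc)
next
  case (t_sigma_split_left A B D p)
  then show ?case by (cases p; simp add: horiz_push via_calc vid_nil[of p] typed_def base_calc)
next
  case (t_sigma_split_right A B D p)
  then show ?case by (cases p; simp add: horiz_push via_calc vid_nil[of p] typed_def base_calc)
next
  case (t_iota_sigma_left A p)
  then show ?case by (cases p; simp add: horiz_push via_calc vid_nil[of p] typed_def base_calc)
next
  case (t_iota_sigma_right A p)
  then show ?case by (cases p; simp add: horiz_push via_calc vid_nil[of p] typed_def base_calc)
next
  case (t_sigma_kappa_left A p)
  then show ?case by (cases p; simp add: horiz_push via_calc vid_nil[of p] typed_def base_calc)
next
  case (t_sigma_kappa_right A p)
  then show ?case by (cases p; simp add: horiz_push via_calc vid_nil[of p] typed_def base_calc)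
next
  case (t_eta_dinat f)
  \<comment> \<open>For equations mixing the colours, each side becomes a single cup or cap and
    again only the arrows have to be compared.\<close>
  then show ?case by (simp add: horiz_push horiz_eta horiz_nest cup_absorb cap_absorb via_calc typed_def base_calc)
next
  case (t_eps_dinat f)
  then show ?case by (simp add: horiz_push horiz_eta horiz_nest cup_absorb cap_absorb via_calc typed_def base_calc)
next
  case (t_eta_sigma A B)
  then show ?case by (simp add: horiz_push horiz_eta horiz_nest cup_absorb cap_absorb via_calc typed_def base_calc)
next
  case (t_sigma_eps A B)
  then show ?case by (simp add: horiz_push horiz_eta horiz_nest cup_absorb cap_absorb via_calc typed_def base_calc)
next
  case (t_eta_split_black A B)
  then show ?case by (simp add: horiz_push horiz_eta horiz_nest cup_absorb cap_absorb via_calc typed_def base_calc)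
next
  case (t_eta_split_white A B)
  then show ?case by (simp add: horiz_push horiz_eta horiz_nest cup_absorb cap_absorb via_calc typed_def base_calc)
next
  case (t_merge_white_eps A B)
  \<comment> \<open>The cap is the last factor of a left-nested composite; reassociating lets it
    absorb the preceding cells one at a time.\<close>
  then show ?case by (simp add: hseq_assoc horiz_push horiz_eta horiz_nest cup_absorb cap_absorb via_calc typed_def base_calc)
next
  case (t_merge_black_eps A B)
  then show ?case by (simp add: hseq_assoc horiz_push horiz_eta horiz_nest cup_absorb cap_absorb via_calc typed_def base_calc)
next
  case (t_map_white_seq f g)
  then show ?case by (simp add: horiz_push via_calc typed_def base_calc)
next
  case (t_map_white_ten f g)
  then show ?case using braid_conj[of f g] by (simp add: horiz_push via_calc typed_def base_calc)
next
  case (t_map_white_idt A)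
  then show ?case by (simp add: horiz_push via_calc typed_def base_calc)
next
  case (t_map_white_braid A B)
  then show ?case by (simp add: horiz_push via_calc typed_def base_calc)
next
  case (t_map_black_seq f g)
  then show ?case by (simp add: horiz_push via_calc typed_def base_calc)
next
  case (t_map_black_ten f g)
  then show ?case by (simp add: horiz_push via_calc typed_def base_calc)
next
  case (t_map_black_idt A)
  then show ?case by (simp add: horiz_push via_calc typed_def base_calc)
next
  case (t_map_black_braid A B)
  then show ?case by (simp add: horiz_push via_calc typed_def base_calc)
next
  case (t_snake_white A)
  \<comment> \<open>In three layers the middle one is the black horizontal yank. It leaves a wire
    between two white corners, which the white vertical yank removes; the other snake exchanges the
    colours.\<close>
  have "(\<guillemotleft>VId (A\<^sup>\<circ>)\<guillemotright> \<Sslash> \<guillemotleft>RB A\<guillemotright> \<Sslash> \<guillemotleft>SW A\<guillemotright>) \<interleave> (\<guillemotleft>RW A\<guillemotright> \<Sslash> \<guillemotleft>SB A\<guillemotright> \<Sslash> \<guillemotleft>VId (A\<^sup>\<circ>)\<guillemotright>) = \<guillemotleft>VId (A\<^sup>\<circ>)\<guillemotright>"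
    using t_snake_white hpol_yank[of A Black] vseq_yank[of A White]
    by (subst hseq_interchange3) (simp_all add: hseq_vid vseq_hid)
  with t_snake_white show ?case by (simp add: horiz_push horiz.simps vseq_assoc)
next
  case (t_snake_black A)
  have "(\<guillemotleft>RB A\<guillemotright> \<Sslash> \<guillemotleft>SW A\<guillemotright> \<Sslash> \<guillemotleft>VId (A\<^sup>\<bullet>)\<guillemotright>) \<interleave> (\<guillemotleft>VId (A\<^sup>\<bullet>)\<guillemotright> \<Sslash> \<guillemotleft>RW A\<guillemotright> \<Sslash> \<guillemotleft>SB A\<guillemotright>) = \<guillemotleft>VId (A\<^sup>\<bullet>)\<guillemotright>"
    using t_snake_black hpol_yank[of A White] vseq_yank[of A Black]
    by (subst hseq_interchange3) (simp_all add: hseq_vid vseq_hid)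
  with t_snake_black show ?case by (simp add: horiz_push horiz.simps vseq_assoc)
next
  case (t_spatial h X)
  then show ?case by (simp add: horiz_push closed_slide)
qed simp_all


section \<open>The translations are mutually inverse\<close>

abbreviation "kap \<equiv> \<langle>Kappa White\<rangle>"
abbreviation "iot \<equiv> \<langle>Iota White\<rangle>"

definition "straight t \<longleftrightarrow> \<langle>bend (horiz t)\<rangle> = (kap \<boxtimes> \<^bold>1 (tdom C t)) \<rhd> \<langle>t\<rangle> \<rhd> (\<^bold>1 (tcod C t) \<boxtimes> iot)"

lemma straight_seq:
  assumes "wf_t C (t ;; u)" "straight t" "straight u"
  shows "straight (t ;; u)"
proof -
  have w: "wf_t C t" "wf_t C u" "tcod C t = tdom C u" using assms(1) by auto
  note p = wf_t_boundaries[OF w(1)] wf_t_boundaries[OF w(2)]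
  let ?I = "[(ounit C, White)]"
  \<comment> \<open>Over the unit object, splitting and joining each have two descriptions. The ones
    chosen create the new unit letter on the right and delete the left one, which is where the
    \<kappa> of \<open>t\<close> and the \<iota> of \<open>u\<close> are waiting to cancel.\<close>
  have uj: "\<langle>Unjoin (ounit C) (ounit C)\<rangle> = \<^bold>1 ?I \<boxtimes> iot" "\<langle>Join (ounit C) (ounit C)\<rangle> = kap \<boxtimes> \<^bold>1 ?I"
    using unjoin_unit(1)[of "ounit C"] join_unit(2)[of "ounit C"] by simp_all
  have "\<langle>bend (horiz (t ;; u))\<rangle> = \<^bold>1 ?I \<boxtimes> \<langle>t\<rangle> \<rhd> (\<^bold>1 (?I @ tdom C u) \<boxtimes> iot \<rhd> kap \<boxtimes> \<^bold>1 (tdom C u @ ?I)) \<rhd> \<langle>u\<rangle> \<boxtimes> \<^bold>1 ?I"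
    using w p assms(2,3) by (simp add: horiz_push straight_def bend_norm horiz.simps uj iota_kappa_whisker id_elim)
  also have "\<^bold>1 (?I @ tdom C u) \<boxtimes> iot \<rhd> kap \<boxtimes> \<^bold>1 (tdom C u @ ?I) = kap \<boxtimes> \<^bold>1 (tdom C u) \<rhd> \<^bold>1 (tdom C u) \<boxtimes> iot"
    using slide[of "Kappa White" "Iota White" "[]" "tdom C u" "[]", simplified strict] by (simp add: strict)
  also have "\<^bold>1 ?I \<boxtimes> \<langle>t\<rangle> \<rhd> (kap \<boxtimes> \<^bold>1 (tdom C u) \<rhd> \<^bold>1 (tdom C u) \<boxtimes> iot) \<rhd> \<langle>u\<rangle> \<boxtimes> \<^bold>1 ?I
    = (\<^bold>1 ?I \<boxtimes> \<langle>t\<rangle> \<rhd> kap \<boxtimes> \<^bold>1 (tdom C u)) \<rhd> (\<^bold>1 (tdom C u) \<boxtimes> iot \<rhd> \<langle>u\<rangle> \<boxtimes> \<^bold>1 ?I)"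
    by (simp only: tseq_assoc)
  also have "\<dots> = (kap \<boxtimes> \<^bold>1 (tdom C t) \<rhd> \<langle>t\<rangle>) \<rhd> (\<langle>u\<rangle> \<rhd> \<^bold>1 (tcod C u) \<boxtimes> iot)"
    using slide[of "Kappa White" t "[]" "[]" "[]", simplified strict] slide[of u "Iota White" "[]" "[]" "[]", simplified strict] w
    by (simp add: unit_ten)
  finally show ?thesis by (simp add: straight_def tcls_seq tseq_assoc)
qed

lemma straight_ten:
  assumes "wf_t C (t \<star> u)" "straight t" "straight u"
  shows "straight (t \<star> u)"
proof -
  have w: "wf_t C t" "wf_t C u" using assms(1) by auto
  note p = wf_t_boundaries[OF w(1)] wf_t_boundaries[OF w(2)]
  have "\<langle>t\<rangle> \<boxtimes> \<langle>u\<rangle> = \<langle>t\<rangle> \<boxtimes> \<^bold>1 (tdom C u) \<rhd> \<^bold>1 (tcod C t) \<boxtimes> \<langle>u\<rangle>"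
    using exchange(2)[OF thom_cls[OF w(1)] thom_cls[OF w(2)]] by simp
  then show ?thesis
    using w p assms(2,3) by (simp add: straight_def bend_norm horiz.simps iota_kappa_whisker id_elim)
qed

text \<open>By soundness of both translations the property depends only on the class of the arrow. A
  generator may therefore be replaced by an equal composite of generators already treated.\<close>

lemma straight_transport:
  assumes "t_eq C t u" "straight t"
  shows "straight u"
proof -
  have "\<guillemotleft>horiz t\<guillemotright> = \<guillemotleft>horiz u\<guillemotright>" using assms(1) by (rule horiz_sound)
  then have "cell_eq C (horiz t) (horiz u)"
    using t_eq_wf[OF assms(1)] eq_equiv_class[OF _ equiv_cell, of "horiz t" "horiz u"]
    by (simp add: cell_rel_iff)
  then have "\<langle>bend (horiz t)\<rangle> = \<langle>bend (horiz u)\<rangle>" by (rule bend_sound)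
  then show ?thesis using assms t_class_eq[OF assms(1)] t_eq_wf[OF assms(1)] by (simp add: straight_def)
qed

lemma straight_id: "X \<in> pwords C \<Longrightarrow> straight (\<one>\<^sub>T X)"
  by (simp add: straight_def horiz.simps bend_norm id_elim)

text \<open>The unit letter is isomorphic to the empty word: inserting it with \<iota> before
  \<open>S\<close> and deleting it with \<kappa> afterwards recovers \<open>S\<close>.\<close>

lemma ten_unit_cancel:
  assumes "S \<in> thom X Y" "T \<in> thom X Y" "S \<boxtimes> \<^bold>1 [(ounit C, p)] = T \<boxtimes> \<^bold>1 [(ounit C, p)]"
  shows "S = T"
proof -
  have "(\<^bold>1 X \<boxtimes> \<langle>Iota p\<rangle>) \<rhd> (R \<boxtimes> \<^bold>1 [(ounit C, p)]) \<rhd> (\<^bold>1 Y \<boxtimes> \<langle>Kappa p\<rangle>) = R" if R: "R \<in> thom X Y" for R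
  proof -
    have i: "\<langle>Iota p\<rangle> \<in> thom [] [(ounit C, p)]" by (rule thom_gen) simp_all
    have "(\<^bold>1 X \<boxtimes> \<langle>Iota p\<rangle>) \<rhd> (R \<boxtimes> \<^bold>1 [(ounit C, p)]) = R \<rhd> (\<^bold>1 Y \<boxtimes> \<langle>Iota p\<rangle>)"
      by (simp only: exchange(1)[OF R i] exchange(2)[OF R i, symmetric] unit_ten_thom(2)[OF R])
    from seq_ext[OF this] have "(\<^bold>1 X \<boxtimes> \<langle>Iota p\<rangle>) \<rhd> (R \<boxtimes> \<^bold>1 [(ounit C, p)]) \<rhd> (\<^bold>1 Y \<boxtimes> \<langle>Kappa p\<rangle>)
      = R \<rhd> (\<^bold>1 Y \<boxtimes> \<langle>Iota p\<rangle>) \<rhd> (\<^bold>1 Y \<boxtimes> \<langle>Kappa p\<rangle>)"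
      by (simp only: tseq_assoc)
    also have "\<dots> = R"
      by (simp only: iota_kappa_whisker id_ten_id append_Nil2 seq_id[OF R])
    finally show ?thesis .
  qed
  from this[OF assms(1)] this[OF assms(2)] assms(3) show ?thesis by metis
qed

lemma straight_ten_unit:
  assumes "wf_t C t" "straight (t \<star> \<one>\<^sub>T [(ounit C, p)])"
  shows "straight t"
proof -
  let ?b = "\<langle>bend (horiz t)\<rangle>" and ?X = "tdom C t" and ?Y = "tcod C t" and ?u = "[(ounit C, p)]" and ?I = "[(ounit C, White)]"
  note p = wf_t_boundaries[OF assms(1)]
  have b: "?b \<in> thom (?I @ ?X) (?Y @ ?I)" using assms(1) by (intro thom_gen) simp_all
  have k: "\<^bold>1 ?Y \<boxtimes> kap \<in> thom (?Y @ ?I) ?Y" 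
    using p thom_cls[of "\<one>\<^sub>T (tcod C t) \<star> Kappa White"] by (simp add: tcls_ten)
  have t: "(kap \<boxtimes> \<^bold>1 ?X) \<rhd> \<langle>t\<rangle> \<in> thom (?I @ ?X) ?Y"
    using p assms(1) thom_cls[of "(Kappa White \<star> \<one>\<^sub>T (tdom C t)) ;; t"] by (simp add: tcls_ten tcls_seq)
  have "?b \<boxtimes> \<^bold>1 ?u \<rhd> \<^bold>1 ?Y \<boxtimes> kap \<boxtimes> \<^bold>1 ?u \<rhd> \<^bold>1 (?Y @ ?u) \<boxtimes> iot 
    = kap \<boxtimes> \<^bold>1 (?X @ ?u) \<rhd> \<langle>t\<rangle> \<boxtimes> \<^bold>1 ?u \<rhd> \<^bold>1 (?Y @ ?u) \<boxtimes> iot"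
    using assms p by (simp add: straight_def bend_norm horiz.simps)
  \<comment> \<open>A final \<kappa> removes the trailing \<iota> and leaves the unit letter as a
    common factor on the right, where it can be cancelled; the \<iota> is restored at the
    end.\<close>
  then have "(?b \<boxtimes> \<^bold>1 ?u \<rhd> \<^bold>1 ?Y \<boxtimes> kap \<boxtimes> \<^bold>1 ?u \<rhd> \<^bold>1 (?Y @ ?u) \<boxtimes> iot) \<rhd> \<^bold>1 (?Y @ ?u) \<boxtimes> kap
    = (kap \<boxtimes> \<^bold>1 (?X @ ?u) \<rhd> \<langle>t\<rangle> \<boxtimes> \<^bold>1 ?u \<rhd> \<^bold>1 (?Y @ ?u) \<boxtimes> iot) \<rhd> \<^bold>1 (?Y @ ?u) \<boxtimes> kap"
    by simp
  then have "(?b \<rhd> \<^bold>1 ?Y \<boxtimes> kap) \<boxtimes> \<^bold>1 ?u = (kap \<boxtimes> \<^bold>1 ?X \<rhd> \<langle>t\<rangle>) \<boxtimes> \<^bold>1 ?u"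
    using assms(1) p by (simp add: strict iota_kappa_whisker id_elim)
  then have "?b \<rhd> \<^bold>1 ?Y \<boxtimes> kap = kap \<boxtimes> \<^bold>1 ?X \<rhd> \<langle>t\<rangle>"
    using ten_unit_cancel[OF thom_seqI[OF b k] t] by simp
  then have "(?b \<rhd> \<^bold>1 ?Y \<boxtimes> kap) \<rhd> \<^bold>1 ?Y \<boxtimes> iot = (kap \<boxtimes> \<^bold>1 ?X \<rhd> \<langle>t\<rangle>) \<rhd> \<^bold>1 ?Y \<boxtimes> iot"
    by simp
  then show ?thesis
    using b by (simp add: straight_def tseq_assoc kappa_iota_whisker id_ten_id seq_id)
qed

text \<open>The braiding drawn inside the white split undoes the crossing contained in
  \<open>Unjoin\<close>. The next lemma is the counterpart for the white merge and
  \<open>Join\<close>.\<close>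

lemma braid_unjoin:
  assumes "A \<in> obj C" "B \<in> obj C"
  shows "\<langle>Map White (\<sigma> A B)\<rangle> \<rhd> \<langle>Unjoin B A\<rangle> = sp A B"
proof -
  have "sp A B \<rhd> br A B \<rhd> br B A = \<langle>Map White (\<sigma> A B)\<rangle> \<rhd> \<langle>Unjoin B A\<rangle>"
    using assms map_white_braid[OF assms, symmetric]
    by (simp add: Unjoin_def tcls_seq tseq_assoc split_merge[THEN seq_ext] id_elim base_simps)
  then show ?thesis using assms by (simp add: sigma_sigma id_elim)
qed

lemma join_braid:
  assumes "A \<in> obj C" "B \<in> obj C"
  shows "\<langle>Join B A\<rangle> \<rhd> \<langle>Map White (\<sigma> B A)\<rangle> = mg A B"
proof -
  have "br A B \<rhd> br B A \<rhd> mg A B = \<langle>Join B A\<rangle> \<rhd> \<langle>Map White (\<sigma> B A)\<rangle>"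
    using assms map_white_braid[OF assms(2,1), symmetric]
    by (simp add: Join_def tcls_seq tseq_assoc split_merge id_elim base_simps)
  then show ?thesis using assms by (simp add: sigma_sigma[THEN seq_ext] id_elim)
qed

lemma straight_map: "f \<in> arr C \<Longrightarrow> straight (Map p f)"
proof (cases p)
  case White
  assume "f \<in> arr C"
  then show ?thesis using White by (simp add: straight_def horiz.simps bend_norm)
next
  case Black
  assume f: "f \<in> arr C"
  \<comment> \<open>Bending produces the mate of the white map under \<eta> and \<epsilon>.
    Dinaturality replaces the white map by the black one, and a snake removes the remaining cup and
    cap.\<close>
  have "\<langle>Map Black f\<rangle> = \<langle>Eta (src C f)\<rangle> \<boxtimes> \<^bold>1 ((tgt C f)\<^sup>\<bullet>) \<rhd> \<^bold>1 ((src C f)\<^sup>\<bullet>) \<boxtimes> \<langle>Map White f\<rangle> \<boxtimes> \<^bold>1 ((tgt C f)\<^sup>\<bullet>) \<rhd> \<^bold>1 ((src C f)\<^sup>\<bullet>) \<boxtimes> \<langle>Eps (tgt C f)\<rangle>"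
    using f t_eta_dinat[OF f, THEN t_class_eq, unfolded tcls_seq tcls_ten strict, THEN whisker_eq(2), of "(tgt C f)\<^sup>\<bullet>", THEN seq_ext]
      slide[of "Map Black f" "Eps (tgt C f)" "[]" "[]" "[]", simplified strict, symmetric] snake_black[of "tgt C f", THEN seq_ext]
    by (simp add: strict base_simps id_elim)
  then show ?thesis using f Black by (simp add: straight_def horiz.simps bend_norm tgt_obj)
qed

lemma straight_split:
  assumes "A \<in> obj C" "B \<in> obj C"
  shows "straight (Split p A B)"
proof (cases p)
  case White
  then show ?thesis using assms braid_unjoin[OF assms, THEN seq_ext]
    by (simp add: straight_def horiz.simps bend_norm join_unit iota_kappa_whisker id_elim base_simps)
next
  case Black
  let ?AB = "(A \<odot> B)\<^sup>\<bullet>"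
  \<comment> \<open>The black split is the mate of the white \<open>Join\<close>: the equation for
    \<eta> of a product trades one for the other, and a snake finishes.\<close>
  have "\<langle>Split Black A B\<rangle> = \<langle>Eta A\<rangle> \<boxtimes> \<^bold>1 ?AB \<rhd> \<^bold>1 (A\<^sup>\<bullet>) \<boxtimes> \<langle>Eta B\<rangle> \<boxtimes> \<^bold>1 [(A, White), (A \<odot> B, Black)]
    \<rhd> \<^bold>1 [(A, Black), (B, Black)] \<boxtimes> \<langle>Join A B\<rangle> \<boxtimes> \<^bold>1 ?AB \<rhd> \<^bold>1 [(A, Black), (B, Black)] \<boxtimes> \<langle>Eps (A \<odot> B)\<rangle>"
    using assms t_eta_split_black[OF assms, THEN t_class_eq, unfolded Nest_eta_def tcls_seq tcls_ten strict, THEN whisker_eq(2), of ?AB, THEN seq_ext, unfolded strict, symmetric]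
      slide[of "Split Black A B" "Eps (A \<odot> B)" "[]" "[]" "[]", simplified strict, symmetric] snake_black[of "A \<odot> B", THEN seq_ext]
    by (simp add: strict base_simps id_elim Join_def tcls_seq)
  then show ?thesis using assms Black
    by (simp add: straight_def horiz.simps bend_norm unjoin_unit iota_kappa_whisker id_elim base_simps)
qed

lemma straight_merge:
  assumes "A \<in> obj C" "B \<in> obj C"
  shows "straight (Merge p A B)"
proof (cases p)
  case White
  then show ?thesis using assms join_braid[OF assms, THEN seq_ext]
    by (simp add: straight_def horiz.simps bend_norm unjoin_unit iota_kappa_whisker id_elim base_simps)
next
  case Black
  let ?AB = "(A \<odot> B)\<^sup>\<bullet>"
  \<comment> \<open>Dually, the black merge is the mate of the white \<open>Unjoin\<close>, by the
    equation for \<epsilon> of a product.\<close>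
  have "\<langle>Merge Black A B\<rangle> = \<langle>Eta (A \<odot> B)\<rangle> \<boxtimes> \<^bold>1 [(A, Black), (B, Black)] \<rhd> \<^bold>1 ?AB \<boxtimes> \<langle>Unjoin A B\<rangle> \<boxtimes> \<^bold>1 [(A, Black), (B, Black)]
    \<rhd> \<^bold>1 [(A \<odot> B, Black), (B, White)] \<boxtimes> \<langle>Eps A\<rangle> \<boxtimes> \<^bold>1 (B\<^sup>\<bullet>) \<rhd> \<^bold>1 ?AB \<boxtimes> \<langle>Eps B\<rangle>"
    using assms t_merge_black_eps[OF assms, THEN t_class_eq, unfolded Nest_eps_def tcls_seq tcls_ten strict, THEN whisker_eq(1), of ?AB, unfolded strict, symmetric]
      slide[of "Eta (A \<odot> B)" "Merge Black A B" "[]" "[]" "[]", simplified strict, THEN seq_ext, symmetric] snake_black[of "A \<odot> B"]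
    by (simp add: strict base_simps id_elim Unjoin_def tcls_seq)
  then show ?thesis using assms Black
    by (simp add: straight_def horiz.simps bend_norm join_unit iota_kappa_whisker id_elim base_simps)
qed

lemma straight_sigma:
  assumes "A \<in> obj C" "B \<in> obj C"
  shows "straight (Sigma p A B)"
proof (cases p)
  case White
  have "straight (Merge White A B ;; Map White (\<sigma> A B) ;; Split White B A)"
    using assms by (intro straight_seq straight_merge straight_map straight_split) (simp_all add: base_simps)
  then show ?thesis using White straight_transport[OF t_map_white_braid[OF assms]] by simp
next
  case Black
  have "straight (Merge Black A B ;; Map Black (\<sigma> B A) ;; Split Black B A)"
    using assms by (intro straight_seq straight_merge straight_map straight_split) (simp_all add: base_simps)
  then show ?thesis using Black straight_transport[OF t_map_black_braid[OF assms]] by simp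
qed

text \<open>No equation relates \<open>\<iota>\<^sup>\<bullet>\<close> and \<open>\<kappa>\<^sup>\<bullet>\<close> to \<open>\<eta>\<close> and \<open>\<epsilon>\<close> directly; they are reached through the
  splitting and merging of the unit object.\<close>

lemma iota_is_split:
  "t_eq C (Split p (ounit C) (ounit C)) (Iota p \<star> \<one>\<^sub>T [(ounit C, p)])"
  "t_eq C (Merge p (ounit C) (ounit C)) (Kappa p \<star> \<one>\<^sub>T [(ounit C, p)])"
proof -
  let ?s = "\<langle>Split p (ounit C) (ounit C)\<rangle>" and ?m = "\<langle>Merge p (ounit C) (ounit C)\<rangle>" and ?I = "[(ounit C, p)]"
  have s: "?s \<rhd> \<langle>Kappa p\<rangle> \<boxtimes> \<^bold>1 ?I = \<^bold>1 ?I"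
    using t_split_kappa_left[of "ounit C" C p, THEN t_class_eq, unfolded tcls_seq tcls_ten strict] by simp
  have "?s \<rhd> (\<langle>Kappa p\<rangle> \<rhd> \<langle>Iota p\<rangle>) \<boxtimes> \<^bold>1 ?I = \<langle>Iota p\<rangle> \<boxtimes> \<^bold>1 ?I"
    by (simp add: strict s[THEN seq_ext] id_elim)
  then have "?s = \<langle>Iota p\<rangle> \<boxtimes> \<^bold>1 ?I" by (simp add: kappa_iota id_ten_id id_elim obj_closed)
  then have "\<langle>Split p (ounit C) (ounit C)\<rangle> = \<langle>Iota p \<star> \<one>\<^sub>T ?I\<rangle>" by (simp add: tcls_ten)
  then show "t_eq C (Split p (ounit C) (ounit C)) (Iota p \<star> \<one>\<^sub>T ?I)"
    using eq_equiv_class[OF _ equiv_t] by (simp add: t_rel_iff)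
  have "?m = ?m \<rhd> ?s \<rhd> \<langle>Kappa p\<rangle> \<boxtimes> \<^bold>1 ?I" by (simp add: s id_elim obj_closed)
  also have "\<dots> = \<langle>Kappa p\<rangle> \<boxtimes> \<^bold>1 ?I" by (simp add: merge_split[THEN seq_ext] id_elim)
  finally have "\<langle>Merge p (ounit C) (ounit C)\<rangle> = \<langle>Kappa p \<star> \<one>\<^sub>T ?I\<rangle>" by (simp add: tcls_ten)
  then show "t_eq C (Merge p (ounit C) (ounit C)) (Kappa p \<star> \<one>\<^sub>T ?I)"
    using eq_equiv_class[OF _ equiv_t] by (simp add: t_rel_iff)
qed

theorem bend_horiz: "wf_t C t \<Longrightarrow> straight t"
proof (induction t)
  case (Iota p)
  show ?case
    by (rule straight_ten_unit[of _ p], simp, rule straight_transport[OF iota_is_split(1)], rule straight_split) simp_all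
next
  case (Kappa p)
  show ?case
    by (rule straight_ten_unit[of _ p], simp, rule straight_transport[OF iota_is_split(2)], rule straight_merge) simp_all
next
  case (Eta A)
  then show ?case by (simp add: straight_def horiz.simps bend_norm)
next
  case (Eps A)
  then show ?case by (simp add: straight_def horiz.simps bend_norm)
qed (simp_all add: straight_id straight_seq straight_ten straight_map straight_split straight_merge straight_sigma)

section \<open>Drawing a bent cell gives the cell back\<close>

lemma hseq_eq_vseq:
  assumes "wf_cell C a" "wf_cell C c" "tright a = []" "tleft c = []" "tbot C a = ounit C" "ttop C c = ounit C"
  shows "\<guillemotleft>a\<guillemotright> \<interleave> \<guillemotleft>c\<guillemotright> = \<guillemotleft>a\<guillemotright> \<Sslash> \<guillemotleft>c\<guillemotright>"
  using hpol_above[of a c White] assms by (simp add: hseq_hid_unit)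

text \<open>The crossing contained in \<open>Join\<close> or \<open>Unjoin\<close> cancels the
  braiding drawn in the white merge or split, so only corners are left.\<close>

lemma horiz_join:
  assumes "A \<in> obj C" "B \<in> obj C"
  shows "\<guillemotleft>horiz (Unjoin A B)\<guillemotright> = \<guillemotleft>RW (A \<odot> B)\<guillemotright> \<Sslash> (\<guillemotleft>HId A\<guillemotright> \<interleave> \<guillemotleft>SW B\<guillemotright>) \<Sslash> \<guillemotleft>SW A\<guillemotright>"
    "\<guillemotleft>horiz (Join A B)\<guillemotright> = \<guillemotleft>RW B\<guillemotright> \<Sslash> (\<guillemotleft>RW A\<guillemotright> \<interleave> \<guillemotleft>HId B\<guillemotright>) \<Sslash> \<guillemotleft>SW (A \<odot> B)\<guillemotright>"
proof -
  have "\<guillemotleft>horiz (Unjoin A B)\<guillemotright> = \<guillemotleft>via White [A \<odot> B] (idt C (A \<odot> B)) [B, A]\<guillemotright>"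
    "\<guillemotleft>horiz (Join A B)\<guillemotright> = \<guillemotleft>via White [B, A] (idt C (A \<odot> B)) [A \<odot> B]\<guillemotright>"
    using assms by (simp_all add: Unjoin_def Join_def horiz_push via_calc typed_def base_calc)
  then show "\<guillemotleft>horiz (Unjoin A B)\<guillemotright> = \<guillemotleft>RW (A \<odot> B)\<guillemotright> \<Sslash> (\<guillemotleft>HId A\<guillemotright> \<interleave> \<guillemotleft>SW B\<guillemotright>) \<Sslash> \<guillemotleft>SW A\<guillemotright>"
    "\<guillemotleft>horiz (Join A B)\<guillemotright> = \<guillemotleft>RW B\<guillemotright> \<Sslash> (\<guillemotleft>RW A\<guillemotright> \<interleave> \<guillemotleft>HId B\<guillemotright>) \<Sslash> \<guillemotleft>SW (A \<odot> B)\<guillemotright>"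
    using assms
    by (simp_all add: via_def ccls_v recv_send_short box_idt vseq_hid vseq_hid_ext base_simps vseq_assoc del: recv.simps send.simps)
qed

theorem horiz_bend: "wf_cell C a \<Longrightarrow> \<guillemotleft>horiz (bend a)\<guillemotright> = \<guillemotleft>RW (ttop C a)\<guillemotright> \<Sslash> \<guillemotleft>a\<guillemotright> \<Sslash> \<guillemotleft>SW (tbot C a)\<guillemotright>"
proof (induction a)
  case (HId A)
  then show ?case using vseq_yank[of A White] by (simp add: horiz.simps vseq_hid_ext vseq_hid)
next
  case (VId X)
  let ?I = "HId (ounit C)"
  \<comment> \<open>Padding with the unit edge puts the word \<open>X\<close> of both factors into
    the middle layer, with the two corners above and below it.\<close>
  have "(\<guillemotleft>RW (ounit C)\<guillemotright> \<Sslash> \<guillemotleft>VId X\<guillemotright> \<Sslash> \<guillemotleft>?I\<guillemotright>) \<interleave> (\<guillemotleft>?I\<guillemotright> \<Sslash> \<guillemotleft>VId X\<guillemotright> \<Sslash> \<guillemotleft>SW (ounit C)\<guillemotright>)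
    = \<guillemotleft>RW (ounit C)\<guillemotright> \<Sslash> \<guillemotleft>VId X\<guillemotright> \<Sslash> \<guillemotleft>SW (ounit C)\<guillemotright>"
    using VId by (subst hseq_interchange3) (simp_all add: hseq_vid hseq_hid_unit)
  then show ?case using VId by (simp add: horiz_push horiz.simps vseq_hid vseq_hid_ext)
next
  case (SW A)
  then show ?case using vseq_yank[of A White, THEN vseq_ext] by (simp add: horiz_push horiz.simps)
next
  case (RW A)
  then show ?case using vseq_yank[of A White] by (simp add: horiz_push horiz.simps)
next
  case (SB A)
  then show ?case using hseq_eq_vseq[of "RW A \<div> SB A" "SW (ounit C)"] by (simp add: ccls_push horiz.simps)
next
  case (RB A)
  then show ?case using hseq_eq_vseq[of "RW (ounit C)" "RB A \<div> SW A"] by (simp add: ccls_push horiz.simps)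
next
  case (Box f)
  then show ?case by (simp add: ccls_push horiz.simps)
next
  case (HComp a b)
  let ?I = "HId (ounit C)"
  let ?A = "ttop C a" and ?A' = "ttop C b" and ?B = "tbot C a" and ?B' = "tbot C b"
  have w: "wf_cell C a" "wf_cell C b" "tright a = tleft b" using HComp.prems by auto
  note s = w base_simps hseq_vid hseq_hid_unit hseq_hid hseq_yank vseq_hid vseq_hid_ext
  \<comment> \<open>Each of the four layered interchanges yanks one pair of white corners introduced
    by bending: on \<open>?A\<close>, \<open>?B'\<close>, \<open>?B\<close> and \<open>?A'\<close>
    in this order. The third is used inside the bottom layer of the fourth.\<close>
  have "(\<guillemotleft>RW (?A \<odot> ?A') \<div> (HId ?A \<parallel> SW ?A')\<guillemotright> \<Sslash> \<guillemotleft>SW ?A\<guillemotright> \<Sslash> \<guillemotleft>VId (tleft a)\<guillemotright>) \<interleave> (\<guillemotleft>VId (?A'\<^sup>\<circ>)\<guillemotright> \<Sslash> \<guillemotleft>RW ?A\<guillemotright> \<Sslash> \<guillemotleft>a \<div> SW ?B\<guillemotright>)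
    = \<guillemotleft>RW (?A \<odot> ?A') \<div> (HId ?A \<parallel> SW ?A')\<guillemotright> \<Sslash> \<guillemotleft>a \<div> SW ?B\<guillemotright>"
    by (subst hseq_interchange3) (simp_all add: s)
  then have 1: "\<guillemotleft>horiz (Unjoin ?A ?A' \<star> \<one>\<^sub>T (tleft a))\<guillemotright> \<interleave> \<guillemotleft>horiz (\<one>\<^sub>T (?A'\<^sup>\<circ>) \<star> bend a)\<guillemotright>
    = \<guillemotleft>RW (?A \<odot> ?A')\<guillemotright> \<Sslash> (\<guillemotleft>HId ?A\<guillemotright> \<interleave> \<guillemotleft>SW ?A'\<guillemotright>) \<Sslash> \<guillemotleft>a\<guillemotright> \<Sslash> \<guillemotleft>SW ?B\<guillemotright>"
    using HComp w by (simp add: horiz_push horiz_join vseq_assoc)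
  have "(\<guillemotleft>RW ?A' \<div> b\<guillemotright> \<Sslash> \<guillemotleft>SW ?B'\<guillemotright> \<Sslash> \<guillemotleft>VId (?B\<^sup>\<circ>)\<guillemotright>) \<interleave> (\<guillemotleft>VId (tright b)\<guillemotright> \<Sslash> \<guillemotleft>RW ?B'\<guillemotright> \<Sslash> \<guillemotleft>(RW ?B \<parallel> HId ?B') \<div> SW (?B \<odot> ?B')\<guillemotright>)
    = \<guillemotleft>RW ?A' \<div> b\<guillemotright> \<Sslash> \<guillemotleft>(RW ?B \<parallel> HId ?B') \<div> SW (?B \<odot> ?B')\<guillemotright>"
    by (subst hseq_interchange3) (simp_all add: s)
  then have 2: "\<guillemotleft>horiz (bend b \<star> \<one>\<^sub>T (?B\<^sup>\<circ>))\<guillemotright> \<interleave> \<guillemotleft>horiz (\<one>\<^sub>T (tright b) \<star> Join ?B ?B')\<guillemotright>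
    = \<guillemotleft>RW ?A'\<guillemotright> \<Sslash> \<guillemotleft>b\<guillemotright> \<Sslash> (\<guillemotleft>RW ?B\<guillemotright> \<interleave> \<guillemotleft>HId ?B'\<guillemotright>) \<Sslash> \<guillemotleft>SW (?B \<odot> ?B')\<guillemotright>"
    using HComp w by (simp add: horiz_push horiz_join vseq_assoc)
  have 3: "(\<guillemotleft>a\<guillemotright> \<Sslash> \<guillemotleft>SW ?B\<guillemotright> \<Sslash> \<guillemotleft>?I\<guillemotright>) \<interleave> (\<guillemotleft>b\<guillemotright> \<Sslash> \<guillemotleft>RW ?B \<parallel> HId ?B'\<guillemotright> \<Sslash> \<guillemotleft>SW (?B \<odot> ?B')\<guillemotright>)
    = (\<guillemotleft>a\<guillemotright> \<interleave> \<guillemotleft>b\<guillemotright>) \<Sslash> \<guillemotleft>SW (?B \<odot> ?B')\<guillemotright>"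
    by (subst hseq_interchange3) (simp_all add: s ccls_h hseq_yank[THEN hseq_ext])
  have 4: "(\<guillemotleft>RW (?A \<odot> ?A')\<guillemotright> \<Sslash> \<guillemotleft>HId ?A \<parallel> SW ?A'\<guillemotright> \<Sslash> \<guillemotleft>a \<div> (SW ?B \<div> ?I)\<guillemotright>) \<interleave> 
      (\<guillemotleft>?I\<guillemotright> \<Sslash> \<guillemotleft>RW ?A'\<guillemotright> \<Sslash> \<guillemotleft>b \<div> ((RW ?B \<parallel> HId ?B') \<div> SW (?B \<odot> ?B'))\<guillemotright>)
    = \<guillemotleft>RW (?A \<odot> ?A')\<guillemotright> \<Sslash> \<guillemotleft>HId (?A \<odot> ?A')\<guillemotright> \<Sslash> (\<guillemotleft>a\<guillemotright> \<interleave> \<guillemotleft>b\<guillemotright>) \<Sslash> \<guillemotleft>SW (?B \<odot> ?B')\<guillemotright>"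
    using 3 by (subst hseq_interchange3) (simp_all add: s ccls_h ccls_v hseq_assoc)
  have "\<guillemotleft>horiz (bend (a \<parallel> b))\<guillemotright> = (\<guillemotleft>RW (?A \<odot> ?A')\<guillemotright> \<Sslash> (\<guillemotleft>HId ?A\<guillemotright> \<interleave> \<guillemotleft>SW ?A'\<guillemotright>) \<Sslash> \<guillemotleft>a\<guillemotright> \<Sslash> \<guillemotleft>SW ?B\<guillemotright>)
    \<interleave> (\<guillemotleft>RW ?A'\<guillemotright> \<Sslash> \<guillemotleft>b\<guillemotright> \<Sslash> (\<guillemotleft>RW ?B\<guillemotright> \<interleave> \<guillemotleft>HId ?B'\<guillemotright>) \<Sslash> \<guillemotleft>SW (?B \<odot> ?B')\<guillemotright>)"
    by (simp only: bend.simps horiz.simps(2) ccls_h hseq_assoc flip: 1 2)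
  also have "\<dots> = \<guillemotleft>RW (?A \<odot> ?A')\<guillemotright> \<Sslash> (\<guillemotleft>a\<guillemotright> \<interleave> \<guillemotleft>b\<guillemotright>) \<Sslash> \<guillemotleft>SW (?B \<odot> ?B')\<guillemotright>"
    using 4 by (simp add: s ccls_h ccls_v)
  finally show ?case by (simp add: ccls_h)
next
  case (VComp a b)
  have w: "wf_cell C a" "wf_cell C b" "tbot C a = ttop C b" using VComp.prems by auto
  have "(\<guillemotleft>RW (ttop C a) \<div> a\<guillemotright> \<Sslash> \<guillemotleft>SW (tbot C a)\<guillemotright> \<Sslash> \<guillemotleft>VId (tleft b)\<guillemotright>) \<interleave> (\<guillemotleft>VId (tright a)\<guillemotright> \<Sslash> \<guillemotleft>RW (ttop C b)\<guillemotright> \<Sslash> \<guillemotleft>b \<div> SW (tbot C b)\<guillemotright>)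
    = \<guillemotleft>RW (ttop C a) \<div> a\<guillemotright> \<Sslash> \<guillemotleft>b \<div> SW (tbot C b)\<guillemotright>"
    using w by (subst hseq_interchange3) (simp_all add: hseq_vid hseq_yank vseq_hid_ext vseq_hid)
  then show ?case using VComp w by (simp add: horiz_push vseq_assoc)
qed

text \<open>This gives fullness. The corners on the unit object that surround a bent cell are yanked
  off by the corners that \<open>Iota\<close> and \<open>Kappa\<close> draw.\<close>

lemma horiz_unbend:
  assumes "wf_cell C a" "ttop C a = ounit C" "tbot C a = ounit C"
  shows "\<guillemotleft>horiz ((Iota White \<star> \<one>\<^sub>T (tleft a)) ;; bend a ;; (\<one>\<^sub>T (tright a) \<star> Kappa White))\<guillemotright> = \<guillemotleft>a\<guillemotright>"
proof -
  let ?u = "ounit C" and ?I = "HId (ounit C)"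
  have "(\<guillemotleft>SW ?u\<guillemotright> \<Sslash> \<guillemotleft>VId (tleft a)\<guillemotright> \<Sslash> \<guillemotleft>?I\<guillemotright>) \<interleave> (\<guillemotleft>RW ?u\<guillemotright> \<Sslash> \<guillemotleft>a\<guillemotright> \<Sslash> \<guillemotleft>SW ?u\<guillemotright>) = \<guillemotleft>a\<guillemotright> \<Sslash> \<guillemotleft>SW ?u\<guillemotright>"
    using assms by (subst hseq_interchange3) (simp_all add: hseq_vid hseq_yank hseq_hid_unit vseq_hid_ext)
  moreover have "(\<guillemotleft>a\<guillemotright> \<Sslash> \<guillemotleft>SW ?u\<guillemotright>) \<interleave> (\<guillemotleft>VId (tright a)\<guillemotright> \<Sslash> \<guillemotleft>RW ?u\<guillemotright>) = \<guillemotleft>a\<guillemotright>"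
    using assms hpol_interchange[of a "SW ?u" "VId (tright a)" "RW ?u" White]
    by (simp add: ccls_push hseq_vid hseq_yank vseq_hid)
  ultimately show ?thesis
    using assms by (simp add: horiz_push horiz.simps horiz_bend vseq_hid)
qed

section \<open>The isomorphism\<close>

definition "to_cell S = qval (\<lambda>t. \<guillemotleft>horiz t\<guillemotright>) S"

lemma to_cell: "wf_t C t \<Longrightarrow> to_cell \<langle>t\<rangle> = \<guillemotleft>horiz t\<guillemotright>"
  unfolding to_cell_def by (rule t_qval) (simp_all add: horiz_sound)

lemma horiz_faithful:
  assumes "wf_t C t" "wf_t C u" "\<guillemotleft>horiz t\<guillemotright> = \<guillemotleft>horiz u\<guillemotright>"
  shows "\<langle>t\<rangle> = \<langle>u\<rangle>"
proof -
  have e: "cell_eq C (horiz t) (horiz u)"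
    using assms eq_equiv_class[OF _ equiv_cell, of "horiz t" "horiz u"] by (simp add: cell_rel_iff)
  then have b: "tdom C t = tdom C u" "tcod C t = tcod C u"
    using cell_eq_wf[OF e] assms by simp_all
  \<comment> \<open>Composing with \<iota> and \<kappa> strips the extra unit letters from
    \<open>straight\<close>, so the class of \<open>v\<close> can be read off from its bent drawing
    together with its source and target.\<close>
  have "(iot \<boxtimes> \<^bold>1 (tdom C v)) \<rhd> \<langle>bend (horiz v)\<rangle> \<rhd> (\<^bold>1 (tcod C v) \<boxtimes> kap) = \<langle>v\<rangle>" if "wf_t C v" for v
    using bend_horiz[OF that] that wf_t_boundaries[OF that]
    by (simp add: straight_def tseq_assoc iota_kappa_whisker id_ten_id id_elim)
  from this[OF assms(1)] this[OF assms(2)] show ?thesis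
    using bend_sound[OF e] b by simp
qed

lemma horizontal_simps:
  "obj (\<^bold>H (\<C> C)) = pwords C" "src (\<^bold>H (\<C> C)) = cleft (\<C> C)" "tgt (\<^bold>H (\<C> C)) = cright (\<C> C)"
  "idt (\<^bold>H (\<C> C)) X = \<guillemotleft>VId X\<guillemotright>" "h \<Zsemi>\<^bsub>\<^bold>H (\<C> C)\<^esub> k = h \<interleave> k"
  "wf_cell C a \<Longrightarrow> \<guillemotleft>a\<guillemotright> \<in> arr (\<^bold>H (\<C> C)) \<longleftrightarrow> ttop C a = ounit C \<and> tbot C a = ounit C"
  by (simp_all add: horizontal_cells_def free_cornering_simps)
    (simp_all add: free_cornering_def pword_monoid_def obj_monoid_def)

lemma horizontal_arrE:
  assumes "h \<in> arr (\<^bold>H (\<C> C))"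
  obtains a where "wf_cell C a" "ttop C a = ounit C" "tbot C a = ounit C" "h = \<guillemotleft>a\<guillemotright>"
proof -
  have "h \<in> cells (\<C> C)" using assms by (simp add: horizontal_cells_def)
  then obtain a where "wf_cell C a" "h = \<guillemotleft>a\<guillemotright>" by (rule free_cornering_cellE)
  then show ?thesis using assms that by (simp add: horizontal_simps)
qed

lemma to_cell_functor: "cat_functor (\<T> C) (\<^bold>H (\<C> C)) id to_cell"
proof -
  interpret T: spatial_strict_monoidal_category "\<T> C" by (rule T_spatial)
  interpret H: strict_monoidal_category "\<^bold>H (\<C> C)"
    by (rule single_object_double_category.horizontal_cells_strict_monoidal[OF free_cornering_double_category])
  show ?thesis
    by unfold_locales (auto elim!: T_arrE
      simp: T_simps T_comp to_cell horizontal_simps free_cornering_simps horiz_push)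
qed

lemma to_cell_bij: "bij_betw to_cell (arr (\<T> C)) (arr (\<^bold>H (\<C> C)))"
proof (rule bij_betw_imageI)
  show "inj_on to_cell (arr (\<T> C))"
    by (rule inj_onI, elim T_arrE) (metis to_cell horiz_faithful)
  show "to_cell ` arr (\<T> C) = arr (\<^bold>H (\<C> C))"
  proof (intro equalityI subsetI)
    fix h assume "h \<in> arr (\<^bold>H (\<C> C))"
    then obtain a where a: "wf_cell C a" "ttop C a = ounit C" "tbot C a = ounit C" "h = \<guillemotleft>a\<guillemotright>"
      by (rule horizontal_arrE)
    \<comment> \<open>The preimage is the bent cell with the unit letters of its trivial top and
      bottom removed.\<close>
    let ?t = "(Iota White \<star> \<one>\<^sub>T (tleft a)) ;; bend a ;; (\<one>\<^sub>T (tright a) \<star> Kappa White)"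
    have "wf_t C ?t" using a by simp
    then show "h \<in> to_cell ` arr (\<T> C)"
      using a to_cell[of ?t] horiz_unbend[OF a(1-3)] T_simps(1)[of ?t] by (metis imageI)
  qed (auto elim!: T_arrE simp: to_cell horizontal_simps)
qed

end

theorem corollary7p2:
  fixes \<A> :: "('o, 'm, 'z) symmetric_category_scheme"
  assumes "symmetric_strict_monoidal_category \<A>"
  shows "\<^bold>H (\<C> \<A>) \<cong>\<^sub>C \<T> \<A>"
proof -
  interpret symmetric_strict_monoidal_category \<A> by fact
  show ?thesis
    using isomorphic_categoriesI[OF to_cell_functor _ to_cell_bij]
    by (simp add: T_simps horizontal_simps)
qed

end
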